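(* Let $\tau\in\mathbb H^+$, $\vartheta_k=\vartheta_k(\tau)$, and let the functions $\theta_1'$, $\theta_k$ be taken at $(A\tau+B|\tau)$ with $$A\tau+B=\frac{\nu}{2N}\tau+\frac{\mu}{2N},\qquad \nu,\mu\in\mathbb Z,\quad N\in\mathbb Z\setminus\{0\}.$$ Then the corresponding algebraic solutions $F(x,y)=0$ of the sixth Painlevé equation with Hitchin's parameters $\alpha=\beta=\gamma=\delta=\frac18$ have the following parametrization by single-valued functions of $\tau$: $$x=\frac{\vartheta_4^4}{\vartheta_3^4},\qquad y=\frac{\vartheta_4^2}{\vartheta_3^2}\,\frac{\theta_2}{\theta_1^2}\left\{\frac{\pi\,\vartheta_2^2\;\theta_3\,\theta_4}{\theta_1'+\pi i\frac{\nu}{N}\theta_1}-\theta_2\right\}.$$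
   Context: $\mathbb H^+$ is the upper half-plane. The sixth Painlevé equation with parameters $(\alpha,\beta,\gamma,\delta)$ is taken in the form $$y_{xx}=\tfrac12\Big(\tfrac1y+\tfrac1{y-1}+\tfrac1{y-x}\Big)y_x^2-\Big(\tfrac1x+\tfrac1{x-1}+\tfrac1{y-x}\Big)y_x+\frac{y(y-1)(y-x)}{x^2(x-1)^2}\Big\{\alpha-\beta\frac{x}{y^2}+\gamma\frac{x-1}{(y-1)^2}-\big(\delta-\tfrac12\big)\frac{x(x-1)}{(y-x)^2}\Big\}.$$ An algebraic solution is a solution $y(x)$ satisfying a polynomial relation $F(x,y)=0$. Theta functions: for integers $a,b$, $\theta\big[{a\atop b}\big](z|\tau)=\sum_{k\in\mathbb Z}\exp\big(\pi i(k+\tfrac a2)^2\tau+2\pi i(k+\tfrac a2)(z+\tfrac b2)\big)$, and $\theta_1=-\theta\big[{1\atop1}\big]$, $\theta_2=\theta\big[{1\atop0}\big]$, $\theta_3=\theta\big[{0\atop0}\big]$, $\theta_4=\theta\big[{0\atop1}\big]$; $\vartheta_k(\tau)=\theta_k(0|\tau)$; $\theta_1'(z|\tau)=\partial_z\theta_1(z|\tau)$. *)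

theory Defs
  imports
    "HOL-Complex_Analysis.Complex_Analysis"
    "HOL-Computational_Algebra.Computational_Algebra"
begin

definition upper_half_plane :: "complex set" where
  "upper_half_plane = {\<tau>. Im \<tau> > 0}"

definition theta_char :: "int \<Rightarrow> int \<Rightarrow> complex \<Rightarrow> complex \<Rightarrow> complex" where
  "theta_char a b z \<tau> =
     (\<Sum>\<^sub>\<infinity>k\<in>(UNIV :: int set).
        exp (pi * \<i> * (of_int k + of_int a / 2)\<^sup>2 * \<tau>
             + 2 * pi * \<i> * (of_int k + of_int a / 2) * (z + of_int b / 2)))"

definition theta1 :: "complex \<Rightarrow> complex \<Rightarrow> complex" where
  "theta1 z \<tau> = - theta_char 1 1 z \<tau>"

definition theta2 :: "complex \<Rightarrow> complex \<Rightarrow> complex" where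
  "theta2 z \<tau> = theta_char 1 0 z \<tau>"

definition theta3 :: "complex \<Rightarrow> complex \<Rightarrow> complex" where
  "theta3 z \<tau> = theta_char 0 0 z \<tau>"

definition theta4 :: "complex \<Rightarrow> complex \<Rightarrow> complex" where
  "theta4 z \<tau> = theta_char 0 1 z \<tau>"

definition theta1' :: "complex \<Rightarrow> complex \<Rightarrow> complex" where
  "theta1' z \<tau> = deriv (\<lambda>w. theta1 w \<tau>) z"

definition painleve6_rhs ::
  "complex \<Rightarrow> complex \<Rightarrow> complex \<Rightarrow> complex \<Rightarrow> complex \<Rightarrow> complex \<Rightarrow> complex \<Rightarrow> complex" where
  "painleve6_rhs \<alpha> \<beta> \<gamma> \<delta> x y y' =
     1/2 * (1/y + 1/(y - 1) + 1/(y - x)) * y'\<^sup>2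
     - (1/x + 1/(x - 1) + 1/(y - x)) * y'
     + y * (y - 1) * (y - x) / (x\<^sup>2 * (x - 1)\<^sup>2)
       * (\<alpha> - \<beta> * (x / y\<^sup>2) + \<gamma> * ((x - 1) / (y - 1)\<^sup>2)
          - (\<delta> - 1/2) * (x * (x - 1) / (y - x)\<^sup>2))"

text \<open>
  A single-valued branch of a solution of the sixth Painleve equation on an open set \<open>U\<close>
  on which no denominator of the equation vanishes.
\<close>
definition painleve6_solution_on ::
  "complex \<Rightarrow> complex \<Rightarrow> complex \<Rightarrow> complex \<Rightarrow> complex set \<Rightarrow> (complex \<Rightarrow> complex) \<Rightarrow> bool" where
  "painleve6_solution_on \<alpha> \<beta> \<gamma> \<delta> U Y \<longleftrightarrow>
     open U \<and> Y holomorphic_on U \<and>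
     (\<forall>x\<in>U. x \<noteq> 0 \<and> x \<noteq> 1 \<and> Y x \<noteq> 0 \<and> Y x \<noteq> 1 \<and> Y x \<noteq> x \<and>
            deriv (deriv Y) x = painleve6_rhs \<alpha> \<beta> \<gamma> \<delta> x (Y x) (deriv Y x))"

text \<open>
  A polynomial \<open>F(x,y)\<close> in two variables is an element of \<open>\<complex>[x][y]\<close>: the outer variable
  of \<^typ>\<open>complex poly poly\<close> is \<open>y\<close>, the inner one is \<open>x\<close>.
\<close>
definition eval_poly2 :: "complex poly poly \<Rightarrow> complex \<Rightarrow> complex \<Rightarrow> complex" where
  "eval_poly2 F x y = poly (poly F [:y:]) x"

definition algebraic_painleve6_solution_on ::
  "complex \<Rightarrow> complex \<Rightarrow> complex \<Rightarrow> complex \<Rightarrow> complex poly poly \<Rightarrow>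
   complex set \<Rightarrow> (complex \<Rightarrow> complex) \<Rightarrow> bool" where
  "algebraic_painleve6_solution_on \<alpha> \<beta> \<gamma> \<delta> F U Y \<longleftrightarrow>
     painleve6_solution_on \<alpha> \<beta> \<gamma> \<delta> U Y \<and> F \<noteq> 0 \<and> (\<forall>x\<in>U. eval_poly2 F x (Y x) = 0)"

definition hitchin_x :: "complex \<Rightarrow> complex" where
  "hitchin_x \<tau> = theta4 0 \<tau> ^ 4 / theta3 0 \<tau> ^ 4"

definition torsion_point :: "int \<Rightarrow> int \<Rightarrow> int \<Rightarrow> complex \<Rightarrow> complex" where
  "torsion_point \<nu> \<mu> N \<tau> = of_int \<nu> / (2 * of_int N) * \<tau> + of_int \<mu> / (2 * of_int N)"

definition hitchin_denom :: "int \<Rightarrow> int \<Rightarrow> int \<Rightarrow> complex \<Rightarrow> complex" where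
  "hitchin_denom \<nu> \<mu> N \<tau> =
     (let z = torsion_point \<nu> \<mu> N \<tau>
      in theta1' z \<tau> + pi * \<i> * (of_int \<nu> / of_int N) * theta1 z \<tau>)"

definition hitchin_y :: "int \<Rightarrow> int \<Rightarrow> int \<Rightarrow> complex \<Rightarrow> complex" where
  "hitchin_y \<nu> \<mu> N \<tau> =
     (let z = torsion_point \<nu> \<mu> N \<tau>
      in (theta4 0 \<tau>)\<^sup>2 / (theta3 0 \<tau>)\<^sup>2 * (theta2 z \<tau> / (theta1 z \<tau>)\<^sup>2)
         * (pi * (theta2 0 \<tau>)\<^sup>2 * theta3 z \<tau> * theta4 z \<tau> / hitchin_denom \<nu> \<mu> N \<tau>
            - theta2 z \<tau>))"

text \<open>
  The values of \<open>\<tau>\<close> at which \<open>hitchin_y\<close> has a vanishing denominator (division by zero being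
  zero in HOL, the value there is meaningless) or at which the right-hand side of the equation is
  singular because \<open>y\<close> equals \<open>0\<close>, \<open>1\<close> or \<open>x\<close>.
\<close>
definition hitchin_exceptional :: "int \<Rightarrow> int \<Rightarrow> int \<Rightarrow> complex set" where
  "hitchin_exceptional \<nu> \<mu> N =
     {\<tau> \<in> upper_half_plane. theta1 (torsion_point \<nu> \<mu> N \<tau>) \<tau> = 0 \<or> hitchin_denom \<nu> \<mu> N \<tau> = 0 \<or>
        hitchin_y \<nu> \<mu> N \<tau> = 0 \<or> hitchin_y \<nu> \<mu> N \<tau> = 1 \<or> hitchin_y \<nu> \<mu> N \<tau> = hitchin_x \<tau>}"

end

theory Submission
  imports Defs "HOL-Real_Asymp.Real_Asymp"
begin

text \<open>
  Hitchin's equation is the image, under an Okamoto transformation, of Picard's equation, the sixth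
  Painleve equation with \<open>\<alpha> = \<beta> = \<gamma> = 0\<close>, \<open>\<delta> = 0\<close> in the present sign convention. Picard's
  equation is solved by a section of the Legendre curve \<open>w\<^sup>2 = q (q - 1) (q - x)\<close> whose elliptic
  argument is \<open>A \<tau> + B\<close> with \<open>A\<close> and \<open>B\<close> constant, namely by
  \<open>q = - (\<vartheta>\<^sub>4\<^sup>2 / \<vartheta>\<^sub>3\<^sup>2) (\<theta>\<^sub>2 / \<theta>\<^sub>1)\<^sup>2\<close>. The transformation is \<open>y = q + 1 / (2 p)\<close>, where \<open>p\<close> is the
  Hamiltonian momentum of \<open>q\<close>. In theta functions \<open>p\<close> is proportional to
  \<open>(\<theta>\<^sub>1' + 2 \<pi> \<i> A \<theta>\<^sub>1) \<theta>\<^sub>1\<^sup>2 / (\<theta>\<^sub>2 \<theta>\<^sub>3 \<theta>\<^sub>4)\<close>, and \<open>y\<close> becomes the function of the theorem.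

  All theta identities come from one source, the product formula \<open>jtheta_product\<close>, a rearrangement
  of an absolutely convergent double series. It expresses products of theta functions at \<open>\<tau>\<close> by
  theta functions at \<open>2 \<tau>\<close>, and so it gives the quadratic relations, the addition formulas and the
  duplication formulas by polynomial algebra. Iterating \<open>\<tau> \<mapsto> 2 \<tau>\<close> down to the cusp \<open>\<i> \<infinity>\<close> shows
  that the theta constants do not vanish (\<open>theta_constants_nonzero\<close>) and that
  \<open>\<vartheta>\<^sub>1' = \<pi> \<vartheta>\<^sub>2 \<vartheta>\<^sub>3 \<vartheta>\<^sub>4\<close> (\<open>jacobi_derivative_formula\<close>). If \<open>z\<^sub>0\<close> is a zero of \<open>\<theta>\<^sub>1\<close>, then the addition
  formula makes \<open>\<theta>\<^sub>1 (a + z\<^sub>0) / \<theta>\<^sub>1 a\<close> an exponential in \<open>a\<close>, and comparing multipliers puts \<open>z\<^sub>0\<close> into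
  the lattice (\<open>theta1_zeros\<close>).

  The differential equation. Multiplying \<open>\<theta>\<^sub>k (A \<tau> + z | \<tau>)\<close> by a common exponential factor yields
  series that again satisfy the heat equation. Therefore derivatives along \<open>A \<tau> + B\<close> with respect to
  \<open>\<tau>\<close> are second derivatives with respect to \<open>z\<close>, and the latter are known from the quadratic
  relations. This gives first-order equations for \<open>t = \<vartheta>\<^sub>4\<^sup>2 / \<vartheta>\<^sub>3\<^sup>2\<close>, \<open>s = (\<theta>\<^sub>2 / \<theta>\<^sub>1)\<^sup>2\<close> and the
  logarithmic derivative of \<open>\<theta>\<^sub>1\<close> (\<open>t_deriv\<close>, \<open>s_deriv\<close>, \<open>Z_deriv\<close>), then the Hamiltonian system of
  Picard for \<open>(q, p)\<close>, then that of Hitchin for \<open>(y, p)\<close> (\<open>y_deriv\<close>, \<open>p_deriv\<close>), whose elimination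
  of \<open>p\<close> is the sixth Painleve equation. The same systems show that \<open>p\<close> is not identically zero and
  that \<open>y\<close> is not identically \<open>0\<close>, \<open>1\<close> or \<open>x\<close>, so the exceptional set is sparse.

  Algebraicity. Repeated addition expresses \<open>q\<close> at \<open>j u\<close> as a rational function of \<open>x\<close> and of \<open>q\<close> at
  \<open>u\<close>. At a point of exact order \<open>n\<close> the values of \<open>q\<close> at \<open>(n - 1) z\<close> and at \<open>z\<close> agree, and this is
  a nontrivial polynomial equation for \<open>q\<close> (\<open>picard_q_torsion_algebraic\<close>). Differentiating it shows
  that \<open>dq/dx\<close>, hence \<open>p\<close>, hence \<open>y\<close>, is a rational function of \<open>x\<close> and \<open>q\<close>, and a rational function
  of \<open>x\<close> and an algebraic function is algebraic (\<open>rational_function_algebraic\<close>).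
\<close>

section \<open>Theta series with polynomial weights\<close>

text \<open>
  Locally uniform limits of holomorphic functions may be differentiated under the limit; here the limit
  runs over the finite partial sums of an unordered series, and the second bound identifies the limit of
  the differentiated partial sums.
\<close>
lemma has_field_derivative_infsum_M_test:
  fixes f f' :: "int \<Rightarrow> complex \<Rightarrow> complex"
  assumes "0 < R"
    and deriv: "\<And>k w. w \<in> cball z R \<Longrightarrow> (f k has_field_derivative f' k w) (at w)"
    and bound: "\<And>k w. w \<in> cball z R \<Longrightarrow> norm (f k w) \<le> M k" "M summable_on UNIV"
    and bound': "\<And>k. norm (f' k z) \<le> M' k" "M' summable_on UNIV"
  shows "((\<lambda>w. \<Sum>\<^sub>\<infinity>k. f k w) has_field_derivative (\<Sum>\<^sub>\<infinity>k. f' k z)) (at z)"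
proof -
  have ul: "uniform_limit (cball z R) (\<lambda>X w. \<Sum>k\<in>X. f k w) (\<lambda>w. \<Sum>\<^sub>\<infinity>k. f k w) (finite_subsets_at_top UNIV)"
    by (rule Weierstrass_m_test_general[OF _ bound(2)]) (use bound(1) in auto)
  have ev: "\<forall>\<^sub>F X in finite_subsets_at_top UNIV. continuous_on (cball z R) (\<lambda>w. \<Sum>k\<in>X. f k w) \<and>
          (\<forall>w\<in>ball z R. ((\<lambda>w. \<Sum>k\<in>X. f k w) has_field_derivative (\<Sum>k\<in>X. f' k w)) (at w))"
  proof (intro always_eventually allI conjI ballI)
    fix X :: "int set"
    have *: "((\<lambda>w. \<Sum>k\<in>X. f k w) has_field_derivative (\<Sum>k\<in>X. f' k w)) (at w)" if "w \<in> cball z R" for w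
      by (rule DERIV_sum) (use deriv that in auto)
    then show "continuous_on (cball z R) (\<lambda>w. \<Sum>k\<in>X. f k w)"
      using DERIV_isCont continuous_at_imp_continuous_on by blast
    show "((\<lambda>w. \<Sum>k\<in>X. f k w) has_field_derivative (\<Sum>k\<in>X. f' k w)) (at w)" if "w \<in> ball z R" for w
      using * that by auto
  qed
  obtain g' where g': "\<And>w. w \<in> ball z R \<Longrightarrow> ((\<lambda>w. \<Sum>\<^sub>\<infinity>k. f k w) has_field_derivative (g' w)) (at w) \<and>
        ((\<lambda>X. \<Sum>k\<in>X. f' k w) \<longlongrightarrow> g' w) (finite_subsets_at_top UNIV)"
    using has_complex_derivative_uniform_limit[OF ev ul] \<open>0 < R\<close> by auto
  have "(\<lambda>k. norm (f' k z)) summable_on UNIV"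
    using bound' by (intro summable_on_comparison_test[OF bound'(2)]) auto
  then have "(\<lambda>k. f' k z) summable_on UNIV"
    by (rule abs_summable_summable)
  then have "((\<lambda>X. \<Sum>k\<in>X. f' k z) \<longlongrightarrow> (\<Sum>\<^sub>\<infinity>k. f' k z)) (finite_subsets_at_top UNIV)"
    using has_sum_def has_sum_infsum by blast
  then have "g' z = (\<Sum>\<^sub>\<infinity>k. f' k z)"
    using g'[of z] \<open>0 < R\<close> tendsto_unique[of "finite_subsets_at_top (UNIV :: int set)"] by auto
  with g'[of z] \<open>0 < R\<close> show ?thesis by auto
qed

lemma summable_on_exp_neg_abs_int: "(\<lambda>k::int. exp (- \<bar>real_of_int k\<bar>)) summable_on UNIV"
proof -
  have g: "(\<lambda>n::nat. exp (- real n)) summable_on UNIV"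
  proof -
    have "summable (\<lambda>n. (exp (-1) :: real) ^ n)" by (intro summable_geometric) auto
    also have "(\<lambda>n. (exp (-1) :: real) ^ n) = (\<lambda>n. exp (- real n))"
      by (auto simp: exp_of_nat_mult[symmetric])
    finally show ?thesis by (intro norm_summable_imp_summable_on) auto
  qed
  have 1: "(\<lambda>k::int. exp (- \<bar>real_of_int k\<bar>)) summable_on (range int)"
    by (subst summable_on_reindex) (auto simp: o_def intro!: inj_onI g)
  have 2: "(\<lambda>k::int. exp (- \<bar>real_of_int k\<bar>)) summable_on (range (\<lambda>n. - int n))"
    by (subst summable_on_reindex) (auto simp: o_def intro!: inj_onI g)
  have "UNIV = range int \<union> range (\<lambda>n. - int n)"
  proof (intro equalityI subsetI)
    fix k :: int
    show "k \<in> range int \<union> range (\<lambda>n. - int n)" by (cases k rule: int_cases2) auto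
  qed auto
  with summable_on_union[OF 1 2] show ?thesis by simp
qed

text \<open>
  The weight \<open>(2 \<pi> \<i> (k + \<rho>))\<^sup>n\<close> makes the family of these series closed under differentiation:
  \<open>\<partial>/\<partial>z\<close> raises \<open>n\<close> by one and, by the heat equation, \<open>4 \<pi> \<i> \<partial>/\<partial>\<tau>\<close> raises it by two. The
  coefficients \<open>c\<close> absorb the second characteristic, a phase; \<open>\<rho>\<close> may be any real number.
\<close>
definition theta_term :: "(int \<Rightarrow> complex) \<Rightarrow> real \<Rightarrow> nat \<Rightarrow> complex \<Rightarrow> complex \<Rightarrow> int \<Rightarrow> complex" where
  "theta_term c \<rho> n z \<tau> k = c k * (2 * pi * \<i> * (of_int k + of_real \<rho>)) ^ n *
     exp (pi * \<i> * (of_int k + of_real \<rho>)\<^sup>2 * \<tau> + 2 * pi * \<i> * (of_int k + of_real \<rho>) * z)"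

definition theta_series :: "(int \<Rightarrow> complex) \<Rightarrow> real \<Rightarrow> nat \<Rightarrow> complex \<Rightarrow> complex \<Rightarrow> complex" where
  "theta_series c \<rho> n z \<tau> = (\<Sum>\<^sub>\<infinity>k. theta_term c \<rho> n z \<tau> k)"

lemma norm_theta_term:
  "norm (theta_term c \<rho> n z \<tau> k) = norm (c k) * (2 * pi * \<bar>of_int k + \<rho>\<bar>) ^ n *
     exp (- pi * (of_int k + \<rho>)\<^sup>2 * Im \<tau> - 2 * pi * (of_int k + \<rho>) * Im z)"
proof -
  have e: "(of_int k + of_real \<rho> :: complex) = of_real (of_int k + \<rho>)" by simp
  have n1: "norm (2 * pi * \<i> * (of_int k + of_real \<rho>) :: complex) = 2 * pi * \<bar>of_int k + \<rho>\<bar>"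
    unfolding e norm_mult norm_of_real by (simp del: of_real_add)
  have r: "Re (pi * \<i> * (of_int k + of_real \<rho>)\<^sup>2 * \<tau> + 2 * pi * \<i> * (of_int k + of_real \<rho>) * z)
     = - pi * (of_int k + \<rho>)\<^sup>2 * Im \<tau> - 2 * pi * (of_int k + \<rho>) * Im z"
    unfolding e of_real_power[symmetric] by simp
  show ?thesis
    unfolding theta_term_def norm_mult[of _ "exp _"] norm_mult[of "c k"] norm_power n1 norm_exp_eq_Re r by simp
qed

text \<open>
  The majorant must not depend on \<open>z\<close>, \<open>\<tau>\<close> and \<open>c\<close>, because it serves as the bound in an M-test. The
  Gaussian decay in \<open>k + \<rho>\<close> beats both the polynomial weight, which is at most \<open>n! exp (2 \<pi> \<bar>k + \<rho>\<bar>)\<close>,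
  and the linear exponent; completing the square leaves a multiple of \<open>exp (- \<bar>k\<bar>)\<close>.
\<close>
lemma theta_term_bound:
  assumes "\<delta> > 0" "M \<ge> 0"
  obtains B where "B summable_on (UNIV :: int set)"
    "\<And>c k z \<tau>. norm (c k) \<le> 1 \<Longrightarrow> Im \<tau> \<ge> \<delta> \<Longrightarrow> \<bar>Im z\<bar> \<le> M \<Longrightarrow> norm (theta_term c \<rho> n z \<tau> k) \<le> B k"
proof
  define b where "b = 2 * pi + 2 * pi * M + 1"
  define C where "C = fact n * exp (b\<^sup>2 / (4 * pi * \<delta>)) * exp \<bar>\<rho>\<bar>"
  show "(\<lambda>k::int. C * exp (- \<bar>real_of_int k\<bar>)) summable_on UNIV"
    by (intro summable_on_cmult_right summable_on_exp_neg_abs_int)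
  fix c :: "int \<Rightarrow> complex" and k z \<tau> assume *: "norm (c k) \<le> 1" "Im \<tau> \<ge> \<delta>" "\<bar>Im z\<bar> \<le> M"
  define u where "u = \<bar>of_int k + \<rho>\<bar>"
  have u: "u \<ge> 0" by (simp add: u_def)
  have 1: "(2 * pi * u) ^ n \<le> fact n * exp (2 * pi * u)"
  proof -
    have "(2 * pi * u) ^ n / fact n \<le> exp (2 * pi * u)"
      using sum_le_suminf[OF summable_exp_generic[of "2 * pi * u"], of "{n}"] u
      by (simp add: exp_def field_simps)
    then show ?thesis by (simp add: field_simps)
  qed
  have "- (of_int k + \<rho>) * Im z \<le> u * M"
    using abs_le_D1[of "- (of_int k + \<rho>) * Im z" "u * M"] mult_left_mono[OF *(3) u]
    by (simp add: abs_mult u_def abs_minus_commute[of "- real_of_int k"] del: minus_add_distrib)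
  moreover have "u\<^sup>2 * \<delta> \<le> (of_int k + \<rho>)\<^sup>2 * Im \<tau>"
    using mult_left_mono[OF *(2), of "u\<^sup>2"] by (simp add: u_def)
  ultimately have "pi * (- (of_int k + \<rho>) * Im z) \<le> pi * (u * M)" "pi * (u\<^sup>2 * \<delta>) \<le> pi * ((of_int k + \<rho>)\<^sup>2 * Im \<tau>)"
    by (meson mult_left_mono pi_ge_zero)+
  moreover have "- pi * (of_int k + \<rho>)\<^sup>2 * Im \<tau> - 2 * pi * (of_int k + \<rho>) * Im z
      = 2 * (pi * (- (of_int k + \<rho>) * Im z)) - pi * ((of_int k + \<rho>)\<^sup>2 * Im \<tau>)"
    "- pi * \<delta> * u\<^sup>2 + 2 * pi * M * u = 2 * (pi * (u * M)) - pi * (u\<^sup>2 * \<delta>)"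
    by (simp_all add: algebra_simps)
  ultimately have 2: "- pi * (of_int k + \<rho>)\<^sup>2 * Im \<tau> - 2 * pi * (of_int k + \<rho>) * Im z \<le> - pi * \<delta> * u\<^sup>2 + 2 * pi * M * u"
    by linarith
  have pd: "pi * \<delta> > 0" using assms by simp
  have "(2 * pi * \<delta> * u - b)\<^sup>2 \<ge> 0" by simp
  then have "4 * (pi * \<delta>) * (b * u - pi * \<delta> * u\<^sup>2) \<le> b\<^sup>2"
    by (simp add: power2_eq_square algebra_simps)
  then have 3: "b * u - pi * \<delta> * u\<^sup>2 \<le> b\<^sup>2 / (4 * pi * \<delta>)"
    using pd by (subst pos_le_divide_eq) (auto simp: mult_ac)
  have 4: "- u \<le> \<bar>\<rho>\<bar> - \<bar>real_of_int k\<bar>" by (simp add: u_def)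
  have "norm (theta_term c \<rho> n z \<tau> k) \<le> 1 * (fact n * exp (2 * pi * u)) * exp (- pi * \<delta> * u\<^sup>2 + 2 * pi * M * u)"
    unfolding norm_theta_term u_def[symmetric]
    by (intro mult_mono) (use * 1 2 u in auto)
  also have "\<dots> = fact n * exp (b * u - pi * \<delta> * u\<^sup>2 - u)"
    by (simp add: b_def exp_add[symmetric] algebra_simps)
  also have "\<dots> \<le> fact n * exp (b\<^sup>2 / (4 * pi * \<delta>) + (\<bar>\<rho>\<bar> - \<bar>real_of_int k\<bar>))"
    using 3 4 by (intro mult_left_mono) auto
  also have "\<dots> = C * exp (- \<bar>real_of_int k\<bar>)"
    by (simp add: C_def exp_add[symmetric] algebra_simps)
  finally show "norm (theta_term c \<rho> n z \<tau> k) \<le> C * exp (- \<bar>real_of_int k\<bar>)" .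
qed

lemma theta_term_abs_summable:
  assumes "\<And>k. norm (c k) \<le> 1" "Im \<tau> > 0"
  shows "(\<lambda>k. norm (theta_term c \<rho> n z \<tau> k)) summable_on UNIV"
proof -
  obtain B where B: "B summable_on (UNIV :: int set)"
    "\<And>c k z' \<tau>'. norm (c k) \<le> 1 \<Longrightarrow> Im \<tau>' \<ge> Im \<tau> \<Longrightarrow> \<bar>Im z'\<bar> \<le> \<bar>Im z\<bar> \<Longrightarrow> norm (theta_term c \<rho> n z' \<tau>' k) \<le> B k"
    using theta_term_bound[OF assms(2), of "\<bar>Im z\<bar>" \<rho> n] by auto
  show ?thesis
    by (rule summable_on_comparison_test[OF B(1)]) (use B(2) assms in auto)
qed

lemma theta_term_summable:
  assumes "\<And>k. norm (c k) \<le> 1" "Im \<tau> > 0"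
  shows "theta_term c \<rho> n z \<tau> summable_on UNIV"
  using abs_summable_summable[OF theta_term_abs_summable[OF assms]] by simp

lemma theta_series_deriv_z:
  assumes "\<And>k. norm (c k) \<le> 1" "Im \<tau> > 0"
  shows "((\<lambda>z. theta_series c \<rho> n z \<tau>) has_field_derivative theta_series c \<rho> (Suc n) z \<tau>) (at z)"
proof -
  obtain B where B: "B summable_on (UNIV :: int set)"
    "\<And>c k z' \<tau>'. norm (c k) \<le> 1 \<Longrightarrow> Im \<tau>' \<ge> Im \<tau> \<Longrightarrow> \<bar>Im z'\<bar> \<le> \<bar>Im z\<bar> + 1 \<Longrightarrow> norm (theta_term c \<rho> n z' \<tau>' k) \<le> B k"
    using theta_term_bound[OF assms(2), of "\<bar>Im z\<bar> + 1" \<rho> n] by auto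
  show ?thesis unfolding theta_series_def
  proof (rule has_field_derivative_infsum_M_test[of 1])
    show "((\<lambda>a. theta_term c \<rho> n a \<tau> k) has_field_derivative theta_term c \<rho> (Suc n) w \<tau> k) (at w)" for k w
      unfolding theta_term_def by (rule derivative_eq_intros refl)+ (simp add: mult_ac)
    show "norm (theta_term c \<rho> n w \<tau> k) \<le> B k" if "w \<in> cball z 1" for w k
    proof (rule B(2))
      have "\<bar>Im w\<bar> \<le> \<bar>Im z\<bar> + \<bar>Im (w - z)\<bar>" by simp
      also have "\<bar>Im (w - z)\<bar> \<le> 1"
        using that abs_Im_le_cmod[of "w - z"] by (simp add: dist_norm norm_minus_commute)
      finally show "\<bar>Im w\<bar> \<le> \<bar>Im z\<bar> + 1" by simp
    qed (use assms in auto)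
    show "B summable_on UNIV" by fact
    show "(\<lambda>k. norm (theta_term c \<rho> (Suc n) z \<tau> k)) summable_on UNIV"
      by (rule theta_term_abs_summable[OF assms])
  qed auto
qed

lemma theta_series_deriv_tau:
  assumes "\<And>k. norm (c k) \<le> 1" "Im \<tau> > 0"
  shows "((\<lambda>\<tau>. theta_series c \<rho> n z \<tau>) has_field_derivative theta_series c \<rho> (Suc (Suc n)) z \<tau> / (4 * pi * \<i>)) (at \<tau>)"
proof -
  define R where "R = Im \<tau> / 2"
  have R: "R > 0" using assms by (simp add: R_def)
  obtain B where B: "B summable_on (UNIV :: int set)"
    "\<And>c k z' \<tau>'. norm (c k) \<le> 1 \<Longrightarrow> Im \<tau>' \<ge> R \<Longrightarrow> \<bar>Im z'\<bar> \<le> \<bar>Im z\<bar> \<Longrightarrow> norm (theta_term c \<rho> n z' \<tau>' k) \<le> B k"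
    using theta_term_bound[OF R, of "\<bar>Im z\<bar>" \<rho> n] by auto
  have "((\<lambda>\<tau>. theta_series c \<rho> n z \<tau>) has_field_derivative (\<Sum>\<^sub>\<infinity>k. theta_term c \<rho> (Suc (Suc n)) z \<tau> k / (4 * pi * \<i>))) (at \<tau>)"
    unfolding theta_series_def
  proof (rule has_field_derivative_infsum_M_test[OF R])
    show "((\<lambda>a. theta_term c \<rho> n z a k) has_field_derivative theta_term c \<rho> (Suc (Suc n)) z w k / (4 * pi * \<i>)) (at w)" for k w
      unfolding theta_term_def
      by (rule derivative_eq_intros refl)+ (simp add: field_simps power2_eq_square)
    show "norm (theta_term c \<rho> n z w k) \<le> B k" if "w \<in> cball \<tau> R" for w k
    proof (rule B(2))
      have "\<bar>Im (w - \<tau>)\<bar> \<le> R"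
        using that abs_Im_le_cmod[of "w - \<tau>"] by (simp add: dist_norm norm_minus_commute)
      then have "Im \<tau> - Im w \<le> R" by simp
      then show "R \<le> Im w" by (simp add: R_def)
    qed (use assms in auto)
    show "B summable_on UNIV" by fact
    have "(\<lambda>k. norm (theta_term c \<rho> (Suc (Suc n)) z \<tau> k) * (1 / (4 * pi))) summable_on UNIV"
      by (rule summable_on_cmult_left theta_term_abs_summable[OF assms])+
    then show "(\<lambda>k. norm (theta_term c \<rho> (Suc (Suc n)) z \<tau> k / (4 * pi * \<i>))) summable_on UNIV"
      by (simp add: norm_divide norm_mult)
  qed auto
  then show ?thesis
    unfolding theta_series_def divide_inverse infsum_cmult_left' by simp
qed

section \<open>Products of theta series\<close>

text \<open>
  Fubini for the Cauchy product of two absolutely convergent series.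
\<close>
lemma abs_summable_product:
  fixes f g :: "'a \<Rightarrow> complex"
  assumes f: "(\<lambda>k. norm (f k)) summable_on UNIV" and g: "(\<lambda>k. norm (g k)) summable_on UNIV"
  shows "(\<lambda>p. f (fst p) * g (snd p)) summable_on UNIV"
    and "infsum f UNIV * infsum g UNIV = (\<Sum>\<^sub>\<infinity>p. f (fst p) * g (snd p))"
proof -
  have "(\<lambda>p. norm (f (fst p) * g (snd p))) summable_on (UNIV \<times> UNIV)"
    unfolding Infinite_Sum.abs_summable_on_Sigma_iff[of "\<lambda>p. f (fst p) * g (snd p)"]
  proof (intro conjI ballI)
    show "(\<lambda>y. norm (f (fst (x, y)) * g (snd (x, y)))) summable_on UNIV" for x
      using summable_on_cmult_right[OF g, of "norm (f x)"] by (simp add: norm_mult)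
    have "(\<lambda>x. norm (norm (f x) * (\<Sum>\<^sub>\<infinity>y. norm (g y)))) summable_on UNIV"
      using summable_on_cmult_left[OF f, of "\<Sum>\<^sub>\<infinity>y. norm (g y)"]
      by (simp add: abs_mult infsum_nonneg)
    then show "(\<lambda>x. norm (\<Sum>\<^sub>\<infinity>y. norm (f (fst (x, y)) * g (snd (x, y))))) summable_on UNIV"
      by (simp add: norm_mult infsum_cmult_right')
  qed
  then have s: "(\<lambda>p. f (fst p) * g (snd p)) summable_on (UNIV \<times> UNIV)"
    by (rule abs_summable_summable)
  then show "(\<lambda>p. f (fst p) * g (snd p)) summable_on UNIV" by simp
  have "(\<Sum>\<^sub>\<infinity>p\<in>UNIV \<times> UNIV. f (fst p) * g (snd p)) = (\<Sum>\<^sub>\<infinity>x. \<Sum>\<^sub>\<infinity>y. f (fst (x,y)) * g (snd (x,y)))"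
    by (rule infsum_Sigma_banach[symmetric, OF s])
  also have "\<dots> = infsum f UNIV * infsum g UNIV"
    by (simp add: infsum_cmult_right' infsum_cmult_left')
  finally show "infsum f UNIV * infsum g UNIV = (\<Sum>\<^sub>\<infinity>p. f (fst p) * g (snd p))" by simp
qed

text \<open>
  One characteristic suffices for products, since the second one is a translation of \<open>z\<close>.
\<close>
definition jtheta :: "real \<Rightarrow> complex \<Rightarrow> complex \<Rightarrow> complex" where
  "jtheta \<rho> z \<tau> = (\<Sum>\<^sub>\<infinity>k::int. exp (pi * \<i> * (of_int k + of_real \<rho>)\<^sup>2 * \<tau> + 2 * pi * \<i> * (of_int k + of_real \<rho>) * z))"

lemma jtheta_theta_term:
  "exp (pi * \<i> * (of_int k + of_real \<rho>)\<^sup>2 * \<tau> + 2 * pi * \<i> * (of_int k + of_real \<rho>) * z) = theta_term (\<lambda>_. 1) \<rho> 0 z \<tau> k"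
  by (simp add: theta_term_def)

lemma jtheta_abs_summable:
  assumes "Im \<tau> > 0"
  shows "(\<lambda>k::int. norm (exp (pi * \<i> * (of_int k + of_real \<rho>)\<^sup>2 * \<tau> + 2 * pi * \<i> * (of_int k + of_real \<rho>) * z))) summable_on UNIV"
  unfolding jtheta_theta_term by (rule theta_term_abs_summable) (use assms in auto)

text \<open>
  In the double series for the left-hand side with indices \<open>k\<close> and \<open>l\<close>, pass to \<open>k + l\<close> and \<open>k - l\<close>.
  These have the same parity \<open>e\<close>, and writing them as \<open>2 M + e\<close> and \<open>2 N + e\<close> separates the exponents,
  because \<open>k\<^sup>2 + l\<^sup>2 = ((k + l)\<^sup>2 + (k - l)\<^sup>2) / 2\<close>. The two summands on the right are the two parities.
\<close>
theorem jtheta_product: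
  assumes \<tau>: "Im \<tau> > 0"
  shows "jtheta r a \<tau> * jtheta s b \<tau> =
     jtheta ((r + s) / 2) (a + b) (2 * \<tau>) * jtheta ((r - s) / 2) (a - b) (2 * \<tau>) +
     jtheta ((1 + r + s) / 2) (a + b) (2 * \<tau>) * jtheta ((1 + r - s) / 2) (a - b) (2 * \<tau>)"
proof -
  define t where "t = (\<lambda>\<rho> z \<tau> (k::int). exp (pi * \<i> * (of_int k + of_real \<rho>)\<^sup>2 * \<tau> + 2 * pi * \<i> * (of_int k + of_real \<rho>) * z))"
  have tsum: "(\<lambda>k. norm (t \<rho> z \<tau> k)) summable_on UNIV" if "Im \<tau> > 0" for \<rho> z \<tau>
    unfolding t_def by (rule jtheta_abs_summable[OF that])
  have jt: "jtheta \<rho> z \<tau> = infsum (t \<rho> z \<tau>) UNIV" for \<rho> z \<tau>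
    by (simp add: jtheta_def t_def)
  define F where "F = (\<lambda>p. t r a \<tau> (fst p) * t s b \<tau> (snd p))"
  define h where "h = (\<lambda>e (p::int\<times>int). (fst p + snd p + e, fst p - snd p))"
  have inj: "inj (h e)" for e
    by (rule injI) (auto simp: h_def prod_eq_iff)
  have disj: "range (h 0) \<inter> range (h 1) = {}"
  proof -
    have "even (fst (h 0 p) + snd (h 0 p))" "odd (fst (h 1 p) + snd (h 1 p))" for p
      by (auto simp: h_def)
    then show ?thesis by (auto, metis fst_conv snd_conv)
  qed
  have un: "range (h 0) \<union> range (h 1) = UNIV"
  proof (intro equalityI subsetI)
    fix p :: "int \<times> int"
    show "p \<in> range (h 0) \<union> range (h 1)"
    proof (cases "even (fst p + snd p)")
      case True
      then have "p = h 0 ((fst p + snd p) div 2, (fst p - snd p) div 2)"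
        unfolding h_def prod_eq_iff fst_conv snd_conv by presburger
      then show ?thesis by blast
    next
      case False
      then have "p = h 1 ((fst p + snd p - 1) div 2, (fst p - snd p - 1) div 2)"
        unfolding h_def prod_eq_iff fst_conv snd_conv by presburger
      then show ?thesis by blast
    qed
  qed auto
  have trm: "F (h e p) = t ((of_int e + r + s) / 2) (a + b) (2 * \<tau>) (fst p) * t ((of_int e + r - s) / 2) (a - b) (2 * \<tau>) (snd p)" for e p
    unfolding F_def t_def h_def exp_add[symmetric]
    by (rule arg_cong[where f = exp]) (simp add: power2_eq_square field_simps)
  have e: "infsum F (range (h e)) = jtheta ((of_int e + r + s) / 2) (a + b) (2 * \<tau>) * jtheta ((of_int e + r - s) / 2) (a - b) (2 * \<tau>)" for e
  proof -
    have "infsum F (range (h e)) = infsum (F \<circ> h e) UNIV"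
      by (rule infsum_reindex[OF inj])
    also have "\<dots> = (\<Sum>\<^sub>\<infinity>p. t ((of_int e + r + s) / 2) (a + b) (2 * \<tau>) (fst p) * t ((of_int e + r - s) / 2) (a - b) (2 * \<tau>) (snd p))"
      by (simp add: o_def trm)
    also have "\<dots> = jtheta ((of_int e + r + s) / 2) (a + b) (2 * \<tau>) * jtheta ((of_int e + r - s) / 2) (a - b) (2 * \<tau>)"
      unfolding jt by (rule abs_summable_product(2)[symmetric]) (use \<tau> in \<open>auto intro!: tsum\<close>)
    finally show ?thesis .
  qed
  have sF: "F summable_on UNIV"
    unfolding F_def by (rule abs_summable_product(1)) (use \<tau> in \<open>auto intro!: tsum\<close>)
  have "jtheta r a \<tau> * jtheta s b \<tau> = infsum F (range (h 0) \<union> range (h 1))"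
    unfolding jt un F_def by (rule abs_summable_product(2)) (use \<tau> in \<open>auto intro!: tsum\<close>)
  also have "\<dots> = infsum F (range (h 0)) + infsum F (range (h 1))"
    by (rule infsum_Un_disjoint[OF _ _ disj]) (auto intro: summable_on_subset_banach[OF sF])
  finally show ?thesis unfolding e by simp
qed

lemma jtheta_char_add_1: "jtheta (\<rho> + 1) z \<tau> = jtheta \<rho> z \<tau>"
proof -
  have "jtheta \<rho> z \<tau> = infsum (\<lambda>k::int. exp (pi * \<i> * (of_int (k + 1) + of_real \<rho>)\<^sup>2 * \<tau> + 2 * pi * \<i> * (of_int (k + 1) + of_real \<rho>) * z)) UNIV"
    unfolding jtheta_def
    by (rule infsum_reindex_bij_betw[symmetric, of "\<lambda>k. k + 1"]) (auto intro!: bij_betwI[of _ _ _ "\<lambda>k. k - 1"])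
  then show ?thesis by (simp add: jtheta_def add_ac)
qed

lemma jtheta_uminus: "jtheta (- \<rho>) (- z) \<tau> = jtheta \<rho> z \<tau>"
proof -
  have "jtheta \<rho> z \<tau> = infsum (\<lambda>k::int. exp (pi * \<i> * (of_int (- k) + of_real \<rho>)\<^sup>2 * \<tau> + 2 * pi * \<i> * (of_int (- k) + of_real \<rho>) * z)) UNIV"
    unfolding jtheta_def
    by (rule infsum_reindex_bij_betw[symmetric, of uminus]) (auto intro!: bij_betwI[of _ _ _ uminus])
  then show ?thesis by (simp add: jtheta_def algebra_simps power2_eq_square)
qed

lemma jtheta_z_add_1: "jtheta \<rho> (z + 1) \<tau> = exp (2 * pi * \<i> * \<rho>) * jtheta \<rho> z \<tau>"
proof -
  have "exp (pi * \<i> * (of_int k + of_real \<rho>)\<^sup>2 * \<tau> + 2 * pi * \<i> * (of_int k + of_real \<rho>) * (z + 1)) =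
        exp (2 * pi * \<i> * \<rho>) * exp (pi * \<i> * (of_int k + of_real \<rho>)\<^sup>2 * \<tau> + 2 * pi * \<i> * (of_int k + of_real \<rho>) * z)" for k :: int
  proof -
    have "exp (pi * \<i> * (of_int k + of_real \<rho>)\<^sup>2 * \<tau> + 2 * pi * \<i> * (of_int k + of_real \<rho>) * (z + 1)) =
      exp (2 * of_int k * pi * \<i>) * (exp (2 * pi * \<i> * \<rho>) * exp (pi * \<i> * (of_int k + of_real \<rho>)\<^sup>2 * \<tau> + 2 * pi * \<i> * (of_int k + of_real \<rho>) * z))"
      unfolding exp_add[symmetric] by (rule arg_cong[where f = exp]) (simp add: algebra_simps)
    also have "exp (2 * of_int k * pi * \<i>) = 1"
      using exp_integer_2pi[of "of_int k"] by (simp add: mult_ac)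
    finally show ?thesis by simp
  qed
  then show ?thesis unfolding jtheta_def by (simp add: infsum_cmult_right')
qed

lemma jtheta_z_add_tau: "jtheta \<rho> (z + \<tau>) \<tau> = exp (- pi * \<i> * \<tau> - 2 * pi * \<i> * z) * jtheta \<rho> z \<tau>"
proof -
  have "exp (pi * \<i> * (of_int k + of_real \<rho>)\<^sup>2 * \<tau> + 2 * pi * \<i> * (of_int k + of_real \<rho>) * (z + \<tau>)) =
        exp (- pi * \<i> * \<tau> - 2 * pi * \<i> * z) * exp (pi * \<i> * (of_int k + of_real (\<rho> + 1))\<^sup>2 * \<tau> + 2 * pi * \<i> * (of_int k + of_real (\<rho> + 1)) * z)" for k :: int
    unfolding exp_add[symmetric] by (rule arg_cong[where f = exp]) (simp add: algebra_simps power2_eq_square)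
  then have "jtheta \<rho> (z + \<tau>) \<tau> = exp (- pi * \<i> * \<tau> - 2 * pi * \<i> * z) * jtheta (\<rho> + 1) z \<tau>"
    unfolding jtheta_def by (simp add: infsum_cmult_right')
  then show ?thesis by (simp add: jtheta_char_add_1)
qed

lemma theta_char_jtheta: "theta_char a b z \<tau> = jtheta (of_int a / 2) (z + of_int b / 2) \<tau>"
  by (simp add: theta_char_def jtheta_def)

section \<open>Quadratic identities and shifted theta functions\<close>

lemma theta_jtheta:
  "theta1 z \<tau> = - jtheta (1/2) (z + 1/2) \<tau>" "theta2 z \<tau> = jtheta (1/2) z \<tau>"
  "theta3 z \<tau> = jtheta 0 z \<tau>" "theta4 z \<tau> = jtheta 0 (z + 1/2) \<tau>"
  by (simp_all add: theta1_def theta2_def theta3_def theta4_def theta_char_jtheta)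

lemma jtheta_shift:
  "jtheta 1 z \<tau> = jtheta 0 z \<tau>"
  "jtheta 0 (z + 1) \<tau> = jtheta 0 z \<tau>" "jtheta (1/2) (z + 1) \<tau> = - jtheta (1/2) z \<tau>"
  using jtheta_char_add_1[of 0 z \<tau>] jtheta_z_add_1[of 0 z \<tau>] jtheta_z_add_1[of "1/2" z \<tau>]
  by simp_all

lemma theta_even_odd:
  "theta1 (- z) \<tau> = - theta1 z \<tau>" "theta2 (- z) \<tau> = theta2 z \<tau>"
  "theta3 (- z) \<tau> = theta3 z \<tau>" "theta4 (- z) \<tau> = theta4 z \<tau>"
proof -
  have half: "jtheta (1/2) (- w) \<tau> = jtheta (1/2) w \<tau>" for w
    using jtheta_uminus[of "1/2" w \<tau>] jtheta_char_add_1[of "- (1/2)" "- w" \<tau>] by simp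
  have zero: "jtheta 0 (- w) \<tau> = jtheta 0 w \<tau>" for w
    using jtheta_uminus[of 0 w \<tau>] by simp
  show "theta2 (- z) \<tau> = theta2 z \<tau>" "theta3 (- z) \<tau> = theta3 z \<tau>"
    by (simp_all add: theta_jtheta half zero)
  show "theta4 (- z) \<tau> = theta4 z \<tau>"
    using zero[of "z - 1/2"] jtheta_shift(2)[of "z - 1/2" \<tau>] by (simp add: theta_jtheta add_ac)
  show "theta1 (- z) \<tau> = - theta1 z \<tau>"
    using half[of "z - 1/2"] jtheta_shift(3)[of "z - 1/2" \<tau>] by (simp add: theta_jtheta add_ac)
qed

lemma theta1_0 [simp]: "theta1 0 \<tau> = 0"
  using theta_even_odd(1)[of 0 \<tau>] by simp

lemma theta1_quasiperiods:
  "theta1 (z + 1) \<tau> = - theta1 z \<tau>"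
  "theta1 (z + \<tau>) \<tau> = - exp (- pi * \<i> * \<tau> - 2 * pi * \<i> * z) * theta1 z \<tau>"
proof -
  show "theta1 (z + 1) \<tau> = - theta1 z \<tau>"
    using jtheta_shift(3)[of "z + 1/2" \<tau>] by (simp add: theta_jtheta add_ac)
  have "exp (- pi * \<i> * \<tau> - 2 * pi * \<i> * (z + 1/2)) = exp (- pi * \<i> * \<tau> - 2 * pi * \<i> * z) * exp (- (pi * \<i>))"
    unfolding exp_add[symmetric] by (rule arg_cong[where f = exp]) (simp add: algebra_simps)
  also have "exp (- (pi * \<i>)) = -1" by (simp add: exp_minus)
  finally show "theta1 (z + \<tau>) \<tau> = - exp (- pi * \<i> * \<tau> - 2 * pi * \<i> * z) * theta1 z \<tau>"
    using jtheta_z_add_tau[of "1/2" "z + 1/2" \<tau>] by (simp add: theta_jtheta add_ac)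
qed

context
  fixes \<tau> :: complex
  assumes \<tau>: "Im \<tau> > 0"
begin

text \<open>
  The cases of the product formula that are used; on the right the modulus is \<open>2 \<tau>\<close>, and only four
  functions occur there. Every further quadratic identity is a polynomial consequence of these.
\<close>
lemma theta_products:
  "theta1 a \<tau> * theta1 b \<tau> =
     theta3 (a + b) (2 * \<tau>) * theta2 (a - b) (2 * \<tau>) - theta2 (a + b) (2 * \<tau>) * theta3 (a - b) (2 * \<tau>)"
  "theta2 a \<tau> * theta2 b \<tau> =
     theta3 (a + b) (2 * \<tau>) * theta2 (a - b) (2 * \<tau>) + theta2 (a + b) (2 * \<tau>) * theta3 (a - b) (2 * \<tau>)"
  "theta3 a \<tau> * theta3 b \<tau> =
     theta3 (a + b) (2 * \<tau>) * theta3 (a - b) (2 * \<tau>) + theta2 (a + b) (2 * \<tau>) * theta2 (a - b) (2 * \<tau>)"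
  "theta4 a \<tau> * theta4 b \<tau> =
     theta3 (a + b) (2 * \<tau>) * theta3 (a - b) (2 * \<tau>) - theta2 (a + b) (2 * \<tau>) * theta2 (a - b) (2 * \<tau>)"
  "theta1 a \<tau> * theta2 b \<tau> =
     theta1 (a + b) (2 * \<tau>) * theta4 (a - b) (2 * \<tau>) + theta4 (a + b) (2 * \<tau>) * theta1 (a - b) (2 * \<tau>)"
  "theta3 a \<tau> * theta4 b \<tau> =
     theta4 (a + b) (2 * \<tau>) * theta4 (a - b) (2 * \<tau>) - theta1 (a + b) (2 * \<tau>) * theta1 (a - b) (2 * \<tau>)"
proof -
  note p = jtheta_product[OF \<tau>]
  show "theta2 a \<tau> * theta2 b \<tau> =
     theta3 (a + b) (2 * \<tau>) * theta2 (a - b) (2 * \<tau>) + theta2 (a + b) (2 * \<tau>) * theta3 (a - b) (2 * \<tau>)"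
    using p[of "1/2" a "1/2" b] by (simp add: theta_jtheta jtheta_shift)
  show "theta3 a \<tau> * theta3 b \<tau> =
     theta3 (a + b) (2 * \<tau>) * theta3 (a - b) (2 * \<tau>) + theta2 (a + b) (2 * \<tau>) * theta2 (a - b) (2 * \<tau>)"
    using p[of 0 a 0 b] by (simp add: theta_jtheta jtheta_shift)
  have 1: "a + 1/2 + (b + 1/2) = a + b + 1" "a + 1/2 - (b + 1/2) = a - b" by simp_all
  show "theta1 a \<tau> * theta1 b \<tau> =
     theta3 (a + b) (2 * \<tau>) * theta2 (a - b) (2 * \<tau>) - theta2 (a + b) (2 * \<tau>) * theta3 (a - b) (2 * \<tau>)"
    using p[of "1/2" "a + 1/2" "1/2" "b + 1/2"] unfolding 1 by (simp add: theta_jtheta jtheta_shift)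
  show "theta4 a \<tau> * theta4 b \<tau> =
     theta3 (a + b) (2 * \<tau>) * theta3 (a - b) (2 * \<tau>) - theta2 (a + b) (2 * \<tau>) * theta2 (a - b) (2 * \<tau>)"
    using p[of 0 "a + 1/2" 0 "b + 1/2"] unfolding 1 by (simp add: theta_jtheta jtheta_shift)
  have 2: "a + 1/2 + b = a + b + 1/2" "a + 1/2 - b = a - b + 1/2" by simp_all
  show "theta1 a \<tau> * theta2 b \<tau> =
     theta1 (a + b) (2 * \<tau>) * theta4 (a - b) (2 * \<tau>) + theta4 (a + b) (2 * \<tau>) * theta1 (a - b) (2 * \<tau>)"
    using p[of "1/2" "a + 1/2" "1/2" "b"] unfolding 2 by (simp add: theta_jtheta jtheta_shift)
  have 3: "a + (b + 1/2) = a + b + 1/2" "a - (b + 1/2) + 1 = a - b + 1/2" by simp_all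
  show "theta3 a \<tau> * theta4 b \<tau> =
     theta4 (a + b) (2 * \<tau>) * theta4 (a - b) (2 * \<tau>) - theta1 (a + b) (2 * \<tau>) * theta1 (a - b) (2 * \<tau>)"
    using p[of 0 a 0 "b + 1/2"] jtheta_shift(2,3)[of "a - (b + 1/2)" "2 * \<tau>"] unfolding 3
    by (simp add: theta_jtheta)
qed

lemma theta_constants_2tau:
  "(theta2 0 \<tau>)\<^sup>2 = 2 * theta2 0 (2 * \<tau>) * theta3 0 (2 * \<tau>)"
  "(theta3 0 \<tau>)\<^sup>2 = (theta3 0 (2 * \<tau>))\<^sup>2 + (theta2 0 (2 * \<tau>))\<^sup>2"
  "(theta4 0 \<tau>)\<^sup>2 = (theta3 0 (2 * \<tau>))\<^sup>2 - (theta2 0 (2 * \<tau>))\<^sup>2"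
  "theta3 0 \<tau> * theta4 0 \<tau> = (theta4 0 (2 * \<tau>))\<^sup>2"
  using theta_products(2,3,4,6)[of 0 0] by (simp_all add: power2_eq_square)

lemma theta_squares_2tau:
  "(theta1 z \<tau>)\<^sup>2 = theta3 (2 * z) (2 * \<tau>) * theta2 0 (2 * \<tau>) - theta2 (2 * z) (2 * \<tau>) * theta3 0 (2 * \<tau>)"
  "(theta2 z \<tau>)\<^sup>2 = theta3 (2 * z) (2 * \<tau>) * theta2 0 (2 * \<tau>) + theta2 (2 * z) (2 * \<tau>) * theta3 0 (2 * \<tau>)"
  "(theta3 z \<tau>)\<^sup>2 = theta3 (2 * z) (2 * \<tau>) * theta3 0 (2 * \<tau>) + theta2 (2 * z) (2 * \<tau>) * theta2 0 (2 * \<tau>)"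
  "(theta4 z \<tau>)\<^sup>2 = theta3 (2 * z) (2 * \<tau>) * theta3 0 (2 * \<tau>) - theta2 (2 * z) (2 * \<tau>) * theta2 0 (2 * \<tau>)"
  using theta_products(1,2,3,4)[of z z] unfolding mult_2[symmetric] by (simp_all add: power2_eq_square)

lemma jacobi_quartic: "(theta3 0 \<tau>) ^ 4 = (theta2 0 \<tau>) ^ 4 + (theta4 0 \<tau>) ^ 4"
proof -
  have *: "x ^ 4 = (x\<^sup>2)\<^sup>2" for x :: complex by simp
  show ?thesis unfolding * theta_constants_2tau by (simp add: power2_eq_square algebra_simps)
qed

lemma theta_squares:
  "(theta2 0 \<tau>)\<^sup>2 * (theta3 z \<tau>)\<^sup>2 = (theta4 0 \<tau>)\<^sup>2 * (theta1 z \<tau>)\<^sup>2 + (theta3 0 \<tau>)\<^sup>2 * (theta2 z \<tau>)\<^sup>2"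
  "(theta2 0 \<tau>)\<^sup>2 * (theta4 z \<tau>)\<^sup>2 = (theta3 0 \<tau>)\<^sup>2 * (theta1 z \<tau>)\<^sup>2 + (theta4 0 \<tau>)\<^sup>2 * (theta2 z \<tau>)\<^sup>2"
  unfolding theta_constants_2tau theta_squares_2tau by (simp_all add: power2_eq_square algebra_simps)

text \<open>
  Both sides are bilinear in \<open>(\<theta>\<^sub>2, \<theta>\<^sub>3)\<close> at \<open>2 a\<close> and at \<open>2 b\<close>, all with modulus \<open>2 \<tau>\<close>.
\<close>
lemma theta_addition:
  "(theta2 0 \<tau>)\<^sup>2 * (theta1 (a + b) \<tau> * theta1 (a - b) \<tau>) =
     (theta1 a \<tau>)\<^sup>2 * (theta2 b \<tau>)\<^sup>2 - (theta2 a \<tau>)\<^sup>2 * (theta1 b \<tau>)\<^sup>2"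
  "(theta2 0 \<tau>)\<^sup>2 * (theta2 (a + b) \<tau> * theta2 (a - b) \<tau>) =
     (theta2 a \<tau>)\<^sup>2 * (theta2 b \<tau>)\<^sup>2 - (theta1 a \<tau>)\<^sup>2 * (theta1 b \<tau>)\<^sup>2"
proof -
  have *: "a + b + (a - b) = 2 * a" "a + b - (a - b) = 2 * b" by simp_all
  show "(theta2 0 \<tau>)\<^sup>2 * (theta1 (a + b) \<tau> * theta1 (a - b) \<tau>) =
     (theta1 a \<tau>)\<^sup>2 * (theta2 b \<tau>)\<^sup>2 - (theta2 a \<tau>)\<^sup>2 * (theta1 b \<tau>)\<^sup>2"
    unfolding theta_products[of "a + b" "a - b"] theta_constants_2tau(1) theta_squares_2tau *
    by (simp add: power2_eq_square algebra_simps)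
  show "(theta2 0 \<tau>)\<^sup>2 * (theta2 (a + b) \<tau> * theta2 (a - b) \<tau>) =
     (theta2 a \<tau>)\<^sup>2 * (theta2 b \<tau>)\<^sup>2 - (theta1 a \<tau>)\<^sup>2 * (theta1 b \<tau>)\<^sup>2"
    unfolding theta_products[of "a + b" "a - b"] theta_constants_2tau(1) theta_squares_2tau *
    by (simp add: power2_eq_square algebra_simps)
qed

lemma theta1_duplication:
  "theta1 (2 * z) \<tau> * (theta2 0 \<tau> * theta3 0 \<tau> * theta4 0 \<tau>) =
     2 * (theta1 z \<tau> * theta2 z \<tau> * theta3 z \<tau> * theta4 z \<tau>)"
proof -
  have 1: "theta1 z \<tau> * theta2 z \<tau> = theta1 (2 * z) (2 * \<tau>) * theta4 0 (2 * \<tau>)"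
    using theta_products(5)[of z z] unfolding mult_2[symmetric] by simp
  have 2: "theta3 z \<tau> * theta4 z \<tau> = theta4 (2 * z) (2 * \<tau>) * theta4 0 (2 * \<tau>)"
    using theta_products(6)[of z z] unfolding mult_2[symmetric] by simp
  have 3: "theta1 (2 * z) \<tau> * theta2 0 \<tau> = 2 * theta1 (2 * z) (2 * \<tau>) * theta4 (2 * z) (2 * \<tau>)"
    unfolding theta_products(5)[of "2 * z" 0] by simp
  have "theta1 (2 * z) \<tau> * (theta2 0 \<tau> * theta3 0 \<tau> * theta4 0 \<tau>) = (theta1 (2 * z) \<tau> * theta2 0 \<tau>) * (theta3 0 \<tau> * theta4 0 \<tau>)"
    by simp
  also have "\<dots> = 2 * (theta1 z \<tau> * theta2 z \<tau>) * (theta3 z \<tau> * theta4 z \<tau>)"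
    unfolding 1 2 3 theta_constants_2tau(4) by (simp add: power2_eq_square)
  finally show ?thesis by (simp add: mult_ac)
qed

lemma theta2_duplication:
  "theta2 (2 * z) \<tau> * theta2 0 \<tau> ^ 3 = theta2 z \<tau> ^ 4 - theta1 z \<tau> ^ 4"
  using theta_addition(2)[of z z] unfolding mult_2[symmetric]
  by (simp add: power2_eq_square power3_eq_cube power4_eq_xxxx mult_ac)

end

definition theta_phase :: "int \<Rightarrow> int \<Rightarrow> int \<Rightarrow> complex" where
  "theta_phase a b k = exp (pi * \<i> * of_int b * (of_int k + of_int a / 2))"

lemma norm_theta_phase: "norm (theta_phase a b k) \<le> 1"
  by (simp add: theta_phase_def norm_exp_eq_Re)

text \<open>
  The function \<open>\<theta>[a, b] (z + A \<tau> | \<tau>)\<close> itself does not satisfy the heat equation in \<open>(z, \<tau>)\<close>, but its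
  product with \<open>exp (\<pi> \<i> A\<^sup>2 \<tau> + 2 \<pi> \<i> A z)\<close> does: completing the square in the exponent merely replaces
  the characteristic \<open>a / 2\<close> by \<open>a / 2 + A\<close>. The argument \<open>n\<close> counts derivatives with respect to \<open>z\<close>.
\<close>
definition theta_shift :: "int \<Rightarrow> int \<Rightarrow> real \<Rightarrow> nat \<Rightarrow> complex \<Rightarrow> complex \<Rightarrow> complex" where
  "theta_shift a b A n z \<tau> = theta_series (theta_phase a b) (of_int a / 2 + A) n z \<tau>"

definition shift_factor :: "real \<Rightarrow> complex \<Rightarrow> complex \<Rightarrow> complex" where
  "shift_factor A z \<tau> = exp (pi * \<i> * (of_real A)\<^sup>2 * \<tau> + 2 * pi * \<i> * of_real A * z)"

lemma theta_shift_eq: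
  "theta_shift a b A 0 z \<tau> = shift_factor A z \<tau> * theta_char a b (z + of_real A * \<tau>) \<tau>"
proof -
  have "theta_term (theta_phase a b) (of_int a / 2 + A) 0 z \<tau> k = shift_factor A z \<tau> *
    exp (pi * \<i> * (of_int k + of_int a / 2)\<^sup>2 * \<tau>
             + 2 * pi * \<i> * (of_int k + of_int a / 2) * (z + of_real A * \<tau> + of_int b / 2))" for k
    unfolding theta_term_def theta_phase_def shift_factor_def power_0 mult_1_right exp_add[symmetric]
    by (rule arg_cong[where f = exp]) (simp add: algebra_simps power2_eq_square add_divide_distrib)
  then show ?thesis
    unfolding theta_shift_def theta_series_def theta_char_def infsum_cmult_right'[symmetric]
    by (intro infsum_cong)
qed

text \<open>
  The \<open>n\<close>-th derivatives with respect to \<open>z\<close> of \<open>shift_factor A z \<tau> * \<theta>\<^sub>k (z + A \<tau> | \<tau>)\<close>. For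
  \<open>A = 0\<close> they are those of \<open>\<theta>\<^sub>k\<close>.
\<close>
definition stheta1 where "stheta1 A n z \<tau> = - theta_shift 1 1 A n z \<tau>"
definition stheta2 where "stheta2 A n z \<tau> = theta_shift 1 0 A n z \<tau>"
definition stheta3 where "stheta3 A n z \<tau> = theta_shift 0 0 A n z \<tau>"
definition stheta4 where "stheta4 A n z \<tau> = theta_shift 0 1 A n z \<tau>"

lemma stheta_eq:
  "stheta1 A 0 z \<tau> = shift_factor A z \<tau> * theta1 (z + of_real A * \<tau>) \<tau>"
  "stheta2 A 0 z \<tau> = shift_factor A z \<tau> * theta2 (z + of_real A * \<tau>) \<tau>"
  "stheta3 A 0 z \<tau> = shift_factor A z \<tau> * theta3 (z + of_real A * \<tau>) \<tau>"
  "stheta4 A 0 z \<tau> = shift_factor A z \<tau> * theta4 (z + of_real A * \<tau>) \<tau>"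
  by (simp_all add: stheta1_def stheta2_def stheta3_def stheta4_def theta_shift_eq theta1_def theta2_def theta3_def theta4_def)

lemma stheta_0:
  "stheta1 0 0 z \<tau> = theta1 z \<tau>" "stheta2 0 0 z \<tau> = theta2 z \<tau>"
  "stheta3 0 0 z \<tau> = theta3 z \<tau>" "stheta4 0 0 z \<tau> = theta4 z \<tau>"
  by (simp_all add: stheta_eq shift_factor_def)

lemma stheta_deriv_z:
  assumes "Im \<tau> > 0"
  shows "((\<lambda>z. stheta1 A n z \<tau>) has_field_derivative stheta1 A (Suc n) z \<tau>) (at z)"
    "((\<lambda>z. stheta2 A n z \<tau>) has_field_derivative stheta2 A (Suc n) z \<tau>) (at z)"
    "((\<lambda>z. stheta3 A n z \<tau>) has_field_derivative stheta3 A (Suc n) z \<tau>) (at z)"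
    "((\<lambda>z. stheta4 A n z \<tau>) has_field_derivative stheta4 A (Suc n) z \<tau>) (at z)"
  unfolding stheta1_def stheta2_def stheta3_def stheta4_def theta_shift_def
  by (intro DERIV_minus theta_series_deriv_z norm_theta_phase assms)+

lemma stheta_deriv_tau:
  assumes "Im \<tau> > 0"
  shows "((\<lambda>\<tau>. stheta1 A n z \<tau>) has_field_derivative stheta1 A (Suc (Suc n)) z \<tau> / (4 * pi * \<i>)) (at \<tau>)"
    "((\<lambda>\<tau>. stheta2 A n z \<tau>) has_field_derivative stheta2 A (Suc (Suc n)) z \<tau> / (4 * pi * \<i>)) (at \<tau>)"
    "((\<lambda>\<tau>. stheta3 A n z \<tau>) has_field_derivative stheta3 A (Suc (Suc n)) z \<tau> / (4 * pi * \<i>)) (at \<tau>)"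
    "((\<lambda>\<tau>. stheta4 A n z \<tau>) has_field_derivative stheta4 A (Suc (Suc n)) z \<tau> / (4 * pi * \<i>)) (at \<tau>)"
  unfolding stheta1_def stheta2_def stheta3_def stheta4_def theta_shift_def minus_divide_left[symmetric]
  by (intro DERIV_minus theta_series_deriv_tau norm_theta_phase assms)+

section \<open>Theta constants and the zeros of the first theta function\<close>

text \<open>
  After division by the leading exponential, the terms with the least exponent are constant, and all
  others together are at most a constant times \<open>exp (- \<pi> Im \<tau>)\<close>, because their exponents exceed the
  least one by at least \<open>1\<close>.
\<close>
lemma theta_series_at_infinity:
  assumes c: "\<And>k. norm (c k) \<le> 1"
    and \<sigma>: "filterlim (\<lambda>j. Im (\<sigma> j)) at_top sequentially"
    and A: "finite A" "\<And>k. k \<in> A \<Longrightarrow> (of_int k + \<rho>)\<^sup>2 = \<rho>\<^sup>2" "\<And>k. k \<notin> A \<Longrightarrow> (of_int k + \<rho>)\<^sup>2 \<ge> \<rho>\<^sup>2 + 1"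
  shows "(\<lambda>j. theta_series c \<rho> n 0 (\<sigma> j) * exp (- pi * \<i> * (of_real \<rho>)\<^sup>2 * \<sigma> j)) \<longlonglongrightarrow>
           (\<Sum>k\<in>A. c k * (2 * pi * \<i> * (of_int k + of_real \<rho>)) ^ n)"
proof -
  define E where "E = (\<lambda>k::int. (of_int k + \<rho>)\<^sup>2 - \<rho>\<^sup>2)"
  define d where "d = (\<lambda>k. c k * (2 * pi * \<i> * (of_int k + of_real \<rho>)) ^ n)"
  define h where "h = (\<lambda>\<tau> k. d k * exp (pi * \<i> * of_real (E k) * \<tau>))"
  define C where "C = (\<Sum>\<^sub>\<infinity>k\<in>-A. norm (h \<i> k))"
  have h: "h \<tau> k = theta_term c \<rho> n 0 \<tau> k * exp (- pi * \<i> * (of_real \<rho>)\<^sup>2 * \<tau>)" for \<tau> k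
    unfolding h_def d_def theta_term_def mult.assoc[of _ "exp _" "exp _"] exp_add[symmetric]
    by (rule arg_cong[where f = "\<lambda>x. _ * exp x"]) (simp add: E_def algebra_simps)
  have hs: "h \<tau> summable_on UNIV" "(\<lambda>k. norm (h \<tau> k)) summable_on UNIV" if "Im \<tau> > 0" for \<tau>
    unfolding h norm_mult by (intro summable_on_cmult_left theta_term_summable theta_term_abs_summable c that)+
  have g: "theta_series c \<rho> n 0 \<tau> * exp (- pi * \<i> * (of_real \<rho>)\<^sup>2 * \<tau>) = infsum (h \<tau>) UNIV" for \<tau>
    unfolding h theta_series_def by (rule infsum_cmult_left'[symmetric])
  have nh: "norm (h \<tau> k) = norm (d k) * exp (- pi * E k * Im \<tau>)" for \<tau> k
  proof -
    have "Re (pi * \<i> * of_real (E k) * \<tau>) = - pi * E k * Im \<tau>" by simp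
    then show ?thesis unfolding h_def norm_mult norm_exp_eq_Re by simp
  qed
  have bound: "norm (infsum (h \<tau>) UNIV - sum d A) \<le> exp (- pi * (Im \<tau> - 1)) * C" if \<tau>: "Im \<tau> \<ge> 1" for \<tau>
  proof -
    have "infsum (h \<tau>) (A \<union> - A) = infsum (h \<tau>) A + infsum (h \<tau>) (- A)"
      by (rule infsum_Un_disjoint) (use \<tau> in \<open>auto intro!: summable_on_subset_banach[OF hs(1)]\<close>)
    also have "infsum (h \<tau>) A = sum d A"
    proof -
      have "E k = 0" if "k \<in> A" for k using A(2)[OF that] by (simp add: E_def)
      then show ?thesis using A(1) by (simp add: h_def)
    qed
    finally have "infsum (h \<tau>) UNIV - sum d A = infsum (h \<tau>) (- A)" by simp
    also have "norm \<dots> \<le> (\<Sum>\<^sub>\<infinity>k\<in>-A. norm (h \<tau> k))"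
      by (rule norm_infsum_bound)
         (use \<tau> in \<open>auto intro!: summable_on_subset_banach[OF hs(2)]\<close>)
    also have "\<dots> \<le> (\<Sum>\<^sub>\<infinity>k\<in>-A. exp (- pi * (Im \<tau> - 1)) * norm (h \<i> k))"
    proof (rule infsum_mono)
      show "(\<lambda>k. norm (h \<tau> k)) summable_on - A" "(\<lambda>k. exp (- pi * (Im \<tau> - 1)) * norm (h \<i> k)) summable_on - A"
        using \<tau> by (auto intro!: summable_on_subset_banach[OF hs(2)] summable_on_cmult_right)
      fix k assume "k \<in> - A"
      then have "E k \<ge> 1" using A(3)[of k] by (simp add: E_def)
      then have "(Im \<tau> - 1) * 1 \<le> (Im \<tau> - 1) * E k" using \<tau> by (intro mult_left_mono) auto
      then have "pi * ((Im \<tau> - 1) * 1) \<le> pi * ((Im \<tau> - 1) * E k)" by (rule mult_left_mono) simp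
      then have "- pi * E k * Im \<tau> \<le> - pi * (Im \<tau> - 1) + (- pi * E k * 1)"
        by (simp add: algebra_simps)
      then have "exp (- pi * E k * Im \<tau>) \<le> exp (- pi * (Im \<tau> - 1)) * exp (- pi * E k * 1)"
        unfolding exp_add[symmetric] by (simp only: exp_le_cancel_iff)
      then have "norm (d k) * exp (- pi * E k * Im \<tau>) \<le> norm (d k) * (exp (- pi * (Im \<tau> - 1)) * exp (- pi * E k * 1))"
        by (intro mult_left_mono) auto
      then show "norm (h \<tau> k) \<le> exp (- pi * (Im \<tau> - 1)) * norm (h \<i> k)"
        unfolding nh by (simp add: mult_ac)
    qed
    also have "\<dots> = exp (- pi * (Im \<tau> - 1)) * C"
      unfolding C_def by (rule infsum_cmult_right')
    finally show ?thesis .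
  qed
  have "(\<lambda>j. exp (- pi * (Im (\<sigma> j) - 1)) * C) \<longlonglongrightarrow> 0 * C"
  proof (intro tendsto_mult tendsto_const)
    have "filterlim (\<lambda>j. pi * (-1 + Im (\<sigma> j))) at_top sequentially"
      by (intro filterlim_tendsto_pos_mult_at_top[OF tendsto_const] filterlim_tendsto_add_at_top[OF tendsto_const] \<sigma>) simp
    then have "filterlim (\<lambda>j. - (pi * (-1 + Im (\<sigma> j)))) at_bot sequentially"
      by (simp only: filterlim_uminus_at_bot) simp
    from filterlim_compose[OF exp_at_bot this]
    show "(\<lambda>j. exp (- pi * (Im (\<sigma> j) - 1))) \<longlonglongrightarrow> 0" by (simp add: algebra_simps)
  qed
  then have "(\<lambda>j. exp (- pi * (Im (\<sigma> j) - 1)) * C) \<longlonglongrightarrow> 0" by simp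
  moreover have "\<forall>\<^sub>F j in sequentially. norm (infsum (h (\<sigma> j)) UNIV - sum d A) \<le> exp (- pi * (Im (\<sigma> j) - 1)) * C"
    using \<sigma>[unfolded filterlim_at_top, rule_format, of 1] by eventually_elim (rule bound)
  ultimately have "(\<lambda>j. infsum (h (\<sigma> j)) UNIV - sum d A) \<longlonglongrightarrow> 0"
    by (rule Lim_null_comparison[rotated])
  then show ?thesis unfolding g d_def[symmetric] by (simp add: LIM_zero_iff)
qed

lemma Im_double: "Im (2 ^ j * \<tau>) = 2 ^ j * Im \<tau>"
proof -
  have "(2 ^ j :: complex) = of_real (2 ^ j)" by simp
  then show ?thesis by (simp only: Im_complex_of_real Re_complex_of_real times_complex.sel)
qed

lemma filterlim_Im_double:
  assumes "Im \<tau> > 0"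
  shows "filterlim (\<lambda>j. Im (2 ^ j * \<tau>)) at_top sequentially"
proof -
  have "filterlim (\<lambda>j. Im \<tau> * 2 ^ j) at_top sequentially"
    by (intro filterlim_tendsto_pos_mult_at_top[OF tendsto_const] assms) real_asymp
  then show ?thesis unfolding Im_double by (simp only: mult.commute)
qed

lemma theta_constants_at_infinity:
  assumes \<sigma>: "filterlim (\<lambda>j. Im (\<sigma> j)) at_top sequentially"
  shows "(\<lambda>j. theta3 0 (\<sigma> j)) \<longlonglongrightarrow> 1" "(\<lambda>j. theta4 0 (\<sigma> j)) \<longlonglongrightarrow> 1"
    "(\<lambda>j. theta2 0 (\<sigma> j) * exp (- pi * \<i> * (1/2)\<^sup>2 * \<sigma> j)) \<longlonglongrightarrow> 2"
    "(\<lambda>j. stheta1 0 1 0 (\<sigma> j) * exp (- pi * \<i> * (1/2)\<^sup>2 * \<sigma> j)) \<longlonglongrightarrow> 2 * pi"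
proof -
  have int: "real_of_int k * real_of_int k \<ge> 1" if "k \<noteq> 0" for k
  proof -
    have "1 \<le> \<bar>k\<bar>" using that by simp
    then have "1 * 1 \<le> \<bar>k\<bar> * \<bar>k\<bar>" by (intro mult_mono) auto
    then have "1 \<le> k * k" by simp
    then show ?thesis by (metis of_int_1_le_iff of_int_mult)
  qed
  have half: "(real_of_int k + 1/2)\<^sup>2 \<ge> (1/2)\<^sup>2 + 1" if "k \<notin> {0, -1}" for k
  proof -
    have "k * (k + 1) \<ge> 1"
    proof (cases "k \<ge> 1")
      case True
      then have "1 * 1 \<le> k * (k + 1)" by (intro mult_mono) auto
      then show ?thesis by simp
    next
      case False
      with that have "1 * 1 \<le> (- k) * (- k - 1)" by (intro mult_mono) auto
      then show ?thesis by (simp add: algebra_simps)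
    qed
    then have "real_of_int (k * (k + 1)) \<ge> 1" by (simp only: of_int_1_le_iff)
    then show ?thesis by (simp add: power2_eq_square algebra_simps)
  qed
  have z: "(\<lambda>j. theta_series (theta_phase 0 b) 0 0 0 (\<sigma> j)) \<longlonglongrightarrow> theta_phase 0 b 0" for b
    using theta_series_at_infinity[where c = "theta_phase 0 b" and A = "{0}" and \<rho> = 0 and n = 0, OF norm_theta_phase \<sigma>] int
    by (simp add: power2_eq_square)
  have half': "k = 0 \<or> k = -1 \<Longrightarrow> (real_of_int k + 1/2) * (real_of_int k + 1/2) * 4 = 1" for k by auto
  have h: "(\<lambda>j. theta_series (theta_phase 1 b) (1/2) n 0 (\<sigma> j) * exp (- pi * \<i> * (1/2)\<^sup>2 * \<sigma> j)) \<longlonglongrightarrow>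
      theta_phase 1 b 0 * (2 * pi * \<i> * (1/2)) ^ n + theta_phase 1 b (-1) * (2 * pi * \<i> * (-1 + 1/2)) ^ n" for b n
    using theta_series_at_infinity[where c = "theta_phase 1 b" and A = "{0, -1}" and \<rho> = "1/2" and n = n, OF norm_theta_phase \<sigma>] half half'
    by (simp add: power2_eq_square)
  have ph: "theta_phase a 0 k = 1" "theta_phase 0 b 0 = 1" "theta_phase 1 1 0 = \<i>" "theta_phase 1 1 (-1) = - \<i>" for a b k
  proof -
    have "exp (\<i> * pi / 2) = \<i>" using cis_pi_half cis_conv_exp[of "pi/2"] by simp
    then show "theta_phase 1 1 0 = \<i>" "theta_phase 1 1 (-1) = - \<i>"
      by (simp_all add: theta_phase_def exp_minus mult_ac)
  qed (simp_all add: theta_phase_def)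
  show "(\<lambda>j. theta3 0 (\<sigma> j)) \<longlonglongrightarrow> 1"
    using z[of 0] by (simp add: stheta_0(3)[symmetric] stheta3_def theta_shift_def ph)
  show "(\<lambda>j. theta4 0 (\<sigma> j)) \<longlonglongrightarrow> 1"
    using z[of 1] by (simp add: stheta_0(4)[symmetric] stheta4_def theta_shift_def ph)
  show "(\<lambda>j. theta2 0 (\<sigma> j) * exp (- pi * \<i> * (1/2)\<^sup>2 * \<sigma> j)) \<longlonglongrightarrow> 2"
    using h[of 0 0] by (simp add: stheta_0(2)[symmetric] stheta2_def theta_shift_def ph)
  have "(\<lambda>j. - (theta_series (theta_phase 1 1) (1/2) 1 0 (\<sigma> j) * exp (- pi * \<i> * (1/2)\<^sup>2 * \<sigma> j))) \<longlonglongrightarrow> - (- of_real (2 * pi))"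
    by (rule tendsto_minus) (use h[of 1 1] in \<open>simp add: ph\<close>)
  then show "(\<lambda>j. stheta1 0 1 0 (\<sigma> j) * exp (- pi * \<i> * (1/2)\<^sup>2 * \<sigma> j)) \<longlonglongrightarrow> 2 * pi"
    by (simp add: stheta1_def theta_shift_def)
qed


text \<open>
  By \<open>\<vartheta>\<^sub>3 \<vartheta>\<^sub>4 (\<tau>) = \<vartheta>\<^sub>4 (2 \<tau>)\<^sup>2\<close> a zero of \<open>\<vartheta>\<^sub>4\<close> at \<open>\<tau>\<close> would propagate to all \<open>2\<^sup>j \<tau>\<close>, but \<open>\<vartheta>\<^sub>4\<close>
  tends to \<open>1\<close> there. The same formula then covers \<open>\<vartheta>\<^sub>3\<close>. For \<open>\<vartheta>\<^sub>2\<close> the argument is repeated with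
  \<open>\<vartheta>\<^sub>2 (\<tau>)\<^sup>2 = 2 \<vartheta>\<^sub>2 \<vartheta>\<^sub>3 (2 \<tau>)\<close>, after removing the factor \<open>exp (\<pi> \<i> \<tau> / 4)\<close> by which \<open>\<vartheta>\<^sub>2\<close> decays.
\<close>
lemma theta_constants_nonzero:
  assumes \<tau>: "Im \<tau> > 0"
  shows "theta2 0 \<tau> \<noteq> 0" "theta3 0 \<tau> \<noteq> 0" "theta4 0 \<tau> \<noteq> 0"
proof -
  have Im: "Im (2 ^ j * \<tau>) > 0" if "Im \<tau> > 0" for \<tau> j using that by (simp add: Im_double)
  have 4: "theta4 0 \<tau> \<noteq> 0" if \<tau>: "Im \<tau> > 0" for \<tau>
  proof
    assume z: "theta4 0 \<tau> = 0"
    have "theta4 0 (2 ^ j * \<tau>) = 0" for j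
    proof (induction j)
      case (Suc j)
      then show ?case using theta_constants_2tau(4)[OF Im[OF \<tau>, of j]] by (simp add: mult_ac)
    qed (use z in auto)
    with theta_constants_at_infinity(2)[OF filterlim_Im_double[OF \<tau>]] show False
      by (simp add: LIMSEQ_const_iff)
  qed
  have 3: "theta3 0 \<tau> \<noteq> 0" if \<tau>: "Im \<tau> > 0" for \<tau>
    using theta_constants_2tau(4)[OF \<tau>] 4[of "2 * \<tau>"] \<tau> by auto
  show "theta2 0 \<tau> \<noteq> 0"
  proof
    assume z: "theta2 0 \<tau> = 0"
    have "theta2 0 (2 ^ j * \<tau>) = 0" for j
    proof (induction j)
      case (Suc j)
      then show ?case using theta_constants_2tau(1)[OF Im[OF \<tau>, of j]] 3[OF Im[OF \<tau>, of "Suc j"]] by (simp add: mult_ac)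
    qed (use z in auto)
    with theta_constants_at_infinity(3)[OF filterlim_Im_double[OF \<tau>]] show False
      by (simp add: LIMSEQ_const_iff)
  qed
  show "theta3 0 \<tau> \<noteq> 0" "theta4 0 \<tau> \<noteq> 0" using 3 4 \<tau> by auto
qed

lemma theta_deriv_0:
  assumes \<tau>: "Im \<tau> > 0"
  shows "stheta2 0 1 0 \<tau> = 0" "stheta3 0 1 0 \<tau> = 0" "stheta4 0 1 0 \<tau> = 0"
proof -
  have *: "D = 0" if "(f has_field_derivative D) (at 0)" "\<And>z. f (- z) = f z" for f :: "complex \<Rightarrow> complex" and D
  proof -
    have "((\<lambda>z. f (- z)) has_field_derivative D * (-1)) (at 0)"
      using DERIV_chain2[OF _ DERIV_minus[OF DERIV_ident], of f D 0 UNIV] that(1) by simp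
    then have "(f has_field_derivative D * (-1)) (at 0)" unfolding that(2) .
    then have "D = D * (-1)" by (rule DERIV_unique[OF that(1)])
    then show ?thesis by simp
  qed
  note d = stheta_deriv_z[OF \<tau>, of 0 0, unfolded stheta_0 One_nat_def[symmetric]]
  show "stheta2 0 1 0 \<tau> = 0" "stheta3 0 1 0 \<tau> = 0" "stheta4 0 1 0 \<tau> = 0"
    by (rule * d theta_even_odd)+
qed

text \<open>
  Put \<open>z + e\<close> and \<open>z - e\<close> into the product formula for \<open>\<theta>\<^sub>1 \<theta>\<^sub>2\<close> and differentiate at \<open>e = 0\<close>.
\<close>
lemma theta_wronskian_2tau:
  assumes \<tau>: "Im \<tau> > 0"
  shows "stheta1 0 1 z \<tau> * theta2 z \<tau> - theta1 z \<tau> * stheta2 0 1 z \<tau> = 2 * theta4 (2 * z) (2 * \<tau>) * stheta1 0 1 0 (2 * \<tau>)"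
proof -
  have \<tau>2: "Im (2 * \<tau>) > 0" using \<tau> by simp
  note d = stheta_deriv_z[OF \<tau>, of 0 0, unfolded stheta_0 One_nat_def[symmetric]]
  note d2 = stheta_deriv_z[OF \<tau>2, of 0 0, unfolded stheta_0 One_nat_def[symmetric]]
  have eq: "theta1 (z + e) \<tau> * theta2 (z - e) \<tau> =
      theta1 (2 * z) (2 * \<tau>) * theta4 (2 * e) (2 * \<tau>) + theta4 (2 * z) (2 * \<tau>) * theta1 (2 * e) (2 * \<tau>)" for e
  proof -
    have s: "z + e + (z - e) = 2 * z" "z + e - (z - e) = 2 * e" by simp_all
    show ?thesis using theta_products(5)[OF \<tau>, of "z + e" "z - e"] unfolding s .
  qed
  have "((\<lambda>e. theta1 (z + e) \<tau> * theta2 (z - e) \<tau>) has_field_derivative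
      (stheta1 0 1 z \<tau> * theta2 z \<tau> - theta1 z \<tau> * stheta2 0 1 z \<tau>)) (at 0)"
  proof -
    have 1: "((\<lambda>e. theta1 (z + e) \<tau>) has_field_derivative stheta1 0 1 (z + 0) \<tau> * 1) (at 0)"
      by (rule DERIV_chain2[OF d(1)]) (auto intro!: derivative_eq_intros)
    have 2: "((\<lambda>e. theta2 (z - e) \<tau>) has_field_derivative stheta2 0 1 (z - 0) \<tau> * (-1)) (at 0)"
      by (rule DERIV_chain2[OF d(2)]) (auto intro!: derivative_eq_intros)
    show ?thesis using DERIV_mult[OF 1 2] by (simp add: algebra_simps)
  qed
  moreover have "((\<lambda>e. theta1 (z + e) \<tau> * theta2 (z - e) \<tau>) has_field_derivative
      (2 * theta4 (2 * z) (2 * \<tau>) * stheta1 0 1 0 (2 * \<tau>))) (at 0)"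
  proof -
    have 1: "((\<lambda>e. theta1 (2 * e) (2 * \<tau>)) has_field_derivative stheta1 0 1 (2 * 0) (2 * \<tau>) * 2) (at 0)"
      by (rule DERIV_chain2[OF d2(1)]) (auto intro!: derivative_eq_intros)
    have 2: "((\<lambda>e. theta4 (2 * e) (2 * \<tau>)) has_field_derivative stheta4 0 1 (2 * 0) (2 * \<tau>) * 2) (at 0)"
      by (rule DERIV_chain2[OF d2(4)]) (auto intro!: derivative_eq_intros)
    show ?thesis unfolding eq
      using DERIV_add[OF DERIV_cmult[OF 2, of "theta1 (2 * z) (2 * \<tau>)"] DERIV_cmult[OF 1, of "theta4 (2 * z) (2 * \<tau>)"]]
        theta_deriv_0(3)[OF \<tau>2] by (simp add: mult_ac)
  qed
  ultimately show ?thesis by (rule DERIV_unique)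
qed

text \<open>
  The quotient \<open>J = \<vartheta>\<^sub>1' / (\<vartheta>\<^sub>2 \<vartheta>\<^sub>3 \<vartheta>\<^sub>4)\<close> satisfies \<open>J (2 \<tau>) = J \<tau>\<close>, by the Wronskian identity at
  \<open>z = 0\<close> and the duplication of the theta constants. So it equals its limit \<open>\<pi>\<close> along \<open>2\<^sup>j \<tau>\<close>.
\<close>
theorem jacobi_derivative_formula:
  assumes \<tau>: "Im \<tau> > 0"
  shows "stheta1 0 1 0 \<tau> = pi * theta2 0 \<tau> * theta3 0 \<tau> * theta4 0 \<tau>"
proof -
  define J where "J = (\<lambda>\<tau>. stheta1 0 1 0 \<tau> / (theta2 0 \<tau> * theta3 0 \<tau> * theta4 0 \<tau>))"
  have Im: "Im (2 ^ j * \<tau>) > 0" for j using \<tau> by (simp add: Im_double)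
  have J2: "J (2 * \<tau>) = J \<tau>" if \<tau>: "Im \<tau> > 0" for \<tau>
  proof -
    have \<tau>2: "Im (2 * \<tau>) > 0" using \<tau> by simp
    note nz = theta_constants_nonzero[OF \<tau>] theta_constants_nonzero[OF \<tau>2]
    have w: "stheta1 0 1 0 \<tau> * theta2 0 \<tau> = 2 * theta4 0 (2 * \<tau>) * stheta1 0 1 0 (2 * \<tau>)"
      using theta_wronskian_2tau[OF \<tau>, of 0] by simp
    have "J \<tau> = (stheta1 0 1 0 \<tau> * theta2 0 \<tau>) / ((theta2 0 \<tau>)\<^sup>2 * (theta3 0 \<tau> * theta4 0 \<tau>))"
      using nz by (simp add: J_def power2_eq_square)
    also have "\<dots> = J (2 * \<tau>)"
      unfolding w theta_constants_2tau[OF \<tau>] using nz by (simp add: J_def power2_eq_square)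
    finally show ?thesis by simp
  qed
  have "J (2 ^ j * \<tau>) = J \<tau>" for j
    by (induction j) (use J2[OF Im] in \<open>simp_all add: mult_ac\<close>)
  then have 1: "(\<lambda>j. J (2 ^ j * \<tau>)) \<longlonglongrightarrow> J \<tau>" by simp
  note lim = theta_constants_at_infinity[OF filterlim_Im_double[OF \<tau>]]
  have "(\<lambda>j. (stheta1 0 1 0 (2 ^ j * \<tau>) * exp (- pi * \<i> * (1/2)\<^sup>2 * (2 ^ j * \<tau>))) /
       ((theta2 0 (2 ^ j * \<tau>) * exp (- pi * \<i> * (1/2)\<^sup>2 * (2 ^ j * \<tau>))) * theta3 0 (2 ^ j * \<tau>) * theta4 0 (2 ^ j * \<tau>)))
       \<longlonglongrightarrow> of_real (2 * pi) / (2 * 1 * 1)"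
    by (intro tendsto_intros lim) simp
  then have "(\<lambda>j. J (2 ^ j * \<tau>)) \<longlonglongrightarrow> pi"
    by (simp add: J_def mult.assoc)
  with 1 have "J \<tau> = pi" using LIMSEQ_unique by blast
  then show ?thesis using theta_constants_nonzero[OF \<tau>] by (simp add: J_def field_simps)
qed

theorem theta_wronskian:
  assumes \<tau>: "Im \<tau> > 0"
  shows "stheta1 0 1 z \<tau> * theta2 z \<tau> - theta1 z \<tau> * stheta2 0 1 z \<tau> = pi * (theta2 0 \<tau>)\<^sup>2 * (theta3 z \<tau> * theta4 z \<tau>)"
proof -
  have \<tau>2: "Im (2 * \<tau>) > 0" using \<tau> by simp
  have "theta3 z \<tau> * theta4 z \<tau> = theta4 (2 * z) (2 * \<tau>) * theta4 0 (2 * \<tau>)"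
    using theta_products(6)[OF \<tau>, of z z] unfolding mult_2[symmetric] by simp
  then show ?thesis
    unfolding theta_wronskian_2tau[OF \<tau>] theta_constants_2tau(1)[OF \<tau>] jacobi_derivative_formula[OF \<tau>2] by simp
qed

lemma exp_eq_1E:
  fixes w :: complex
  assumes "exp w = 1"
  obtains n :: int where "w = 2 * of_int n * pi * \<i>"
proof -
  from assms[unfolded exp_eq_1] obtain n :: int where "Re w = 0" "Im w = of_int (2 * n) * pi" by blast
  then have "w = 2 * of_int n * pi * \<i>" by (simp add: complex_eq_iff)
  then show ?thesis by (rule that)
qed

text \<open>
  Let \<open>b = z\<^sub>0 / 2\<close>. By duplication \<open>\<theta>\<^sub>1 \<theta>\<^sub>2 \<theta>\<^sub>3 \<theta>\<^sub>4\<close> vanishes at \<open>b\<close>, so \<open>\<theta>\<^sub>1 = 0\<close>, \<open>\<theta>\<^sub>2 = 0\<close> or the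
  Wronskian of \<open>\<theta>\<^sub>1\<close> and \<open>\<theta>\<^sub>2\<close> vanishes there. In each case the derivative of the addition formula with
  respect to \<open>b\<close> is a multiple of the formula itself. This says that \<open>E (w) = \<theta>\<^sub>1 (w + z\<^sub>0)\<close> satisfies
  \<open>E' \<theta>\<^sub>1 - E \<theta>\<^sub>1' = 2 h E \<theta>\<^sub>1\<close> with a constant \<open>h\<close>, whence \<open>E (w) = C exp (2 h w) \<theta>\<^sub>1 (w)\<close>. The
  quasi-periods \<open>1\<close> and \<open>\<tau>\<close> then give \<open>exp (2 h) = 1\<close> and \<open>exp (2 h \<tau> + 2 \<pi> \<i> z\<^sub>0) = 1\<close>.
\<close>
theorem theta1_zeros:
  assumes \<tau>: "Im \<tau> > 0" and z0: "theta1 z0 \<tau> = 0"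
  obtains m n :: int where "z0 = of_int m + of_int n * \<tau>"
proof -
  note nz = theta_constants_nonzero[OF \<tau>]
  note d = stheta_deriv_z[OF \<tau>, of 0 0, unfolded stheta_0 One_nat_def[symmetric]]
  define b where "b = z0 / 2"
  define t1 t2 where "t1 = (\<lambda>z. theta1 z \<tau>)" and "t2 = (\<lambda>z. theta2 z \<tau>)"
  define t1' t2' where "t1' = (\<lambda>z. stheta1 0 1 z \<tau>)" and "t2' = (\<lambda>z. stheta2 0 1 z \<tau>)"
  have d1: "(t1 has_field_derivative t1' z) (at z)" for z using d(1) by (simp add: t1_def t1'_def)
  have d2: "(t2 has_field_derivative t2' z) (at z)" for z using d(2) by (simp add: t2_def t2'_def)
  have hol1: "t1 holomorphic_on UNIV"
    using d1 by (auto simp: holomorphic_on_def field_differentiable_def intro: has_field_derivative_at_within)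
  have wr: "t1' z * t2 z - t1 z * t2' z = pi * (theta2 0 \<tau>)\<^sup>2 * (theta3 z \<tau> * theta4 z \<tau>)" for z
    unfolding t1_def t2_def t1'_def t2'_def by (rule theta_wronskian[OF \<tau>])
  have ad: "(theta2 0 \<tau>)\<^sup>2 * (t1 (a + b) * t1 (a - b)) = (t1 a)\<^sup>2 * (t2 b)\<^sup>2 - (t2 a)\<^sup>2 * (t1 b)\<^sup>2" for a b
    unfolding t1_def t2_def by (rule theta_addition(1)[OF \<tau>])
  have ad': "(theta2 0 \<tau>)\<^sup>2 * (t1' (a + b) * t1 (a - b) - t1 (a + b) * t1' (a - b)) =
      2 * ((t1 a)\<^sup>2 * (t2 b * t2' b) - (t2 a)\<^sup>2 * (t1 b * t1' b))" for a b
  proof -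
    have "((\<lambda>b. (theta2 0 \<tau>)\<^sup>2 * (t1 (a + b) * t1 (a - b))) has_field_derivative
        (theta2 0 \<tau>)\<^sup>2 * (t1' (a + b) * t1 (a - b) - t1 (a + b) * t1' (a - b))) (at b)"
      by (auto intro!: derivative_eq_intros DERIV_chain2[OF d1] simp: algebra_simps)
    moreover have "((\<lambda>b. (t1 a)\<^sup>2 * (t2 b)\<^sup>2 - (t2 a)\<^sup>2 * (t1 b)\<^sup>2) has_field_derivative
        2 * ((t1 a)\<^sup>2 * (t2 b * t2' b) - (t2 a)\<^sup>2 * (t1 b * t1' b))) (at b)"
      by (auto intro!: derivative_eq_intros d1 d2 simp: algebra_simps)
    ultimately show ?thesis unfolding ad by (rule DERIV_unique)
  qed
  have "t1 b * t2 b * (theta3 b \<tau> * theta4 b \<tau>) = 0"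
    using theta1_duplication[OF \<tau>, of b] z0 by (simp add: b_def t1_def t2_def)
  then have deg: "t1 b * t2 b * (t1' b * t2 b - t1 b * t2' b) = 0"
    unfolding wr using nz by auto
  have t1nz: "t1' 0 \<noteq> 0" using jacobi_derivative_formula[OF \<tau>] nz by (simp add: t1'_def)
  obtain w0 where w0: "t1 w0 \<noteq> 0"
  proof (rule ccontr)
    assume "\<not> thesis"
    with that have "t1 = (\<lambda>_. 0)" by blast
    then have "t1' 0 = 0" using DERIV_unique[OF d1[of 0], of 0] by simp
    with t1nz show False by simp
  qed
  define U where "U = {w. t1 w \<noteq> 0}"
  have U: "open U" "w0 \<in> U"
    using w0 holomorphic_on_imp_continuous_on[OF hol1] by (auto simp: U_def intro: open_Collect_neq)
  \<comment> \<open>A common zero of \<open>\<theta>\<^sub>1\<close> and \<open>\<theta>\<^sub>2\<close> would make the right-hand side of the addition formula vanish identically.\<close>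
  have nb: "t1 b \<noteq> 0 \<or> t2 b \<noteq> 0"
  proof (rule ccontr)
    assume "\<not> ?thesis"
    then have *: "t1 b = 0" "t2 b = 0" by auto
    have ab: "t1 (a + b) * t1 (a - b) = 0" for a using ad[of a b] * nz by simp
    have prod: "t1 (w + 2 * b) * t1 w = 0" for w
      using ab[of "w + b"] by (simp add: algebra_simps)
    have "t1 (w + 2 * b) = 0" for w
    proof (rule analytic_continuation_open[of U UNIV "\<lambda>w. t1 (w + 2 * b)" "\<lambda>_. 0"])
      have "(t1 \<circ> (\<lambda>w. w + 2 * b)) holomorphic_on UNIV"
        by (rule holomorphic_on_compose_gen[OF _ hol1]) (auto intro!: holomorphic_intros)
      then show "(\<lambda>w. t1 (w + 2 * b)) holomorphic_on UNIV" by (simp add: o_def)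
    qed (use U prod in \<open>auto simp: U_def\<close>)
    from this[of "w0 - 2 * b"] w0 show False by simp
  qed
  \<comment> \<open>The logarithmic derivative of whichever of \<open>\<theta>\<^sub>1\<close>, \<open>\<theta>\<^sub>2\<close> is nonzero at \<open>b\<close>; if both are nonzero, the vanishing Wronskian makes the two choices equal.\<close>
  define h where "h = (if t2 b \<noteq> 0 then t2' b / t2 b else t1' b / t1 b)"
  have h: "t2 b * t2' b = h * (t2 b)\<^sup>2" "t1 b * t1' b = h * (t1 b)\<^sup>2"
    using deg nb by (auto simp: h_def power2_eq_square field_simps)
  have E: "t1' (w + z0) * t1 w - t1 (w + z0) * t1' w = 2 * h * (t1 (w + z0) * t1 w)" for w
  proof -
    have s: "w + b + b = w + z0" "w + b - b = w" by (simp_all add: b_def)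
    have "(theta2 0 \<tau>)\<^sup>2 * (t1' (w + z0) * t1 w - t1 (w + z0) * t1' w) =
        2 * h * ((t1 (w + b))\<^sup>2 * (t2 b)\<^sup>2 - (t2 (w + b))\<^sup>2 * (t1 b)\<^sup>2)"
      using ad'[of "w + b" b] unfolding s h by (simp add: algebra_simps)
    also have "\<dots> = (theta2 0 \<tau>)\<^sup>2 * (2 * h * (t1 (w + z0) * t1 w))"
      unfolding ad[of "w + b" b, symmetric] s by simp
    finally show ?thesis using nz by simp
  qed
  obtain r where r: "r > 0" "ball w0 r \<subseteq> U" using U openE by blast
  have "\<exists>C. \<forall>w\<in>ball w0 r. exp (- 2 * h * w) * t1 (w + z0) / t1 w = C"
  proof (rule has_field_derivative_zero_constant)
    fix w assume "w \<in> ball w0 r"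
    then have nz: "t1 w \<noteq> 0" using r by (auto simp: U_def)
    have 1: "((\<lambda>w. t1 (w + z0)) has_field_derivative t1' (w + z0) * 1) (at w)"
      by (rule DERIV_chain2[OF d1]) (auto intro!: derivative_eq_intros)
    have "((\<lambda>w. exp (- 2 * h * w) * t1 (w + z0) / t1 w) has_field_derivative
       (exp (- 2 * h * w) * (t1' (w + z0) * t1 w - t1 (w + z0) * t1' w - 2 * h * (t1 (w + z0) * t1 w))) / (t1 w)\<^sup>2) (at w)"
    proof -
      have 2: "((\<lambda>w. exp (- 2 * h * w)) has_field_derivative exp (- 2 * h * w) * (- 2 * h)) (at w)"
        by (rule derivative_eq_intros refl)+ simp
      show ?thesis
        by (rule DERIV_cong[OF DERIV_divide[OF DERIV_mult[OF 2 1] d1 nz]])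
           (simp add: power2_eq_square algebra_simps)
    qed
    then show "((\<lambda>w. exp (- 2 * h * w) * t1 (w + z0) / t1 w) has_field_derivative 0) (at w within ball w0 r)"
      by (auto simp: E dest: has_field_derivative_at_within)
  qed auto
  then obtain C where C: "\<And>w. w \<in> ball w0 r \<Longrightarrow> exp (- 2 * h * w) * t1 (w + z0) / t1 w = C" by blast
  have shift: "t1 (w + z0) = C * exp (2 * h * w) * t1 w" for w
  proof (rule analytic_continuation_open[of "ball w0 r" UNIV "\<lambda>w. t1 (w + z0)" "\<lambda>w. C * exp (2 * h * w) * t1 w"])
    have "(t1 \<circ> (\<lambda>w. w + z0)) holomorphic_on UNIV"
      by (rule holomorphic_on_compose_gen[OF _ hol1]) (auto intro!: holomorphic_intros)
    then show "(\<lambda>w. t1 (w + z0)) holomorphic_on UNIV" by (simp add: o_def)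
    show "(\<lambda>w. C * exp (2 * h * w) * t1 w) holomorphic_on UNIV" by (intro holomorphic_intros hol1)
    fix w assume w: "w \<in> ball w0 r"
    then have "t1 w \<noteq> 0" using r by (auto simp: U_def)
    with C[OF w] show "t1 (w + z0) = C * exp (2 * h * w) * t1 w"
      by (simp add: exp_minus field_simps)
  qed (use r in auto)
  have Cnz: "C \<noteq> 0"
    using shift[of "w0 - z0"] w0 by auto
  have q1: "t1 (w + 1) = - t1 w" and q2: "t1 (w + \<tau>) = - exp (- pi * \<i> * \<tau> - 2 * pi * \<i> * w) * t1 w" for w
    unfolding t1_def by (rule theta1_quasiperiods)+
  have s0: "t1 (w0 + z0) \<noteq> 0" using shift[of w0] Cnz w0 by simp
  have "exp (2 * h) = 1"
  proof -
    have "- t1 (w0 + z0) = t1 ((w0 + 1) + z0)" using q1[of "w0 + z0"] by (simp add: add_ac)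
    also have "\<dots> = C * exp (2 * h * (w0 + 1)) * t1 (w0 + 1)" by (rule shift)
    also have "\<dots> = - exp (2 * h) * t1 (w0 + z0)" unfolding q1 shift[of w0] by (simp add: algebra_simps exp_add)
    finally show ?thesis using s0 by simp
  qed
  then obtain n :: int where n: "2 * h = 2 * of_int n * pi * \<i>"
    by (rule exp_eq_1E)
  have "exp (- 2 * pi * \<i> * z0 - 2 * h * \<tau>) = 1"
  proof -
    have "- exp (- pi * \<i> * \<tau> - 2 * pi * \<i> * (w0 + z0)) * t1 (w0 + z0) = t1 ((w0 + \<tau>) + z0)"
      using q2[of "w0 + z0"] by (simp add: add_ac)
    also have "\<dots> = C * exp (2 * h * (w0 + \<tau>)) * t1 (w0 + \<tau>)" by (rule shift)
    also have "\<dots> = - (exp (2 * h * \<tau>) * exp (- pi * \<i> * \<tau> - 2 * pi * \<i> * w0)) * t1 (w0 + z0)"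
      unfolding q2 shift[of w0] by (simp add: algebra_simps exp_add)
    finally have "exp (- pi * \<i> * \<tau> - 2 * pi * \<i> * (w0 + z0)) = exp (2 * h * \<tau>) * exp (- pi * \<i> * \<tau> - 2 * pi * \<i> * w0)"
      using s0 by simp
    also have "exp (- pi * \<i> * \<tau> - 2 * pi * \<i> * (w0 + z0)) = exp (- 2 * pi * \<i> * z0) * exp (- pi * \<i> * \<tau> - 2 * pi * \<i> * w0)"
      unfolding exp_add[symmetric] by (simp add: algebra_simps)
    finally have "exp (- 2 * pi * \<i> * z0) = exp (2 * h * \<tau>)" by simp
    then show ?thesis by (simp add: exp_diff)
  qed
  then obtain m :: int where "- 2 * pi * \<i> * z0 - 2 * h * \<tau> = 2 * of_int m * pi * \<i>"
    by (rule exp_eq_1E)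
  then have "(2 * pi * \<i>) * z0 = (2 * pi * \<i>) * (of_int (- m) + of_int (- n) * \<tau>)"
    unfolding n of_int_minus of_real_mult of_real_of_int_eq of_real_numeral of_real_neg_numeral by algebra
  then have "z0 = of_int (- m) + of_int (- n) * \<tau>" by (subst (asm) mult_cancel_left) simp
  then show ?thesis by (rule that)
qed

section \<open>Second-order identities\<close>

text \<open>
  The second derivative of the addition formula with respect to \<open>b\<close> at \<open>b = 0\<close>. It expresses the
  second logarithmic derivative of \<open>\<theta>\<^sub>1\<close>, that is, up to a constant, \<open>- \<wp>\<close>, by \<open>(\<theta>\<^sub>2 / \<theta>\<^sub>1)\<^sup>2\<close>.
\<close>
lemma theta1_hirota:
  assumes \<tau>: "Im \<tau> > 0"
  shows "stheta1 0 2 z \<tau> * theta1 z \<tau> - (stheta1 0 1 z \<tau>)\<^sup>2 =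
     stheta2 0 2 0 \<tau> / theta2 0 \<tau> * (theta1 z \<tau>)\<^sup>2 - pi\<^sup>2 * (theta3 0 \<tau>)\<^sup>2 * (theta4 0 \<tau>)\<^sup>2 * (theta2 z \<tau>)\<^sup>2"
proof -
  define t1 t2 where "t1 = (\<lambda>z. theta1 z \<tau>)" and "t2 = (\<lambda>z. theta2 z \<tau>)"
  define t1' t2' where "t1' = (\<lambda>z. stheta1 0 1 z \<tau>)" and "t2' = (\<lambda>z. stheta2 0 1 z \<tau>)"
  define t1'' t2'' where "t1'' = (\<lambda>z. stheta1 0 2 z \<tau>)" and "t2'' = (\<lambda>z. stheta2 0 2 z \<tau>)"
  define c where "c = (theta2 0 \<tau>)\<^sup>2"
  note nz = theta_constants_nonzero[OF \<tau>]
  have d1: "(t1 has_field_derivative t1' z) (at z)" "(t1' has_field_derivative t1'' z) (at z)" for z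
    using stheta_deriv_z(1)[OF \<tau>, of 0 0 z] stheta_deriv_z(1)[OF \<tau>, of 0 1 z]
    by (simp_all add: t1_def t1'_def t1''_def stheta_0 numeral_2_eq_2)
  have d2: "(t2 has_field_derivative t2' z) (at z)" "(t2' has_field_derivative t2'' z) (at z)" for z
    using stheta_deriv_z(2)[OF \<tau>, of 0 0 z] stheta_deriv_z(2)[OF \<tau>, of 0 1 z]
    by (simp_all add: t2_def t2'_def t2''_def stheta_0 numeral_2_eq_2)
  have ad: "c * (t1 (z + b) * t1 (z - b)) = (t1 z)\<^sup>2 * (t2 b)\<^sup>2 - (t2 z)\<^sup>2 * (t1 b)\<^sup>2" for b
    unfolding t1_def t2_def c_def by (rule theta_addition(1)[OF \<tau>])
  have p: "((\<lambda>b. f (z + b)) has_field_derivative f' (z + b)) (at b)"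
    and n: "((\<lambda>b. f (z - b)) has_field_derivative - f' (z - b)) (at b)"
    if "\<And>w. (f has_field_derivative f' w) (at w)" for f f' :: "complex \<Rightarrow> complex" and b
  proof -
    have "((\<lambda>b. f (z + b)) has_field_derivative f' (z + b) * 1) (at b)"
      by (rule DERIV_chain2[OF that]) (auto intro!: derivative_eq_intros)
    then show "((\<lambda>b. f (z + b)) has_field_derivative f' (z + b)) (at b)" by simp
    have "((\<lambda>b. f (z - b)) has_field_derivative f' (z - b) * (-1)) (at b)"
      by (rule DERIV_chain2[OF that]) (auto intro!: derivative_eq_intros)
    then show "((\<lambda>b. f (z - b)) has_field_derivative - f' (z - b)) (at b)" by simp
  qed
  have ad': "c * (t1' (z + b) * t1 (z - b) - t1 (z + b) * t1' (z - b)) =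
      2 * ((t1 z)\<^sup>2 * (t2 b * t2' b) - (t2 z)\<^sup>2 * (t1 b * t1' b))" for b
  proof (rule DERIV_unique)
    show "((\<lambda>b. c * (t1 (z + b) * t1 (z - b))) has_field_derivative
        c * (t1' (z + b) * t1 (z - b) - t1 (z + b) * t1' (z - b))) (at b)"
      by (rule DERIV_cong[OF DERIV_cmult[OF DERIV_mult[OF p[OF d1(1)] n[OF d1(1)]]]]) simp
    show "((\<lambda>b. c * (t1 (z + b) * t1 (z - b))) has_field_derivative
        2 * ((t1 z)\<^sup>2 * (t2 b * t2' b) - (t2 z)\<^sup>2 * (t1 b * t1' b))) (at b)"
      unfolding ad power2_eq_square[of "t2 b" for b] power2_eq_square[of "t1 b" for b]
      by (rule DERIV_cong[OF DERIV_diff[OF DERIV_cmult[OF DERIV_mult[OF d2(1) d2(1)]] DERIV_cmult[OF DERIV_mult[OF d1(1) d1(1)]]]])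
         (simp add: algebra_simps)
  qed
  have t0: "t1 0 = 0" "t2' 0 = 0" "t2 0 = theta2 0 \<tau>" "t1' 0 = pi * theta2 0 \<tau> * theta3 0 \<tau> * theta4 0 \<tau>" "t2'' 0 = stheta2 0 2 0 \<tau>"
    using theta_deriv_0[OF \<tau>] jacobi_derivative_formula[OF \<tau>] by (simp_all add: t1_def t2'_def t2_def t1'_def t2''_def)
  have "c * (2 * (t1'' z * t1 z - (t1' z)\<^sup>2)) = 2 * ((t1 z)\<^sup>2 * (t2 0 * t2'' 0) - (t2 z)\<^sup>2 * (t1' 0)\<^sup>2)"
  proof (rule DERIV_unique)
    show "((\<lambda>b. c * (t1' (z + b) * t1 (z - b) - t1 (z + b) * t1' (z - b))) has_field_derivative
        c * (2 * (t1'' z * t1 z - (t1' z)\<^sup>2))) (at 0)"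
      by (rule DERIV_cong[OF DERIV_cmult[OF DERIV_diff[OF DERIV_mult[OF p[OF d1(2)] n[OF d1(1)]] DERIV_mult[OF p[OF d1(1)] n[OF d1(2)]]]]])
         (simp add: power2_eq_square algebra_simps)
    show "((\<lambda>b. c * (t1' (z + b) * t1 (z - b) - t1 (z + b) * t1' (z - b))) has_field_derivative
        2 * ((t1 z)\<^sup>2 * (t2 0 * t2'' 0) - (t2 z)\<^sup>2 * (t1' 0)\<^sup>2)) (at 0)"
      unfolding ad'
      by (rule DERIV_cong[OF DERIV_cmult[OF DERIV_diff[OF DERIV_cmult[OF DERIV_mult[OF d2]] DERIV_cmult[OF DERIV_mult[OF d1]]]]])
         (simp add: t0 power2_eq_square)
  qed
  moreover have "(t1 z)\<^sup>2 * (t2 0 * t2'' 0) - (t2 z)\<^sup>2 * (t1' 0)\<^sup>2 =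
      c * (t2'' 0 / t2 0 * (t1 z)\<^sup>2 - pi\<^sup>2 * (theta3 0 \<tau>)\<^sup>2 * (theta4 0 \<tau>)\<^sup>2 * (t2 z)\<^sup>2)" (is "_ = c * ?R")
    using nz by (simp add: t0 c_def power2_eq_square field_simps)
  ultimately have "2 * (c * (t1'' z * t1 z - (t1' z)\<^sup>2)) = 2 * (c * ?R)"
    by (simp only: mult.left_commute[of c 2])
  then have "c * (t1'' z * t1 z - (t1' z)\<^sup>2) = c * ?R"
    by (subst (asm) mult_cancel_left) simp
  then show ?thesis using nz by (simp add: c_def t0 t1_def t2_def t1'_def t1''_def)
qed

text \<open>
  The second derivatives at \<open>z = 0\<close> of the quadratic relations. Through the heat equation these are the
  differences of the logarithmic \<open>\<tau>\<close>-derivatives of the theta constants; only the differences are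
  modular, which is why the value for \<open>\<vartheta>\<^sub>2\<close> remains on the right.
\<close>
lemma theta_constants_heat:
  assumes \<tau>: "Im \<tau> > 0"
  shows "stheta3 0 2 0 \<tau> / theta3 0 \<tau> = stheta2 0 2 0 \<tau> / theta2 0 \<tau> + pi\<^sup>2 * theta4 0 \<tau> ^ 4"
    "stheta4 0 2 0 \<tau> / theta4 0 \<tau> = stheta2 0 2 0 \<tau> / theta2 0 \<tau> + pi\<^sup>2 * theta3 0 \<tau> ^ 4"
proof -
  note nz = theta_constants_nonzero[OF \<tau>]
  have sq: "((\<lambda>z. (f z)\<^sup>2) has_field_derivative 2 * (f z * f' z)) (at z)"
    if "\<And>w. (f has_field_derivative f' w) (at w)" for f f' :: "complex \<Rightarrow> complex" and z
    unfolding power2_eq_square by (rule DERIV_cong[OF DERIV_mult[OF that that]]) simp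
  have sq2: "((\<lambda>z. 2 * (f z * f' z)) has_field_derivative 2 * ((f' z)\<^sup>2 + f z * f'' z)) (at z)"
    if "\<And>w. (f has_field_derivative f' w) (at w)" "\<And>w. (f' has_field_derivative f'' w) (at w)" for f f' f'' :: "complex \<Rightarrow> complex" and z
    by (rule DERIV_cong[OF DERIV_cmult[OF DERIV_mult[OF that]]]) (simp add: power2_eq_square)
  have key: "c0 * (f3 0 * f3'' 0) = c1 * (t1' 0)\<^sup>2 + c2 * (t2 0 * t2'' 0)"
    if e: "\<And>z. c0 * (f3 z)\<^sup>2 = c1 * (t1 z)\<^sup>2 + c2 * (t2 z)\<^sup>2"
     and d: "\<And>w. (f3 has_field_derivative f3' w) (at w)" "\<And>w. (f3' has_field_derivative f3'' w) (at w)"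
     "\<And>w. (t1 has_field_derivative t1' w) (at w)" "\<And>w. (t1' has_field_derivative t1'' w) (at w)"
     "\<And>w. (t2 has_field_derivative t2' w) (at w)" "\<And>w. (t2' has_field_derivative t2'' w) (at w)"
     and z: "f3' 0 = 0" "t1 0 = 0" "t2' 0 = 0"
   for c0 c1 c2 :: complex and f3 f3' f3'' t1 t1' t1'' t2 t2' t2'' :: "complex \<Rightarrow> complex"
  proof -
    have e': "c0 * (2 * (f3 z * f3' z)) = c1 * (2 * (t1 z * t1' z)) + c2 * (2 * (t2 z * t2' z))" for z
    proof (rule DERIV_unique)
      show "((\<lambda>z. c0 * (f3 z)\<^sup>2) has_field_derivative c0 * (2 * (f3 z * f3' z))) (at z)"
        by (intro DERIV_cmult sq d)
      show "((\<lambda>z. c0 * (f3 z)\<^sup>2) has_field_derivative c1 * (2 * (t1 z * t1' z)) + c2 * (2 * (t2 z * t2' z))) (at z)"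
        unfolding e by (intro DERIV_add DERIV_cmult sq d)
    qed
    have "c0 * (2 * ((f3' 0)\<^sup>2 + f3 0 * f3'' 0)) = c1 * (2 * ((t1' 0)\<^sup>2 + t1 0 * t1'' 0)) + c2 * (2 * ((t2' 0)\<^sup>2 + t2 0 * t2'' 0))"
    proof (rule DERIV_unique)
      show "((\<lambda>z. c0 * (2 * (f3 z * f3' z))) has_field_derivative c0 * (2 * ((f3' 0)\<^sup>2 + f3 0 * f3'' 0))) (at 0)"
        by (intro DERIV_cmult[of _ _ _ _ c0] sq2 d)
      show "((\<lambda>z. c0 * (2 * (f3 z * f3' z))) has_field_derivative
          c1 * (2 * ((t1' 0)\<^sup>2 + t1 0 * t1'' 0)) + c2 * (2 * ((t2' 0)\<^sup>2 + t2 0 * t2'' 0))) (at 0)"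
        unfolding e' by (intro DERIV_add DERIV_cmult[of _ _ _ _ c1] DERIV_cmult[of _ _ _ _ c2] sq2 d)
    qed
    then have "2 * (c0 * (f3 0 * f3'' 0)) = 2 * (c1 * (t1' 0)\<^sup>2 + c2 * (t2 0 * t2'' 0))"
      unfolding z by (simp add: algebra_simps)
    then show ?thesis by (subst (asm) mult_cancel_left) simp
  qed
  note d0 = stheta_deriv_z[OF \<tau>, of 0 0, unfolded stheta_0 One_nat_def[symmetric]]
  have d1: "((\<lambda>z. stheta1 0 1 z \<tau>) has_field_derivative stheta1 0 2 z \<tau>) (at z)"
    "((\<lambda>z. stheta2 0 1 z \<tau>) has_field_derivative stheta2 0 2 z \<tau>) (at z)"
    "((\<lambda>z. stheta3 0 1 z \<tau>) has_field_derivative stheta3 0 2 z \<tau>) (at z)"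
    "((\<lambda>z. stheta4 0 1 z \<tau>) has_field_derivative stheta4 0 2 z \<tau>) (at z)" for z
    using stheta_deriv_z[OF \<tau>, of 0 1 z] by (simp_all add: numeral_2_eq_2)
  note z = theta_deriv_0[OF \<tau>] theta1_0
  have div: "X / a3 = Y / a2 + p\<^sup>2 * a4 ^ 4"
    if h: "a2\<^sup>2 * (a3 * X) = a4\<^sup>2 * (p * a2 * a3 * a4)\<^sup>2 + a3\<^sup>2 * (a2 * Y)" and nz: "a2 \<noteq> 0" "a3 \<noteq> 0"
    for X Y a2 a3 a4 p :: complex
  proof -
    have "X / a3 = (a2\<^sup>2 * (a3 * X)) / (a2\<^sup>2 * a3\<^sup>2)" using nz by (simp add: power2_eq_square)
    also have "\<dots> = Y / a2 + p\<^sup>2 * a4 ^ 4"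
      unfolding h using nz by (simp add: field_simps power2_eq_square power4_eq_xxxx)
    finally show ?thesis .
  qed
  have "(theta2 0 \<tau>)\<^sup>2 * (theta3 0 \<tau> * stheta3 0 2 0 \<tau>) =
      (theta4 0 \<tau>)\<^sup>2 * (stheta1 0 1 0 \<tau>)\<^sup>2 + (theta3 0 \<tau>)\<^sup>2 * (theta2 0 \<tau> * stheta2 0 2 0 \<tau>)"
    by (rule key[OF theta_squares(1)[OF \<tau>] d0(3) d1(3) d0(1) d1(1) d0(2) d1(2) z(2) z(4) z(1)])
  then show "stheta3 0 2 0 \<tau> / theta3 0 \<tau> = stheta2 0 2 0 \<tau> / theta2 0 \<tau> + pi\<^sup>2 * theta4 0 \<tau> ^ 4"
    unfolding jacobi_derivative_formula[OF \<tau>] of_real_power by (rule div) (use nz in auto)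
  have "(theta2 0 \<tau>)\<^sup>2 * (theta4 0 \<tau> * stheta4 0 2 0 \<tau>) =
      (theta3 0 \<tau>)\<^sup>2 * (stheta1 0 1 0 \<tau>)\<^sup>2 + (theta4 0 \<tau>)\<^sup>2 * (theta2 0 \<tau> * stheta2 0 2 0 \<tau>)"
    by (rule key[OF theta_squares(2)[OF \<tau>] d0(4) d1(4) d0(1) d1(1) d0(2) d1(2) z(3) z(4) z(1)])
  then show "stheta4 0 2 0 \<tau> / theta4 0 \<tau> = stheta2 0 2 0 \<tau> / theta2 0 \<tau> + pi\<^sup>2 * theta3 0 \<tau> ^ 4"
    unfolding jacobi_derivative_formula[OF \<tau>] of_real_power
    by - (rule div, simp add: mult_ac, use nz in auto)
qed

lemma stheta_derivatives:
  assumes \<tau>: "Im \<tau> > 0"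
  defines "w \<equiv> \<lambda>A z. z + complex_of_real A * \<tau>"
  shows "stheta1 A 1 z \<tau> = shift_factor A z \<tau> * (stheta1 0 1 (w A z) \<tau> + 2 * pi * \<i> * of_real A * theta1 (w A z) \<tau>)"
    "stheta2 A 1 z \<tau> = shift_factor A z \<tau> * (stheta2 0 1 (w A z) \<tau> + 2 * pi * \<i> * of_real A * theta2 (w A z) \<tau>)"
    "stheta1 A 2 z \<tau> = shift_factor A z \<tau> * (stheta1 0 2 (w A z) \<tau> + 2 * (2 * pi * \<i> * of_real A) * stheta1 0 1 (w A z) \<tau>
        + (2 * pi * \<i> * of_real A)\<^sup>2 * theta1 (w A z) \<tau>)"
proof -
  define c where "c = 2 * pi * \<i> * of_real A"
  have e: "((\<lambda>z. shift_factor A z \<tau>) has_field_derivative shift_factor A z \<tau> * c) (at z)" for z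
    unfolding shift_factor_def c_def by (rule derivative_eq_intros refl)+ simp
  have sh: "((\<lambda>z. f (w A z)) has_field_derivative f' (w A z)) (at z)"
    if "\<And>u. (f has_field_derivative f' u) (at u)" for f f' :: "complex \<Rightarrow> complex" and z
  proof -
    have "((\<lambda>z. f (w A z)) has_field_derivative f' (w A z) * 1) (at z)"
      unfolding w_def by (rule DERIV_chain2[OF that]) (auto intro!: derivative_eq_intros)
    then show ?thesis by simp
  qed
  have ex: "((\<lambda>z. shift_factor A z \<tau> * f (w A z)) has_field_derivative shift_factor A z \<tau> * (f' (w A z) + c * f (w A z))) (at z)"
    if "\<And>u. (f has_field_derivative f' u) (at u)" for f f' :: "complex \<Rightarrow> complex" and z
    by (rule DERIV_cong[OF DERIV_mult[OF e sh[OF that]]]) (simp add: algebra_simps)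
  note d0 = stheta_deriv_z[OF \<tau>, of 0 0, unfolded stheta_0 One_nat_def[symmetric]]
  have eq: "stheta1 A 0 z \<tau> = shift_factor A z \<tau> * theta1 (w A z) \<tau>" "stheta2 A 0 z \<tau> = shift_factor A z \<tau> * theta2 (w A z) \<tau>" for z
    by (simp_all add: stheta_eq w_def)
  have 1: "stheta1 A 1 z \<tau> = shift_factor A z \<tau> * (stheta1 0 1 (w A z) \<tau> + c * theta1 (w A z) \<tau>)" for z
    using DERIV_unique[OF stheta_deriv_z(1)[OF \<tau>, of A 0 z, unfolded eq] ex[OF d0(1)]] by simp
  then show "stheta1 A 1 z \<tau> = shift_factor A z \<tau> * (stheta1 0 1 (w A z) \<tau> + 2 * pi * \<i> * of_real A * theta1 (w A z) \<tau>)"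
    by (simp add: c_def)
  show "stheta2 A 1 z \<tau> = shift_factor A z \<tau> * (stheta2 0 1 (w A z) \<tau> + 2 * pi * \<i> * of_real A * theta2 (w A z) \<tau>)"
    using DERIV_unique[OF stheta_deriv_z(2)[OF \<tau>, of A 0 z, unfolded eq] ex[OF d0(2)]] by (simp add: c_def)
  have d: "((\<lambda>u. stheta1 0 1 u \<tau> + c * theta1 u \<tau>) has_field_derivative stheta1 0 2 u \<tau> + c * stheta1 0 1 u \<tau>) (at u)" for u
    using DERIV_add[OF stheta_deriv_z(1)[OF \<tau>, of 0 1 u] DERIV_cmult[OF d0(1)[of u], of c]] by (simp add: numeral_2_eq_2)
  have "stheta1 A 2 z \<tau> = shift_factor A z \<tau> * ((stheta1 0 2 (w A z) \<tau> + c * stheta1 0 1 (w A z) \<tau>) + c * (stheta1 0 1 (w A z) \<tau> + c * theta1 (w A z) \<tau>))"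
    using DERIV_unique[OF stheta_deriv_z(1)[OF \<tau>, of A 1 z, unfolded 1] ex[OF d, of z]] by (simp add: numeral_2_eq_2)
  then show "stheta1 A 2 z \<tau> = shift_factor A z \<tau> * (stheta1 0 2 (w A z) \<tau> + 2 * (2 * pi * \<i> * of_real A) * stheta1 0 1 (w A z) \<tau>
        + (2 * pi * \<i> * of_real A)\<^sup>2 * theta1 (w A z) \<tau>)"
    unfolding c_def[symmetric] by (simp add: power2_eq_square algebra_simps)
qed

text \<open>
  The identities are homogeneous of degree two, and the common factor contributes the same constant
  \<open>2 \<pi> \<i> A\<close> to every logarithmic derivative, which cancels in Wronskians and in second logarithmic
  derivatives. So the relations for \<open>\<theta>\<^sub>k\<close> hold unchanged for the shifted functions.
\<close>
lemma stheta_relations: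
  assumes \<tau>: "Im \<tau> > 0"
  shows "(theta2 0 \<tau>)\<^sup>2 * (stheta3 A 0 z \<tau>)\<^sup>2 = (theta4 0 \<tau>)\<^sup>2 * (stheta1 A 0 z \<tau>)\<^sup>2 + (theta3 0 \<tau>)\<^sup>2 * (stheta2 A 0 z \<tau>)\<^sup>2" (is ?S3)
    "(theta2 0 \<tau>)\<^sup>2 * (stheta4 A 0 z \<tau>)\<^sup>2 = (theta3 0 \<tau>)\<^sup>2 * (stheta1 A 0 z \<tau>)\<^sup>2 + (theta4 0 \<tau>)\<^sup>2 * (stheta2 A 0 z \<tau>)\<^sup>2" (is ?S4)
    "stheta1 A 1 z \<tau> * stheta2 A 0 z \<tau> - stheta1 A 0 z \<tau> * stheta2 A 1 z \<tau> = pi * (theta2 0 \<tau>)\<^sup>2 * (stheta3 A 0 z \<tau> * stheta4 A 0 z \<tau>)" (is ?W)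
    "stheta1 A 2 z \<tau> * stheta1 A 0 z \<tau> - (stheta1 A 1 z \<tau>)\<^sup>2 =
     stheta2 0 2 0 \<tau> / theta2 0 \<tau> * (stheta1 A 0 z \<tau>)\<^sup>2 - pi\<^sup>2 * (theta3 0 \<tau>)\<^sup>2 * (theta4 0 \<tau>)\<^sup>2 * (stheta2 A 0 z \<tau>)\<^sup>2" (is ?H)
proof -
  define w where "w = z + of_real A * \<tau>"
  define E where "E = shift_factor A z \<tau>"
  define c where "c = 2 * pi * \<i> * of_real A"
  have eq: "stheta1 A 0 z \<tau> = E * theta1 w \<tau>" "stheta2 A 0 z \<tau> = E * theta2 w \<tau>"
     "stheta3 A 0 z \<tau> = E * theta3 w \<tau>" "stheta4 A 0 z \<tau> = E * theta4 w \<tau>"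
     "stheta1 A 1 z \<tau> = E * (stheta1 0 1 w \<tau> + c * theta1 w \<tau>)"
     "stheta2 A 1 z \<tau> = E * (stheta2 0 1 w \<tau> + c * theta2 w \<tau>)"
     "stheta1 A 2 z \<tau> = E * (stheta1 0 2 w \<tau> + 2 * c * stheta1 0 1 w \<tau> + c\<^sup>2 * theta1 w \<tau>)"
    unfolding E_def w_def c_def by (rule stheta_eq stheta_derivatives[OF \<tau>])+
  have "(theta2 0 \<tau>)\<^sup>2 * (stheta3 A 0 z \<tau>)\<^sup>2 = E\<^sup>2 * ((theta2 0 \<tau>)\<^sup>2 * (theta3 w \<tau>)\<^sup>2)"
    unfolding eq by (simp add: power_mult_distrib)
  then show ?S3 unfolding theta_squares(1)[OF \<tau>] eq by (simp add: power_mult_distrib algebra_simps)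
  have "(theta2 0 \<tau>)\<^sup>2 * (stheta4 A 0 z \<tau>)\<^sup>2 = E\<^sup>2 * ((theta2 0 \<tau>)\<^sup>2 * (theta4 w \<tau>)\<^sup>2)"
    unfolding eq by (simp add: power_mult_distrib)
  then show ?S4 unfolding theta_squares(2)[OF \<tau>] eq by (simp add: power_mult_distrib algebra_simps)
  have "stheta1 A 1 z \<tau> * stheta2 A 0 z \<tau> - stheta1 A 0 z \<tau> * stheta2 A 1 z \<tau> = E\<^sup>2 * (stheta1 0 1 w \<tau> * theta2 w \<tau> - theta1 w \<tau> * stheta2 0 1 w \<tau>)"
    unfolding eq by (simp add: power2_eq_square algebra_simps)
  then show ?W unfolding theta_wronskian[OF \<tau>] eq by (simp add: power2_eq_square algebra_simps)
  have "stheta1 A 2 z \<tau> * stheta1 A 0 z \<tau> - (stheta1 A 1 z \<tau>)\<^sup>2 = E\<^sup>2 * (stheta1 0 2 w \<tau> * theta1 w \<tau> - (stheta1 0 1 w \<tau>)\<^sup>2)"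
    unfolding eq by (simp add: power2_eq_square algebra_simps)
  then show ?H unfolding theta1_hirota[OF \<tau>] eq by (simp add: power_mult_distrib algebra_simps)
qed

lemma stheta_relations_deriv:
  assumes \<tau>: "Im \<tau> > 0"
  shows "(theta2 0 \<tau>)\<^sup>2 * (stheta3 A 0 z \<tau> * stheta3 A 1 z \<tau>) = (theta4 0 \<tau>)\<^sup>2 * (stheta1 A 0 z \<tau> * stheta1 A 1 z \<tau>) + (theta3 0 \<tau>)\<^sup>2 * (stheta2 A 0 z \<tau> * stheta2 A 1 z \<tau>)"
    "(theta2 0 \<tau>)\<^sup>2 * (stheta4 A 0 z \<tau> * stheta4 A 1 z \<tau>) = (theta3 0 \<tau>)\<^sup>2 * (stheta1 A 0 z \<tau> * stheta1 A 1 z \<tau>) + (theta4 0 \<tau>)\<^sup>2 * (stheta2 A 0 z \<tau> * stheta2 A 1 z \<tau>)"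
    "stheta1 A 2 z \<tau> * stheta2 A 0 z \<tau> - stheta1 A 0 z \<tau> * stheta2 A 2 z \<tau> = pi * (theta2 0 \<tau>)\<^sup>2 * (stheta3 A 1 z \<tau> * stheta4 A 0 z \<tau> + stheta3 A 0 z \<tau> * stheta4 A 1 z \<tau>)"
    "stheta1 A 3 z \<tau> * stheta1 A 0 z \<tau> - stheta1 A 1 z \<tau> * stheta1 A 2 z \<tau> =
     2 * (stheta2 0 2 0 \<tau> / theta2 0 \<tau> * (stheta1 A 0 z \<tau> * stheta1 A 1 z \<tau>) - pi\<^sup>2 * (theta3 0 \<tau>)\<^sup>2 * (theta4 0 \<tau>)\<^sup>2 * (stheta2 A 0 z \<tau> * stheta2 A 1 z \<tau>))"
proof -
  have d1: "((\<lambda>z. stheta1 A 0 z \<tau>) has_field_derivative stheta1 A 1 z \<tau>) (at z)"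
     "((\<lambda>z. stheta1 A 1 z \<tau>) has_field_derivative stheta1 A 2 z \<tau>) (at z)"
     "((\<lambda>z. stheta1 A 2 z \<tau>) has_field_derivative stheta1 A 3 z \<tau>) (at z)"
     "((\<lambda>z. stheta2 A 0 z \<tau>) has_field_derivative stheta2 A 1 z \<tau>) (at z)"
     "((\<lambda>z. stheta2 A 1 z \<tau>) has_field_derivative stheta2 A 2 z \<tau>) (at z)"
     "((\<lambda>z. stheta3 A 0 z \<tau>) has_field_derivative stheta3 A 1 z \<tau>) (at z)"
     "((\<lambda>z. stheta4 A 0 z \<tau>) has_field_derivative stheta4 A 1 z \<tau>) (at z)" for z
    using stheta_deriv_z[OF \<tau>, of A 0 z] stheta_deriv_z[OF \<tau>, of A 1 z] stheta_deriv_z[OF \<tau>, of A 2 z]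
    by (simp_all add: numeral_2_eq_2 numeral_3_eq_3)
  have sq: "((\<lambda>z. (f z)\<^sup>2) has_field_derivative 2 * (f z * f' z)) (at z)"
    if "\<And>w. (f has_field_derivative f' w) (at w)" for f f' :: "complex \<Rightarrow> complex" and z
    unfolding power2_eq_square by (rule DERIV_cong[OF DERIV_mult[OF that that]]) simp
  have key: "c0 * (f3 z * f3' z) = c1 * (f1 z * f1' z) + c2 * (f2 z * f2' z)"
    if e: "\<And>z. c0 * (f3 z)\<^sup>2 = c1 * (f1 z)\<^sup>2 + c2 * (f2 z)\<^sup>2"
     and d: "\<And>w. (f3 has_field_derivative f3' w) (at w)" "\<And>w. (f1 has_field_derivative f1' w) (at w)"
       "\<And>w. (f2 has_field_derivative f2' w) (at w)"
     for c0 c1 c2 :: complex and f1 f2 f3 f1' f2' f3' :: "complex \<Rightarrow> complex"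
  proof -
    have "c0 * (2 * (f3 z * f3' z)) = c1 * (2 * (f1 z * f1' z)) + c2 * (2 * (f2 z * f2' z))"
    proof (rule DERIV_unique)
      show "((\<lambda>z. c0 * (f3 z)\<^sup>2) has_field_derivative c0 * (2 * (f3 z * f3' z))) (at z)"
        by (intro DERIV_cmult sq d)
      show "((\<lambda>z. c0 * (f3 z)\<^sup>2) has_field_derivative c1 * (2 * (f1 z * f1' z)) + c2 * (2 * (f2 z * f2' z))) (at z)"
        unfolding e by (intro DERIV_add DERIV_cmult sq d)
    qed
    then have "2 * (c0 * (f3 z * f3' z)) = 2 * (c1 * (f1 z * f1' z) + c2 * (f2 z * f2' z))"
      by (simp add: algebra_simps)
    then show ?thesis by (subst (asm) mult_cancel_left) simp
  qed
  show "(theta2 0 \<tau>)\<^sup>2 * (stheta3 A 0 z \<tau> * stheta3 A 1 z \<tau>) = (theta4 0 \<tau>)\<^sup>2 * (stheta1 A 0 z \<tau> * stheta1 A 1 z \<tau>) + (theta3 0 \<tau>)\<^sup>2 * (stheta2 A 0 z \<tau> * stheta2 A 1 z \<tau>)"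
    by (rule key[OF stheta_relations(1)[OF \<tau>] d1(6) d1(1) d1(4)])
  show "(theta2 0 \<tau>)\<^sup>2 * (stheta4 A 0 z \<tau> * stheta4 A 1 z \<tau>) = (theta3 0 \<tau>)\<^sup>2 * (stheta1 A 0 z \<tau> * stheta1 A 1 z \<tau>) + (theta4 0 \<tau>)\<^sup>2 * (stheta2 A 0 z \<tau> * stheta2 A 1 z \<tau>)"
    by (rule key[OF stheta_relations(2)[OF \<tau>] d1(7) d1(1) d1(4)])
  show "stheta1 A 2 z \<tau> * stheta2 A 0 z \<tau> - stheta1 A 0 z \<tau> * stheta2 A 2 z \<tau> = pi * (theta2 0 \<tau>)\<^sup>2 * (stheta3 A 1 z \<tau> * stheta4 A 0 z \<tau> + stheta3 A 0 z \<tau> * stheta4 A 1 z \<tau>)"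
  proof (rule DERIV_unique)
    show "((\<lambda>z. stheta1 A 1 z \<tau> * stheta2 A 0 z \<tau> - stheta1 A 0 z \<tau> * stheta2 A 1 z \<tau>) has_field_derivative
        stheta1 A 2 z \<tau> * stheta2 A 0 z \<tau> - stheta1 A 0 z \<tau> * stheta2 A 2 z \<tau>) (at z)"
      by (rule DERIV_cong[OF DERIV_diff[OF DERIV_mult[OF d1(2) d1(4)] DERIV_mult[OF d1(1) d1(5)]]]) (simp add: algebra_simps)
    show "((\<lambda>z. stheta1 A 1 z \<tau> * stheta2 A 0 z \<tau> - stheta1 A 0 z \<tau> * stheta2 A 1 z \<tau>) has_field_derivative
        pi * (theta2 0 \<tau>)\<^sup>2 * (stheta3 A 1 z \<tau> * stheta4 A 0 z \<tau> + stheta3 A 0 z \<tau> * stheta4 A 1 z \<tau>)) (at z)"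
      unfolding stheta_relations(3)[OF \<tau>]
      by (rule DERIV_cong[OF DERIV_cmult[OF DERIV_mult[OF d1(6) d1(7)]]]) (simp add: algebra_simps)
  qed
  show "stheta1 A 3 z \<tau> * stheta1 A 0 z \<tau> - stheta1 A 1 z \<tau> * stheta1 A 2 z \<tau> =
     2 * (stheta2 0 2 0 \<tau> / theta2 0 \<tau> * (stheta1 A 0 z \<tau> * stheta1 A 1 z \<tau>) - pi\<^sup>2 * (theta3 0 \<tau>)\<^sup>2 * (theta4 0 \<tau>)\<^sup>2 * (stheta2 A 0 z \<tau> * stheta2 A 1 z \<tau>))"
  proof (rule DERIV_unique)
    show "((\<lambda>z. stheta1 A 2 z \<tau> * stheta1 A 0 z \<tau> - (stheta1 A 1 z \<tau>)\<^sup>2) has_field_derivative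
        stheta1 A 3 z \<tau> * stheta1 A 0 z \<tau> - stheta1 A 1 z \<tau> * stheta1 A 2 z \<tau>) (at z)"
      by (rule DERIV_cong[OF DERIV_diff[OF DERIV_mult[OF d1(3) d1(1)] sq[OF d1(2)]]]) (simp add: algebra_simps)
    show "((\<lambda>z. stheta1 A 2 z \<tau> * stheta1 A 0 z \<tau> - (stheta1 A 1 z \<tau>)\<^sup>2) has_field_derivative
        2 * (stheta2 0 2 0 \<tau> / theta2 0 \<tau> * (stheta1 A 0 z \<tau> * stheta1 A 1 z \<tau>) - pi\<^sup>2 * (theta3 0 \<tau>)\<^sup>2 * (theta4 0 \<tau>)\<^sup>2 * (stheta2 A 0 z \<tau> * stheta2 A 1 z \<tau>))) (at z)"
      unfolding stheta_relations(4)[OF \<tau>]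
      by (rule DERIV_cong[OF DERIV_diff[OF DERIV_cmult[OF sq[OF d1(1)]] DERIV_cmult[OF sq[OF d1(4)]]]]) (simp add: algebra_simps)
  qed
qed

section \<open>The flow of the torsion section\<close>

text \<open>
  The line \<open>z = A \<tau> + B\<close> in the universal elliptic curve. The assumption says that it meets no
  half-period, so by the duplication formula none of the \<open>\<theta>\<^sub>k\<close> vanishes along it.
\<close>
locale shifted_point =
  fixes A B :: real
  assumes nondegenerate: "Im \<tau> > 0 \<Longrightarrow> theta1 (2 * (of_real B + of_real A * \<tau>)) \<tau> \<noteq> 0"
begin

definition f1 where "f1 n \<tau> = stheta1 A n (of_real B) \<tau>"
definition f2 where "f2 n \<tau> = stheta2 A n (of_real B) \<tau>"
definition f3 where "f3 n \<tau> = stheta3 A n (of_real B) \<tau>"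
definition f4 where "f4 n \<tau> = stheta4 A n (of_real B) \<tau>"

text \<open>
  Coordinates of weight zero. The function \<open>Z\<close> is the logarithmic derivative of the shifted \<open>\<theta>\<^sub>1\<close>, made
  modular of weight zero by \<open>\<pi> \<vartheta>\<^sub>3\<^sup>2\<close>; it is \<open>\<theta>\<^sub>1' / \<theta>\<^sub>1 + 2 \<pi> \<i> A\<close> up to this factor. The function \<open>v\<close>
  is the second coordinate on the curve \<open>v\<^sup>2 = s (t + s) (1 + t s)\<close>, and \<open>\<kappa>\<close> is the common factor of
  all \<open>\<tau>\<close>-derivatives.
\<close>
definition t where "t \<tau> = (theta4 0 \<tau>)\<^sup>2 / (theta3 0 \<tau>)\<^sup>2"
definition s where "s \<tau> = (f2 0 \<tau> / f1 0 \<tau>)\<^sup>2"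
definition v where "v \<tau> = (theta2 0 \<tau>)\<^sup>2 / (theta3 0 \<tau>)\<^sup>2 * (f2 0 \<tau> * f3 0 \<tau> * f4 0 \<tau> / f1 0 \<tau> ^ 3)"
definition Z where "Z \<tau> = f1 1 \<tau> / (pi * (theta3 0 \<tau>)\<^sup>2 * f1 0 \<tau>)"
definition \<kappa> where "\<kappa> \<tau> = pi\<^sup>2 * theta3 0 \<tau> ^ 4 / (4 * pi * \<i>)"

lemma f_nonzero:
  assumes \<tau>: "Im \<tau> > 0"
  shows "f1 0 \<tau> \<noteq> 0" "f2 0 \<tau> \<noteq> 0" "f3 0 \<tau> \<noteq> 0" "f4 0 \<tau> \<noteq> 0"
  using theta1_duplication[OF \<tau>, of "of_real B + of_real A * \<tau>"] nondegenerate[OF \<tau>] theta_constants_nonzero[OF \<tau>]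
  by (auto simp: f1_def f2_def f3_def f4_def stheta_eq shift_factor_def)

lemma f_deriv:
  assumes \<tau>: "Im \<tau> > 0"
  shows "(f1 n has_field_derivative f1 (n + 2) \<tau> / (4 * pi * \<i>)) (at \<tau>)"
    "(f2 n has_field_derivative f2 (n + 2) \<tau> / (4 * pi * \<i>)) (at \<tau>)"
    "(f3 n has_field_derivative f3 (n + 2) \<tau> / (4 * pi * \<i>)) (at \<tau>)"
    "(f4 n has_field_derivative f4 (n + 2) \<tau> / (4 * pi * \<i>)) (at \<tau>)"
  using stheta_deriv_tau[OF \<tau>, of A n "of_real B"] by (simp_all add: f1_def[abs_def] f2_def[abs_def] f3_def[abs_def] f4_def[abs_def])

lemma const_deriv:
  assumes \<tau>: "Im \<tau> > 0"
  shows "(theta3 0 has_field_derivative stheta3 0 2 0 \<tau> / (4 * pi * \<i>)) (at \<tau>)"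
    "(theta4 0 has_field_derivative stheta4 0 2 0 \<tau> / (4 * pi * \<i>)) (at \<tau>)"
  using stheta_deriv_tau(3,4)[OF \<tau>, of 0 0 0] by (simp_all add: stheta_0 numeral_2_eq_2)

lemma t_nonzero: assumes \<tau>: "Im \<tau> > 0" shows "t \<tau> \<noteq> 0" "(t \<tau>)\<^sup>2 \<noteq> 1"
proof -
  note nz = theta_constants_nonzero[OF \<tau>]
  show "t \<tau> \<noteq> 0" using nz by (simp add: t_def)
  have "1 - (t \<tau>)\<^sup>2 = theta2 0 \<tau> ^ 4 / theta3 0 \<tau> ^ 4"
  proof -
    have "1 - (t \<tau>)\<^sup>2 = (theta3 0 \<tau> ^ 4 - theta4 0 \<tau> ^ 4) / theta3 0 \<tau> ^ 4"
      using nz by (simp add: t_def diff_divide_distrib power_divide)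
    then show ?thesis by (simp add: jacobi_quartic[OF \<tau>])
  qed
  then show "(t \<tau>)\<^sup>2 \<noteq> 1" using nz by auto
qed

lemma t_deriv:
  assumes \<tau>: "Im \<tau> > 0"
  shows "(t has_field_derivative \<kappa> \<tau> * (2 * t \<tau> * (1 - (t \<tau>)\<^sup>2))) (at \<tau>)"
proof -
  note nz = theta_constants_nonzero[OF \<tau>]
  define l where "l = stheta2 0 2 0 \<tau> / theta2 0 \<tau>"
  have h: "stheta3 0 2 0 \<tau> = (l + pi\<^sup>2 * theta4 0 \<tau> ^ 4) * theta3 0 \<tau>" "stheta4 0 2 0 \<tau> = (l + pi\<^sup>2 * theta3 0 \<tau> ^ 4) * theta4 0 \<tau>"
    using theta_constants_heat[OF \<tau>] nz unfolding l_def[symmetric] by (simp_all add: nonzero_divide_eq_eq)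
  have sq: "((\<lambda>z. (g z)\<^sup>2) has_field_derivative 2 * (g \<tau> * D)) (at \<tau>)"
    if "(g has_field_derivative D) (at \<tau>)" for g :: "complex \<Rightarrow> complex" and D
    unfolding power2_eq_square by (rule DERIV_cong[OF DERIV_mult[OF that that]]) simp
  show ?thesis unfolding t_def[abs_def] \<kappa>_def
    apply (rule DERIV_cong[OF DERIV_divide[OF sq[OF const_deriv(2)[OF \<tau>]] sq[OF const_deriv(1)[OF \<tau>]]]])
    subgoal using nz by simp
    subgoal unfolding h using nz by (simp add: field_simps power2_eq_square power4_eq_xxxx)
    done
qed

text \<open>
  With \<open>r = \<theta>\<^sub>2 / \<theta>\<^sub>1\<close> the heat equation turns \<open>4 \<pi> \<i> dr/d\<tau>\<close> into the \<open>z\<close>-derivative of the Wronskian of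
  \<open>\<theta>\<^sub>1\<close> and \<open>\<theta>\<^sub>2\<close>, up to \<open>\<theta>\<^sub>1\<^sup>2\<close>. That Wronskian is \<open>\<pi> \<vartheta>\<^sub>2\<^sup>2 \<theta>\<^sub>3 \<theta>\<^sub>4\<close>, and the derivatives of \<open>\<theta>\<^sub>3\<close> and
  \<open>\<theta>\<^sub>4\<close> follow from those of \<open>\<theta>\<^sub>1\<close> by the differentiated quadratic relations.
\<close>
lemma s_deriv:
  assumes \<tau>: "Im \<tau> > 0"
  shows "(s has_field_derivative \<kappa> \<tau> * (- 4 * Z \<tau> * v \<tau> + 2 * s \<tau> * (1 + 2 * t \<tau> * s \<tau> + (t \<tau>)\<^sup>2))) (at \<tau>)"
proof -
  note nz = theta_constants_nonzero[OF \<tau>] f_nonzero[OF \<tau>]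
  note r = stheta_relations[OF \<tau>, of A "of_real B", folded f1_def f2_def f3_def f4_def]
  note r' = stheta_relations_deriv[OF \<tau>, of A "of_real B", folded f1_def f2_def f3_def f4_def]
  define c2 c3 c4 where "c2 = (theta2 0 \<tau>)\<^sup>2" "c3 = (theta3 0 \<tau>)\<^sup>2" "c4 = (theta4 0 \<tau>)\<^sup>2"
  note c = this(1)[symmetric] this(2)[symmetric] this(3)[symmetric]
  have cnz: "c2 \<noteq> 0" "c3 \<noteq> 0" "c4 \<noteq> 0" using nz by (simp_all add: c[symmetric])
  define a1 a2 a3 a4 where "a1 = f1 0 \<tau>" "a2 = f2 0 \<tau>" "a3 = f3 0 \<tau>" "a4 = f4 0 \<tau>"
  note a = this[symmetric]
  define b1 b2 b3 b4 where "b1 = f1 1 \<tau>" "b2 = f2 1 \<tau>" "b3 = f3 1 \<tau>" "b4 = f4 1 \<tau>"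
  note b = this[symmetric]
  have W: "b1 * a2 - a1 * b2 = pi * c2 * (a3 * a4)" using r(3) unfolding a b c .
  have e: "c2 * (c3 * a4\<^sup>2 + c4 * a3\<^sup>2) = (c3\<^sup>2 + c4\<^sup>2) * a1\<^sup>2 + 2 * c3 * c4 * a2\<^sup>2"
    using r(1,2)[unfolded a b c] by algebra
  have q: "c2 * (a3 * b3) = c4 * (a1 * b1) + c3 * (a2 * b2)" "c2 * (a4 * b4) = c3 * (a1 * b1) + c4 * (a2 * b2)"
    "c2 * a3\<^sup>2 = c4 * a1\<^sup>2 + c3 * a2\<^sup>2" "c2 * a4\<^sup>2 = c3 * a1\<^sup>2 + c4 * a2\<^sup>2"
    using r(1,2) r'(1,2) unfolding a b c by simp_all
  have nz': "a1 \<noteq> 0" "a2 \<noteq> 0" "a3 \<noteq> 0" "a4 \<noteq> 0" using nz by (simp_all add: a)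
  \<comment> \<open>The Wronskians of \<open>\<theta>\<^sub>1\<close> with \<open>\<theta>\<^sub>3\<close> and \<open>\<theta>\<^sub>4\<close>.\<close>
  have b3: "a1 * b3 = b1 * a3 - pi * c3 * (a2 * a4)"
  proof -
    have "(c2 * a3) * (a1 * b3) = (c2 * a3) * (b1 * a3 - pi * c3 * (a2 * a4))"
      using q(1,3) W by algebra
    then show ?thesis using cnz nz' by (subst (asm) mult_cancel_left) auto
  qed
  have b4: "a1 * b4 = b1 * a4 - pi * c4 * (a2 * a3)"
  proof -
    have "(c2 * a4) * (a1 * b4) = (c2 * a4) * (b1 * a4 - pi * c4 * (a2 * a3))"
      using q(2,4) W by algebra
    then show ?thesis using cnz nz' by (subst (asm) mult_cancel_left) auto
  qed
  have W2: "a1 * (f2 2 \<tau> * a1 - a2 * f1 2 \<tau>) = - pi * c2 * (2 * b1 * a3 * a4 - pi * a2 * (c3 * a4\<^sup>2 + c4 * a3\<^sup>2))"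
  proof -
    have "f1 2 \<tau> * a2 - a1 * f2 2 \<tau> = pi * c2 * (b3 * a4 + a3 * b4)"
      using r'(3) unfolding a b c .
    then have "a1 * (f2 2 \<tau> * a1 - a2 * f1 2 \<tau>) = - a1 * (pi * c2 * (b3 * a4 + a3 * b4))"
      by (simp add: algebra_simps)
    also have "\<dots> = - pi * c2 * ((a1 * b3) * a4 + a3 * (a1 * b4))" by (simp add: algebra_simps)
    finally show ?thesis unfolding b3 b4 by (simp add: algebra_simps power2_eq_square)
  qed
  have W3: "a1 * (f2 2 \<tau> * a1 - a2 * f1 2 \<tau>) = - 2 * pi * c2 * b1 * a3 * a4 + pi\<^sup>2 * a2 * ((c3\<^sup>2 + c4\<^sup>2) * a1\<^sup>2 + 2 * c3 * c4 * a2\<^sup>2)"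
    unfolding W2 e[symmetric] by (simp add: algebra_simps power2_eq_square)
  define K where "K = 4 * pi * \<i>"
  have K: "K \<noteq> 0" by (simp add: K_def)
  have X: "((\<lambda>x. f2 0 x / f1 0 x) has_field_derivative (f2 2 \<tau> * a1 - a2 * f1 2 \<tau>) / (K * a1\<^sup>2)) (at \<tau>)"
    unfolding K_def a
    by (rule DERIV_cong[OF DERIV_divide[OF f_deriv(2)[OF \<tau>, of 0] f_deriv(1)[OF \<tau>, of 0] nz(4)]])
       (use nz' in \<open>simp add: a numeral_2_eq_2 field_simps\<close>)
  have t4: "theta3 0 \<tau> ^ 4 = c3\<^sup>2" by (simp add: c[symmetric])
  have "(s has_field_derivative 2 * (a2 / a1 * ((f2 2 \<tau> * a1 - a2 * f1 2 \<tau>) / (K * a1\<^sup>2)))) (at \<tau>)"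
    unfolding s_def[abs_def] power2_eq_square[of "_ / _"]
    by (rule DERIV_cong[OF DERIV_mult[OF X X]]) (simp add: a)
  also have "2 * (a2 / a1 * ((f2 2 \<tau> * a1 - a2 * f1 2 \<tau>) / (K * a1\<^sup>2))) =
     2 / (K * a1 ^ 4) * (a2 * (a1 * (f2 2 \<tau> * a1 - a2 * f1 2 \<tau>)))"
    using nz' K by (simp add: divide_simps power2_eq_square power4_eq_xxxx)
  also have "a2 * (a1 * (f2 2 \<tau> * a1 - a2 * f1 2 \<tau>)) =
      of_real (pi\<^sup>2) * c3\<^sup>2 * a1 ^ 4 * (- 2 * Z \<tau> * v \<tau> + s \<tau> * (1 + 2 * t \<tau> * s \<tau> + (t \<tau>)\<^sup>2))"
  proof -
    have sub: "b1 = Z \<tau> * (pi * c3 * a1)" "c2 * (a2 * a3 * a4) = v \<tau> * (c3 * a1 ^ 3)" "a2\<^sup>2 = s \<tau> * a1\<^sup>2" "c4 = t \<tau> * c3"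
    unfolding Z_def v_def s_def t_def a b c using cnz nz' by (simp_all add: power_divide)
    have "a2 * (a1 * (f2 2 \<tau> * a1 - a2 * f1 2 \<tau>)) =
       - 2 * of_real pi * b1 * (c2 * (a2 * a3 * a4)) + of_real (pi\<^sup>2) * a2\<^sup>2 * ((c3\<^sup>2 + c4\<^sup>2) * a1\<^sup>2 + 2 * c3 * c4 * a2\<^sup>2)"
      unfolding W3 by (simp add: algebra_simps power2_eq_square)
    then show ?thesis unfolding sub by (simp add: algebra_simps power2_eq_square power3_eq_cube power4_eq_xxxx)
  qed
  also have "2 / (K * a1 ^ 4) * (of_real (pi\<^sup>2) * c3\<^sup>2 * a1 ^ 4 * (- 2 * Z \<tau> * v \<tau> + s \<tau> * (1 + 2 * t \<tau> * s \<tau> + (t \<tau>)\<^sup>2))) =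
      \<kappa> \<tau> * (- 4 * Z \<tau> * v \<tau> + 2 * s \<tau> * (1 + 2 * t \<tau> * s \<tau> + (t \<tau>)\<^sup>2))"
    unfolding \<kappa>_def t4 K_def[symmetric] using nz' by (simp add: algebra_simps)
  finally show ?thesis .
qed

lemma v_square:
  assumes \<tau>: "Im \<tau> > 0"
  shows "(v \<tau>)\<^sup>2 = s \<tau> * (t \<tau> + s \<tau>) * (1 + t \<tau> * s \<tau>)"
proof -
  note nz = theta_constants_nonzero[OF \<tau>] f_nonzero[OF \<tau>]
  note r = stheta_relations[OF \<tau>, of A "of_real B", folded f1_def f2_def f3_def f4_def]
  define c2 c3 c4 where "c2 = (theta2 0 \<tau>)\<^sup>2" "c3 = (theta3 0 \<tau>)\<^sup>2" "c4 = (theta4 0 \<tau>)\<^sup>2"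
  note c = this(1)[symmetric] this(2)[symmetric] this(3)[symmetric]
  have cnz: "c2 \<noteq> 0" "c3 \<noteq> 0" "c4 \<noteq> 0" using nz by (simp_all add: c[symmetric])
  define a1 a2 a3 a4 where "a1 = f1 0 \<tau>" "a2 = f2 0 \<tau>" "a3 = f3 0 \<tau>" "a4 = f4 0 \<tau>"
  note a = this[symmetric]
  have nz': "a1 \<noteq> 0" using nz by (simp_all add: a)
  have "(v \<tau>)\<^sup>2 = a2\<^sup>2 * (c2 * a3\<^sup>2) * (c2 * a4\<^sup>2) / (c3\<^sup>2 * a1 ^ 6)"
    unfolding v_def a c by (simp add: power_mult_distrib power_divide) (simp add: power2_eq_square)
  also have "\<dots> = s \<tau> * (t \<tau> + s \<tau>) * (1 + t \<tau> * s \<tau>)"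
    unfolding r(1)[unfolded a c] r(2)[unfolded a c] s_def t_def a c using nz' cnz
    by (simp add: field_simps power2_eq_square power_numeral_reduce)
  finally show ?thesis .
qed

text \<open>
  The heat equation reduces this to the \<open>z\<close>-derivative of the second logarithmic derivative of \<open>\<theta>\<^sub>1\<close>.
  The non-modular quantity \<open>\<vartheta>\<^sub>2'' / \<vartheta>\<^sub>2\<close> cancels against the one in the derivative of \<open>\<vartheta>\<^sub>3\<^sup>2\<close>.
\<close>
lemma Z_deriv:
  assumes \<tau>: "Im \<tau> > 0"
  shows "(Z has_field_derivative \<kappa> \<tau> * (- 2 * t \<tau> * (s \<tau> + t \<tau>) * Z \<tau> + 2 * t \<tau> * v \<tau>)) (at \<tau>)"
proof -
  note nz = theta_constants_nonzero[OF \<tau>] f_nonzero[OF \<tau>]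
  note r = stheta_relations[OF \<tau>, of A "of_real B", folded f1_def f2_def f3_def f4_def]
  note r' = stheta_relations_deriv[OF \<tau>, of A "of_real B", folded f1_def f2_def f3_def f4_def]
  define l where "l = stheta2 0 2 0 \<tau> / theta2 0 \<tau>"
  have h: "stheta3 0 2 0 \<tau> = (l + pi\<^sup>2 * theta4 0 \<tau> ^ 4) * theta3 0 \<tau>"
    using theta_constants_heat(1)[OF \<tau>] nz unfolding l_def[symmetric] by (simp add: nonzero_divide_eq_eq)
  define c2 c3 c4 where "c2 = (theta2 0 \<tau>)\<^sup>2" "c3 = (theta3 0 \<tau>)\<^sup>2" "c4 = (theta4 0 \<tau>)\<^sup>2"
  note c = this(1)[symmetric] this(2)[symmetric] this(3)[symmetric]
  have cnz: "c2 \<noteq> 0" "c3 \<noteq> 0" "c4 \<noteq> 0" using nz by (simp_all add: c[symmetric])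
  define a1 a2 a3 a4 where "a1 = f1 0 \<tau>" "a2 = f2 0 \<tau>" "a3 = f3 0 \<tau>" "a4 = f4 0 \<tau>"
  note a = this[symmetric]
  define b1 b2 where "b1 = f1 1 \<tau>" "b2 = f2 1 \<tau>"
  note b = this[symmetric]
  have nz': "a1 \<noteq> 0" "a2 \<noteq> 0" using nz by (simp_all add: a)
  have W: "a1 * b2 = b1 * a2 - pi * c2 * (a3 * a4)" using r(3) unfolding a b c by (simp add: algebra_simps)
  have H: "a1 * (f1 3 \<tau> * a1 - b1 * f1 2 \<tau>) = 2 * (l * a1\<^sup>2 * b1 - pi\<^sup>2 * c3 * c4 * a2 * (b1 * a2 - pi * c2 * (a3 * a4)))"
  proof -
    have H0: "f1 3 \<tau> * a1 - b1 * f1 2 \<tau> = 2 * (l * (a1 * b1) - pi\<^sup>2 * c3 * c4 * (a2 * b2))"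
      using r'(4) unfolding a b c l_def[symmetric] .
    show ?thesis unfolding H0 W[symmetric] by (simp add: algebra_simps power2_eq_square)
  qed
  define K where "K = 4 * pi * \<i>"
  have K: "K \<noteq> 0" by (simp add: K_def)
  have sq: "((\<lambda>x. pi * (theta3 0 x)\<^sup>2) has_field_derivative pi * (2 * c3 * (l + pi\<^sup>2 * c4\<^sup>2) / K)) (at \<tau>)"
  proof -
    have t4: "theta4 0 \<tau> ^ 4 = c4\<^sup>2" by (simp add: c[symmetric])
    have cd: "(theta3 0 has_field_derivative (l + pi\<^sup>2 * c4\<^sup>2) * theta3 0 \<tau> / K) (at \<tau>)"
      using const_deriv(1)[OF \<tau>] unfolding h K_def t4 .
    show ?thesis unfolding power2_eq_square[of "theta3 0 x" for x]
      by (rule DERIV_cong[OF DERIV_cmult[OF DERIV_mult[OF cd cd]]])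
        (simp add: c(2)[symmetric] power2_eq_square[of "theta3 0 \<tau>"])
  qed
  have "(Z has_field_derivative (f1 3 \<tau> / K * (pi * c3 * a1) - b1 * (pi * (2 * c3 * (l + pi\<^sup>2 * c4\<^sup>2) / K) * a1 + f1 2 \<tau> / K * (pi * c3)))
       / ((pi * c3 * a1) * (pi * c3 * a1))) (at \<tau>)"
    using DERIV_divide[OF f_deriv(1)[OF \<tau>, of 1] DERIV_mult[OF sq f_deriv(1)[OF \<tau>, of 0]]] nz cnz
    unfolding Z_def[abs_def] K_def[symmetric] a b c by (simp add: numeral_3_eq_3 numeral_2_eq_2)
  also have "(f1 3 \<tau> / K * (pi * c3 * a1) - b1 * (pi * (2 * c3 * (l + pi\<^sup>2 * c4\<^sup>2) / K) * a1 + f1 2 \<tau> / K * (pi * c3)))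
       / ((pi * c3 * a1) * (pi * c3 * a1)) =
     ((a1 * (f1 3 \<tau> * a1 - b1 * f1 2 \<tau>)) - 2 * b1 * a1\<^sup>2 * (l + pi\<^sup>2 * c4\<^sup>2)) / (K * pi * c3 * a1 ^ 3)"
    using nz' cnz K by (simp add: field_simps power2_eq_square power3_eq_cube)
  also have "(a1 * (f1 3 \<tau> * a1 - b1 * f1 2 \<tau>)) - 2 * b1 * a1\<^sup>2 * (l + pi\<^sup>2 * c4\<^sup>2) =
      2 * of_real pi ^ 3 * c3 ^ 3 * a1 ^ 3 * (- t \<tau> * (s \<tau> + t \<tau>) * Z \<tau> + t \<tau> * v \<tau>)"
  proof -
    have sub: "b1 = Z \<tau> * (pi * c3 * a1)" "c2 * (a2 * a3 * a4) = v \<tau> * (c3 * a1 ^ 3)" "a2\<^sup>2 = s \<tau> * a1\<^sup>2" "c4 = t \<tau> * c3"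
    unfolding Z_def v_def s_def t_def a b c using cnz nz' by (simp_all add: power_divide)
    have "(a1 * (f1 3 \<tau> * a1 - b1 * f1 2 \<tau>)) - 2 * b1 * a1\<^sup>2 * (l + pi\<^sup>2 * c4\<^sup>2) =
        - 2 * (of_real pi)\<^sup>2 * c3 * c4 * (b1 * a2\<^sup>2 - of_real pi * (c2 * (a2 * a3 * a4))) - 2 * b1 * a1\<^sup>2 * (of_real pi)\<^sup>2 * c4\<^sup>2"
      unfolding H of_real_power by (simp add: algebra_simps power2_eq_square)
    then show ?thesis unfolding sub by (simp add: algebra_simps power2_eq_square power3_eq_cube)
  qed
  also have "2 * of_real pi ^ 3 * c3 ^ 3 * a1 ^ 3 * (- t \<tau> * (s \<tau> + t \<tau>) * Z \<tau> + t \<tau> * v \<tau>) / (K * pi * c3 * a1 ^ 3) =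
      \<kappa> \<tau> * (- 2 * t \<tau> * (s \<tau> + t \<tau>) * Z \<tau> + 2 * t \<tau> * v \<tau>)"
  proof -
    have t4: "theta3 0 \<tau> ^ 4 = c3\<^sup>2" by (simp add: c[symmetric])
    show ?thesis unfolding \<kappa>_def t4 K_def[symmetric]
      using nz' cnz K by (simp add: divide_simps) (simp add: algebra_simps power2_eq_square power3_eq_cube)
  qed
  finally show ?thesis .
qed

end

section \<open>The Picard and the Hitchin system\<close>

context shifted_point
begin

text \<open>
  Here \<open>q\<close> is Picard's solution and \<open>p\<close> its momentum; \<open>\<omega>\<close> is chosen such that the derivative of \<open>x\<close>
  is \<open>\<omega> x (x - 1)\<close>, so that \<open>d/d\<tau> = \<omega> x (x - 1) d/dx\<close>.
\<close>
definition x where "x \<tau> = (t \<tau>)\<^sup>2"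
definition q where "q \<tau> = - t \<tau> * s \<tau>"
definition p where "p \<tau> = Z \<tau> / (2 * t \<tau> * v \<tau>)"
definition \<omega> where "\<omega> \<tau> = - 4 * \<kappa> \<tau>"

lemma v_nonzero: "Im \<tau> > 0 \<Longrightarrow> v \<tau> \<noteq> 0"
  using f_nonzero[of \<tau>] theta_constants_nonzero[of \<tau>] by (simp add: v_def)

lemma Z_eq: "Im \<tau> > 0 \<Longrightarrow> Z \<tau> = 2 * t \<tau> * v \<tau> * p \<tau>"
  using v_nonzero[of \<tau>] t_nonzero[of \<tau>] by (simp add: p_def)

lemma x_deriv:
  assumes \<tau>: "Im \<tau> > 0"
  shows "(x has_field_derivative \<omega> \<tau> * (x \<tau> * (x \<tau> - 1))) (at \<tau>)"
  unfolding x_def[abs_def] power2_eq_square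
  by (rule DERIV_cong[OF DERIV_mult[OF t_deriv[OF \<tau>] t_deriv[OF \<tau>]]]) (simp add: \<omega>_def power2_eq_square algebra_simps)

text \<open>
  The derivative of \<open>v\<^sup>2 = s (t + s) (1 + t s)\<close> is divisible by \<open>v\<^sup>2\<close>: once \<open>Z\<close> is written as \<open>2 t v p\<close>,
  each of \<open>s\<close>, \<open>t + s\<close> and \<open>1 + t s\<close> divides its own derivative.
\<close>
lemma v_deriv:
  assumes \<tau>: "Im \<tau> > 0"
  shows "(v has_field_derivative \<kappa> \<tau> * v \<tau> * (2 + 6 * t \<tau> * s \<tau> - 4 * t \<tau> * p \<tau> * (t \<tau> + s \<tau>) * (1 + t \<tau> * s \<tau>)
      - 4 * t \<tau> * p \<tau> * s \<tau> * (1 + t \<tau> * s \<tau>) - 4 * (t \<tau>)\<^sup>2 * p \<tau> * s \<tau> * (t \<tau> + s \<tau>))) (at \<tau>)"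
    (is "(v has_field_derivative \<kappa> \<tau> * v \<tau> * ?Q) _")
proof -
  note nz = theta_constants_nonzero[OF \<tau>] f_nonzero[OF \<tau>]
  have "v field_differentiable (at \<tau>)"
  proof -
    have "(theta2 0 has_field_derivative stheta2 0 2 0 \<tau> / (4 * pi * \<i>)) (at \<tau>)"
      using stheta_deriv_tau(2)[OF \<tau>, of 0 0 0] by (simp add: stheta_0 numeral_2_eq_2)
    then have "theta2 0 field_differentiable (at \<tau>)" "theta3 0 field_differentiable (at \<tau>)"
        "f1 0 field_differentiable (at \<tau>)" "f2 0 field_differentiable (at \<tau>)" "f3 0 field_differentiable (at \<tau>)" "f4 0 field_differentiable (at \<tau>)"
      using const_deriv[OF \<tau>] f_deriv[OF \<tau>] unfolding field_differentiable_def by blast+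
    then show ?thesis unfolding v_def[abs_def]
      using nz by (intro field_differentiable_mult field_differentiable_divide field_differentiable_power) auto
  qed
  then obtain D where D: "(v has_field_derivative D) (at \<tau>)" by (auto simp: field_differentiable_def)
  define T where "T = \<kappa> \<tau> * (2 * t \<tau> * (1 - (t \<tau>)\<^sup>2))"
  define S where "S = \<kappa> \<tau> * (- 4 * Z \<tau> * v \<tau> + 2 * s \<tau> * (1 + 2 * t \<tau> * s \<tau> + (t \<tau>)\<^sup>2))"
  have dt: "(t has_field_derivative T) (at \<tau>)" and ds: "(s has_field_derivative S) (at \<tau>)"
    unfolding T_def S_def by (rule t_deriv[OF \<tau>] s_deriv[OF \<tau>])+
  have "2 * (v \<tau> * D) = S * (t \<tau> + s \<tau>) * (1 + t \<tau> * s \<tau>) + s \<tau> * (T + S) * (1 + t \<tau> * s \<tau>) + s \<tau> * (t \<tau> + s \<tau>) * (T * s \<tau> + t \<tau> * S)"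
  proof (rule DERIV_unique)
    show "((\<lambda>\<tau>. v \<tau> * v \<tau>) has_field_derivative 2 * (v \<tau> * D)) (at \<tau>)"
      by (rule DERIV_cong[OF DERIV_mult[OF D D]]) simp
    have "((\<lambda>\<tau>. s \<tau> * (t \<tau> + s \<tau>) * (1 + t \<tau> * s \<tau>)) has_field_derivative
        S * (t \<tau> + s \<tau>) * (1 + t \<tau> * s \<tau>) + s \<tau> * (T + S) * (1 + t \<tau> * s \<tau>) + s \<tau> * (t \<tau> + s \<tau>) * (T * s \<tau> + t \<tau> * S)) (at \<tau>)"
      by (rule DERIV_cong[OF DERIV_mult[OF DERIV_mult[OF ds DERIV_add[OF dt ds]] DERIV_add[OF DERIV_const[of 1] DERIV_mult[OF dt ds]]]])
         (simp add: algebra_simps)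
    then show "((\<lambda>\<tau>. v \<tau> * v \<tau>) has_field_derivative
        S * (t \<tau> + s \<tau>) * (1 + t \<tau> * s \<tau>) + s \<tau> * (T + S) * (1 + t \<tau> * s \<tau>) + s \<tau> * (t \<tau> + s \<tau>) * (T * s \<tau> + t \<tau> * S)) (at \<tau>)"
    proof (rule has_field_derivative_transform_within_open)
      show "open {\<tau>. Im \<tau> > 0}" by (rule open_halfspace_Im_gt)
    qed (use \<tau> v_square in \<open>auto simp: power2_eq_square\<close>)
  qed
  also have "S = \<kappa> \<tau> * (s \<tau> * (- 8 * t \<tau> * p \<tau> * (t \<tau> + s \<tau>) * (1 + t \<tau> * s \<tau>) + 2 * (1 + 2 * t \<tau> * s \<tau> + (t \<tau>)\<^sup>2)))"
  proof -
    have "S = \<kappa> \<tau> * (- 8 * t \<tau> * p \<tau> * (v \<tau>)\<^sup>2 + 2 * s \<tau> * (1 + 2 * t \<tau> * s \<tau> + (t \<tau>)\<^sup>2))"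
      unfolding S_def Z_eq[OF \<tau>] by (simp add: power2_eq_square algebra_simps)
    then show ?thesis unfolding v_square[OF \<tau>] by (simp add: algebra_simps)
  qed
  finally have "2 * (v \<tau> * D) = 2 * (\<kappa> \<tau> * (s \<tau> * (t \<tau> + s \<tau>) * (1 + t \<tau> * s \<tau>)) * ?Q)"
    unfolding T_def by (simp add: algebra_simps power2_eq_square)
  also have "\<dots> = 2 * (v \<tau> * (\<kappa> \<tau> * v \<tau> * ?Q))" unfolding v_square[OF \<tau>, symmetric] by (simp add: power2_eq_square)
  finally have "D = \<kappa> \<tau> * v \<tau> * ?Q" using v_nonzero[OF \<tau>] by (subst (asm) mult_cancel_left) simp
  with D show ?thesis by simp
qed

text \<open>
  Together with \<open>p_deriv_picard\<close> this is the Hamiltonian system of the sixth Painleve equation with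
  Picard's parameters.
\<close>
lemma q_deriv:
  assumes \<tau>: "Im \<tau> > 0"
  shows "(q has_field_derivative \<omega> \<tau> * (2 * q \<tau> * (q \<tau> - 1) * (q \<tau> - x \<tau>) * p \<tau> + q \<tau> * (q \<tau> - 1))) (at \<tau>)"
proof -
  have "Z \<tau> * v \<tau> = 2 * t \<tau> * p \<tau> * (v \<tau>)\<^sup>2" unfolding Z_eq[OF \<tau>] by (simp add: power2_eq_square)
  also have "\<dots> = 2 * t \<tau> * p \<tau> * (s \<tau> * (t \<tau> + s \<tau>) * (1 + t \<tau> * s \<tau>))" unfolding v_square[OF \<tau>] ..
  finally have Zv: "- 4 * Z \<tau> * v \<tau> = - 8 * t \<tau> * p \<tau> * (s \<tau> * (t \<tau> + s \<tau>) * (1 + t \<tau> * s \<tau>))" by simp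
  have 1: "((\<lambda>\<tau>. - t \<tau>) has_field_derivative - (\<kappa> \<tau> * (2 * t \<tau> * (1 - (t \<tau>)\<^sup>2)))) (at \<tau>)"
    by (rule DERIV_minus[OF t_deriv[OF \<tau>]])
  show ?thesis unfolding q_def[abs_def] x_def \<omega>_def
    by (rule DERIV_cong[OF DERIV_mult[OF 1 s_deriv[OF \<tau>, unfolded Zv]]])
       (simp add: algebra_simps power2_eq_square)
qed

lemma p_deriv_picard:
  assumes \<tau>: "Im \<tau> > 0"
  shows "(p has_field_derivative \<omega> \<tau> * (- (3 * (q \<tau>)\<^sup>2 - 2 * (1 + x \<tau>) * q \<tau> + x \<tau>) * (p \<tau>)\<^sup>2 - (2 * q \<tau> - 1) * p \<tau> - 1 / 4)) (at \<tau>)"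
proof -
  note nz = v_nonzero[OF \<tau>] t_nonzero(1)[OF \<tau>]
  define Q where "Q = 2 + 6 * t \<tau> * s \<tau> - 4 * t \<tau> * p \<tau> * (t \<tau> + s \<tau>) * (1 + t \<tau> * s \<tau>)
      - 4 * t \<tau> * p \<tau> * s \<tau> * (1 + t \<tau> * s \<tau>) - 4 * (t \<tau>)\<^sup>2 * p \<tau> * s \<tau> * (t \<tau> + s \<tau>)"
  define N where "N = 2 * t \<tau> * v \<tau>"
  have N: "N \<noteq> 0" using nz by (simp add: N_def)
  have dN: "((\<lambda>\<tau>. 2 * t \<tau> * v \<tau>) has_field_derivative \<kappa> \<tau> * N * (2 * (1 - (t \<tau>)\<^sup>2) + Q)) (at \<tau>)"
    by (rule DERIV_cong[OF DERIV_mult[OF DERIV_cmult[OF t_deriv[OF \<tau>]] v_deriv[OF \<tau>, folded Q_def]]])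
       (simp add: N_def algebra_simps)
  have "(p has_field_derivative (\<kappa> \<tau> * (- 2 * t \<tau> * (s \<tau> + t \<tau>) * (N * p \<tau>) + N) * N - N * p \<tau> * (\<kappa> \<tau> * N * (2 * (1 - (t \<tau>)\<^sup>2) + Q))) / (N * N)) (at \<tau>)"
    using DERIV_divide[OF Z_deriv[OF \<tau>] dN] N Z_eq[OF \<tau>] unfolding p_def[abs_def, symmetric] N_def by simp
  also have "(\<kappa> \<tau> * (- 2 * t \<tau> * (s \<tau> + t \<tau>) * (N * p \<tau>) + N) * N - N * p \<tau> * (\<kappa> \<tau> * N * (2 * (1 - (t \<tau>)\<^sup>2) + Q))) / (N * N)
     = \<kappa> \<tau> * (- 2 * t \<tau> * (s \<tau> + t \<tau>) * p \<tau> + 1 - p \<tau> * (2 * (1 - (t \<tau>)\<^sup>2) + Q))"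
    using N by (simp add: divide_simps) (simp add: algebra_simps)
  also have "\<dots> = \<omega> \<tau> * (- (3 * (q \<tau>)\<^sup>2 - 2 * (1 + x \<tau>) * q \<tau> + x \<tau>) * (p \<tau>)\<^sup>2 - (2 * q \<tau> - 1) * p \<tau> - 1 / 4)"
    unfolding q_def x_def \<omega>_def Q_def by (simp add: algebra_simps power2_eq_square)
  finally show ?thesis .
qed

text \<open>
  The Okamoto transformation from Picard's to Hitchin's parameters; the momentum is unchanged.
\<close>
definition y where "y \<tau> = q \<tau> + 1 / (2 * p \<tau>)"

lemma p_deriv:
  assumes \<tau>: "Im \<tau> > 0" and p: "p \<tau> \<noteq> 0"
  shows "(p has_field_derivative \<omega> \<tau> * (- (3 * (y \<tau>)\<^sup>2 - 2 * (1 + x \<tau>) * y \<tau> + x \<tau>) * (p \<tau>)\<^sup>2 + (y \<tau> - x \<tau>) * p \<tau>)) (at \<tau>)"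
proof -
  have q: "q \<tau> = y \<tau> - 1 / (2 * p \<tau>)" by (simp add: y_def)
  show ?thesis
    by (rule DERIV_cong[OF p_deriv_picard[OF \<tau>]], unfold q) (use p in \<open>simp add: field_simps power2_eq_square\<close>)
qed

lemma y_deriv:
  assumes \<tau>: "Im \<tau> > 0" and p: "p \<tau> \<noteq> 0"
  shows "(y has_field_derivative \<omega> \<tau> * (2 * y \<tau> * (y \<tau> - 1) * (y \<tau> - x \<tau>) * p \<tau> - ((y \<tau>)\<^sup>2 - 2 * x \<tau> * y \<tau> + x \<tau>) / 2)) (at \<tau>)"
proof -
  have q: "q \<tau> = y \<tau> - 1 / (2 * p \<tau>)" by (simp add: y_def)
  define P where "P = - (3 * (y \<tau>)\<^sup>2 - 2 * (1 + x \<tau>) * y \<tau> + x \<tau>) * (p \<tau>)\<^sup>2 + (y \<tau> - x \<tau>) * p \<tau>"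
  have inv: "((\<lambda>\<tau>. 1 / (2 * p \<tau>)) has_field_derivative - (\<omega> \<tau> * P) / (2 * (p \<tau>)\<^sup>2)) (at \<tau>)"
    by (rule DERIV_cong[OF DERIV_divide[OF DERIV_const DERIV_cmult[OF p_deriv[OF \<tau> p, folded P_def]]]])
       (use p in \<open>simp_all add: power2_eq_square divide_simps\<close>)
  have "(y has_field_derivative \<omega> \<tau> * (2 * q \<tau> * (q \<tau> - 1) * (q \<tau> - x \<tau>) * p \<tau> + q \<tau> * (q \<tau> - 1)) + - (\<omega> \<tau> * P) / (2 * (p \<tau>)\<^sup>2)) (at \<tau>)"
    unfolding y_def[abs_def] by (rule DERIV_add[OF q_deriv[OF \<tau>] inv])
  also have "\<omega> \<tau> * (2 * q \<tau> * (q \<tau> - 1) * (q \<tau> - x \<tau>) * p \<tau> + q \<tau> * (q \<tau> - 1)) + - (\<omega> \<tau> * P) / (2 * (p \<tau>)\<^sup>2)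
    = \<omega> \<tau> * (2 * y \<tau> * (y \<tau> - 1) * (y \<tau> - x \<tau>) * p \<tau> - ((y \<tau>)\<^sup>2 - 2 * x \<tau> * y \<tau> + x \<tau>) / 2)"
    unfolding P_def q using p by (simp add: divide_simps) (simp add: algebra_simps power2_eq_square)
  finally show ?thesis .
qed

end

section \<open>The sixth Painleve equation and the exceptional set\<close>

lemma upper_half_plane_simps:
  "open upper_half_plane" "connected upper_half_plane" "\<tau> \<in> upper_half_plane \<longleftrightarrow> Im \<tau> > 0"
proof -
  have eq: "upper_half_plane = {\<tau>. Im \<tau> > 0}" by (simp add: upper_half_plane_def)
  show "open upper_half_plane" unfolding eq by (rule open_halfspace_Im_gt)
  show "connected upper_half_plane" unfolding eq by (rule convex_connected[OF convex_halfspace_Im_gt])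
  show "\<tau> \<in> upper_half_plane \<longleftrightarrow> Im \<tau> > 0" unfolding eq by (rule mem_Collect_eq)
qed

lemma zeros_sparse_in:
  assumes f: "f holomorphic_on S" and S: "open S" "connected S" and nz: "w \<in> S" "f w \<noteq> 0"
  shows "{z \<in> S. f z = 0} sparse_in S"
proof -
  have "\<not> x islimpt {z \<in> S. f z = 0}" if "x \<in> S" for x
  proof
    assume "x islimpt {z \<in> S. f z = 0}"
    then have "f w = 0"
      by (rule analytic_continuation[OF f S _ that _ _ nz(1), rotated]) auto
    with nz show False by simp
  qed
  then show ?thesis by (simp add: sparse_in_open[OF S(1)])
qed

text \<open>
  The left-hand side is the derivative of \<open>y'\<close> with respect to \<open>X\<close> as computed from the Hamiltonian
  system. In terms of \<open>u = y (y - 1) (y - X) P\<close> the numerator of either side is quadratic in \<open>u\<close>. The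
  coefficients of \<open>u\<^sup>2\<close> and \<open>u\<close> agree at sight, and the constant term is an identity in \<open>X\<close> and \<open>y\<close>.
\<close>
lemma hitchin_system_imp_painleve6:
  fixes X y P :: complex
  assumes nz: "X \<noteq> 0" "X \<noteq> 1" "y \<noteq> 0" "y \<noteq> 1" "y \<noteq> X"
  defines "y' \<equiv> (2 * y * (y - 1) * (y - X) * P - (y\<^sup>2 - 2 * X * y + X) / 2) / (X * (X - 1))"
  defines "P' \<equiv> (- (3 * y\<^sup>2 - 2 * (1 + X) * y + X) * P\<^sup>2 + (y - X) * P) / (X * (X - 1))"
  shows "(2 * (3 * y\<^sup>2 - 2 * (1 + X) * y + X) * y' * P - 2 * y * (y - 1) * P + 2 * y * (y - 1) * (y - X) * P'
          - (2 * (y - X) * y' - 2 * y + 1) / 2) / (X * (X - 1)) - y' * (2 * X - 1) / (X * (X - 1))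
      = painleve6_rhs (1/8) (1/8) (1/8) (1/8) X y y'"
proof -
  define D where "D = X * (X - 1)"
  define G where "G = y * (y - 1) * (y - X)"
  define c where "c = y\<^sup>2 - 2 * X * y + X"
  have D: "D \<noteq> 0" and G: "G \<noteq> 0" using nz by (auto simp: D_def G_def)
  have yD: "D * y' = 2 * G * P - c / 2" unfolding y'_def G_def D_def c_def using nz by simp
  have PD: "D * P' = - (3 * y\<^sup>2 - 2 * (1 + X) * y + X) * P\<^sup>2 + (y - X) * P"
    unfolding P'_def D_def using nz by simp
  have nzy: "y - 1 \<noteq> 0" "y - X \<noteq> 0" "X - 1 \<noteq> 0" using nz by auto
  have rhs: "D\<^sup>2 * G * painleve6_rhs (1/8) (1/8) (1/8) (1/8) X y y' =
     1/2 * ((y - 1) * (y - X) + y * (y - X) + y * (y - 1)) * (D * y')\<^sup>2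
     - ((X - 1) * G + X * G + D * y * (y - 1)) * (D * y')
     + (1/8) * (G\<^sup>2 - X * (y - 1)\<^sup>2 * (y - X)\<^sup>2 + (X - 1) * y\<^sup>2 * (y - X)\<^sup>2 + 3 * D * y\<^sup>2 * (y - 1)\<^sup>2)"
  proof -
    have 1: "D\<^sup>2 * G * (1/2 * (1/y + 1/(y - 1) + 1/(y - X)) * y'\<^sup>2) =
       1/2 * ((y - 1) * (y - X) + y * (y - X) + y * (y - 1)) * (D * y')\<^sup>2"
    proof -
      have "G * (1/y) = (y - 1) * (y - X)" "G * (1/(y - 1)) = y * (y - X)" "G * (1/(y - X)) = y * (y - 1)"
        using nz nzy by (simp_all add: G_def)
      moreover have "D\<^sup>2 * G * (1/2 * (1/y + 1/(y - 1) + 1/(y - X)) * y'\<^sup>2) =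
          1/2 * (G * (1/y) + G * (1/(y - 1)) + G * (1/(y - X))) * (D * y')\<^sup>2"
        by (simp add: algebra_simps power2_eq_square)
      ultimately show ?thesis by (simp only: add_ac)
    qed
    have 2: "D\<^sup>2 * G * ((1/X + 1/(X - 1) + 1/(y - X)) * y') = ((X - 1) * G + X * G + D * y * (y - 1)) * (D * y')"
    proof -
      have "D * (1/X) = X - 1" "D * (1/(X-1)) = X" "G * (1/(y - X)) = y * (y - 1)"
        using nz nzy by (simp_all add: D_def G_def)
      moreover have "D\<^sup>2 * G * ((1/X + 1/(X - 1) + 1/(y - X)) * y') = (D * y') * (D * (1/X) * G + D * (1/(X - 1)) * G + D * (G * (1/(y - X))))"
        by (simp add: algebra_simps power2_eq_square)
      ultimately show ?thesis by (simp only: mult_ac)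
    qed
    have 3: "D\<^sup>2 * G * (y * (y - 1) * (y - X) / (X\<^sup>2 * (X - 1)\<^sup>2)
       * (1/8 - 1/8 * (X / y\<^sup>2) + 1/8 * ((X - 1) / (y - 1)\<^sup>2) - (1/8 - 1/2) * (X * (X - 1) / (y - X)\<^sup>2))) =
       (1/8) * (G\<^sup>2 - X * (y - 1)\<^sup>2 * (y - X)\<^sup>2 + (X - 1) * y\<^sup>2 * (y - X)\<^sup>2 + 3 * D * y\<^sup>2 * (y - 1)\<^sup>2)"
    proof -
      have a: "D\<^sup>2 * (y * (y - 1) * (y - X) / (X\<^sup>2 * (X - 1)\<^sup>2)) = G"
        using nz nzy by (simp add: D_def G_def power_mult_distrib)
      have b: "G\<^sup>2 * (X / y\<^sup>2) = X * (y - 1)\<^sup>2 * (y - X)\<^sup>2" "G\<^sup>2 * ((X - 1) / (y - 1)\<^sup>2) = (X - 1) * y\<^sup>2 * (y - X)\<^sup>2"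
        "G\<^sup>2 * (X * (X - 1) / (y - X)\<^sup>2) = D * y\<^sup>2 * (y - 1)\<^sup>2"
        using nz nzy by (simp_all add: D_def G_def power_mult_distrib)
      have "D\<^sup>2 * G * (y * (y - 1) * (y - X) / (X\<^sup>2 * (X - 1)\<^sup>2)
       * (1/8 - 1/8 * (X / y\<^sup>2) + 1/8 * ((X - 1) / (y - 1)\<^sup>2) - (1/8 - 1/2) * (X * (X - 1) / (y - X)\<^sup>2))) =
        (D\<^sup>2 * (y * (y - 1) * (y - X) / (X\<^sup>2 * (X - 1)\<^sup>2))) * G * (1/8 - 1/8 * (X / y\<^sup>2) + 1/8 * ((X - 1) / (y - 1)\<^sup>2) - (1/8 - 1/2) * (X * (X - 1) / (y - X)\<^sup>2))"
        by (simp only: mult_ac)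
      also have "\<dots> = (1/8) * (G\<^sup>2 - G\<^sup>2 * (X / y\<^sup>2) + G\<^sup>2 * ((X - 1) / (y - 1)\<^sup>2) + 3 * (G\<^sup>2 * (X * (X - 1) / (y - X)\<^sup>2)))"
        unfolding a power2_eq_square[of G] by (simp only: diff_divide_distrib add_divide_distrib ring_distribs) (simp add: algebra_simps)
      finally show ?thesis unfolding b by simp
    qed
    show ?thesis
      unfolding painleve6_rhs_def distrib_left[of "D\<^sup>2 * G"] right_diff_distrib[of "D\<^sup>2 * G"] 1 2 3 ..
  qed
  have lhs: "D\<^sup>2 * G * ((2 * (3 * y\<^sup>2 - 2 * (1 + X) * y + X) * y' * P - 2 * y * (y - 1) * P + 2 * y * (y - 1) * (y - X) * P'
          - (2 * (y - X) * y' - 2 * y + 1) / 2) / (X * (X - 1)) - y' * (2 * X - 1) / (X * (X - 1)))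
     = G * (2 * (3 * y\<^sup>2 - 2 * (1 + X) * y + X) * (D * y') * P - 2 * D * y * (y - 1) * P + 2 * G * (D * P')
        - (y - X) * (D * y') + D * y - D / 2 - (D * y') * (2 * X - 1))"
    unfolding D_def[symmetric] using D by (simp add: field_simps power2_eq_square G_def)
  define u where "u = G * P"
  define g where "g = 3 * y\<^sup>2 - 2 * (1 + X) * y + X"
  define E where "E = (X - 1) * G + X * G + D * y * (y - 1)"
  define M where "M = G\<^sup>2 - X * (y - 1)\<^sup>2 * (y - X)\<^sup>2 + (X - 1) * y\<^sup>2 * (y - X)\<^sup>2 + 3 * D * y\<^sup>2 * (y - 1)\<^sup>2"
  have g: "(y - 1) * (y - X) + y * (y - X) + y * (y - 1) = g"
    by (simp add: g_def algebra_simps power2_eq_square)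
  have yD': "D * y' = 2 * u - c / 2" unfolding yD u_def by simp
  have GPD: "G * (G * (D * P')) = - g * u\<^sup>2 + (y - X) * G * u"
    unfolding PD u_def g_def[symmetric] by (simp add: algebra_simps power2_eq_square)
  have const: "G * ((y - X) * c / 2 + D * y - D / 2 + c * (2 * X - 1) / 2) = g * c\<^sup>2 / 8 + E * c / 2 + (1/8) * M"
    unfolding E_def M_def g_def G_def D_def c_def by (simp add: field_simps power2_eq_square)
  have "G * (2 * g * (D * y') * P - 2 * D * y * (y - 1) * P + 2 * G * (D * P')
        - (y - X) * (D * y') + D * y - D / 2 - (D * y') * (2 * X - 1)) =
      2 * g * (D * y') * u - 2 * D * y * (y - 1) * u + 2 * (G * (G * (D * P')))
        + G * (- (y - X) * (D * y') + D * y - D / 2 - (D * y') * (2 * X - 1))"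
    unfolding u_def by (simp add: algebra_simps)
  also have "\<dots> = 2 * g * u\<^sup>2 - (g * c + 2 * E) * u + G * ((y - X) * c / 2 + D * y - D / 2 + c * (2 * X - 1) / 2)"
    unfolding yD' GPD E_def by (simp add: field_simps power2_eq_square)
  also have "\<dots> = 1/2 * g * (D * y')\<^sup>2 - E * (D * y') + (1/8) * M"
    unfolding const yD' by (simp add: field_simps power2_eq_square)
  finally have "D\<^sup>2 * G * ((2 * (3 * y\<^sup>2 - 2 * (1 + X) * y + X) * y' * P - 2 * y * (y - 1) * P + 2 * y * (y - 1) * (y - X) * P'
          - (2 * (y - X) * y' - 2 * y + 1) / 2) / (X * (X - 1)) - y' * (2 * X - 1) / (X * (X - 1)))
     = D\<^sup>2 * G * painleve6_rhs (1/8) (1/8) (1/8) (1/8) X y y'"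
    unfolding lhs rhs unfolding g g_def[symmetric] E_def[symmetric] M_def[symmetric] .
  then show ?thesis using D G by (subst (asm) mult_cancel_left) auto
qed

lemma holomorphic_on_upper_half_planeI:
  assumes "\<And>\<tau>. Im \<tau> > 0 \<Longrightarrow> (f has_field_derivative D \<tau>) (at \<tau>)"
  shows "f holomorphic_on upper_half_plane"
  unfolding holomorphic_on_open[OF upper_half_plane_simps(1)] using assms upper_half_plane_simps(3) by blast

context shifted_point
begin

lemma x_holomorphic: "x holomorphic_on upper_half_plane"
  and q_holomorphic: "q holomorphic_on upper_half_plane"
  and p_holomorphic: "p holomorphic_on upper_half_plane"
  by (rule holomorphic_on_upper_half_planeI, rule x_deriv q_deriv p_deriv_picard, assumption)+

lemma \<omega>_nonzero: "Im \<tau> > 0 \<Longrightarrow> \<omega> \<tau> \<noteq> 0"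
  using theta_constants_nonzero[of \<tau>] by (simp add: \<omega>_def \<kappa>_def)

lemma x_nonzero: "Im \<tau> > 0 \<Longrightarrow> x \<tau> \<noteq> 0" "Im \<tau> > 0 \<Longrightarrow> x \<tau> \<noteq> 1"
  using t_nonzero[of \<tau>] by (auto simp: x_def)

text \<open>
  At a zero of \<open>p\<close> the Picard system gives \<open>p' = - \<omega> / 4\<close>, which is not zero.
\<close>
lemma p_zeros_sparse: "{\<tau> \<in> upper_half_plane. p \<tau> = 0} sparse_in upper_half_plane"
proof -
  have "\<exists>w\<in>upper_half_plane. p w \<noteq> 0"
  proof (rule ccontr)
    assume "\<not> ?thesis"
    then have z: "p w = 0" if "Im w > 0" for w using that by (auto simp: upper_half_plane_simps)
    have "(p has_field_derivative 0) (at \<i>)"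
      by (rule has_field_derivative_transform_within_open[of "\<lambda>_. 0" _ _ upper_half_plane])
         (auto simp: upper_half_plane_simps z)
    with p_deriv_picard[of \<i>] have "0 = \<omega> \<i> * (- (3 * (q \<i>)\<^sup>2 - 2 * (1 + x \<i>) * q \<i> + x \<i>) * (p \<i>)\<^sup>2 - (2 * q \<i> - 1) * p \<i> - 1 / 4)"
      by (intro DERIV_unique[of p 0 \<i>]) auto
    then show False using \<omega>_nonzero[of \<i>] by (simp add: z)
  qed
  then obtain w where "w \<in> upper_half_plane" "p w \<noteq> 0" ..
  then show ?thesis by (rule zeros_sparse_in[OF p_holomorphic upper_half_plane_simps(1,2)])
qed

text \<open>
  The poles of \<open>y\<close> are the zeros of \<open>p\<close>, and away from them \<open>y = c\<close> means \<open>2 p (q - c) + 1 = 0\<close>. If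
  this holomorphic function vanished identically, then \<open>p\<close> would have no zero, \<open>y\<close> would be \<open>c\<close>
  everywhere, and \<open>c\<close> would satisfy Hitchin's system, against the second assumption.
\<close>
lemma y_special_values_sparse:
  assumes c: "c holomorphic_on upper_half_plane"
    and no: "\<And>\<tau>. Im \<tau> > 0 \<Longrightarrow> p \<tau> \<noteq> 0 \<Longrightarrow> y \<tau> = c \<tau> \<Longrightarrow>
       deriv c \<tau> \<noteq> \<omega> \<tau> * (2 * y \<tau> * (y \<tau> - 1) * (y \<tau> - x \<tau>) * p \<tau> - ((y \<tau>)\<^sup>2 - 2 * x \<tau> * y \<tau> + x \<tau>) / 2)"
  shows "{\<tau> \<in> upper_half_plane. y \<tau> = c \<tau>} sparse_in upper_half_plane"
proof -
  \<comment> \<open>Unlike \<open>y - c\<close>, its multiple by \<open>2 p\<close> is holomorphic.\<close>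
  define g where "g = (\<lambda>\<tau>. 2 * p \<tau> * (q \<tau> - c \<tau>) + 1)"
  have g: "g holomorphic_on upper_half_plane" unfolding g_def by (intro holomorphic_intros x_holomorphic q_holomorphic p_holomorphic c)
  have gy: "g \<tau> = 0 \<longleftrightarrow> y \<tau> = c \<tau>" if "p \<tau> \<noteq> 0" for \<tau>
    using that by (auto simp: g_def y_def field_simps)
  have "\<exists>w\<in>upper_half_plane. g w \<noteq> 0"
  proof (rule ccontr)
    assume "\<not> ?thesis"
    then have z: "g w = 0" if "Im w > 0" for w using that by (auto simp: upper_half_plane_simps)
    have pnz: "p w \<noteq> 0" if "Im w > 0" for w using z[OF that] by (auto simp: g_def)
    have yc: "y w = c w" if "Im w > 0" for w using gy z pnz that by auto
    have "(c has_field_derivative deriv c \<i>) (at \<i>)"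
      by (rule holomorphic_derivI[OF c]) (auto simp: upper_half_plane_simps)
    then have "(y has_field_derivative deriv c \<i>) (at \<i>)"
      by (rule has_field_derivative_transform_within_open[of _ _ _ upper_half_plane])
         (auto simp: upper_half_plane_simps yc)
    from DERIV_unique[OF this y_deriv[of \<i>]] no[of \<i>] pnz[of \<i>] yc[of \<i>] show False by auto
  qed
  then obtain w where "w \<in> upper_half_plane" "g w \<noteq> 0" ..
  then have "{\<tau> \<in> upper_half_plane. g \<tau> = 0} sparse_in upper_half_plane"
    by (rule zeros_sparse_in[OF g upper_half_plane_simps(1,2)])
  from sparse_in_union'[OF p_zeros_sparse this] show ?thesis
    by (rule sparse_in_subset2) (use gy in auto)
qed

lemma exceptional_sparse:
  "{\<tau> \<in> upper_half_plane. p \<tau> = 0 \<or> y \<tau> = 0 \<or> y \<tau> = 1 \<or> y \<tau> = x \<tau>} sparse_in upper_half_plane"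
proof -
  have 0: "{\<tau> \<in> upper_half_plane. y \<tau> = 0} sparse_in upper_half_plane"
    by (rule y_special_values_sparse) (use \<omega>_nonzero x_nonzero in \<open>auto simp: field_simps\<close>)
  have 1: "{\<tau> \<in> upper_half_plane. y \<tau> = 1} sparse_in upper_half_plane"
    by (rule y_special_values_sparse) (use \<omega>_nonzero x_nonzero in \<open>auto simp: field_simps\<close>)
  have 2: "{\<tau> \<in> upper_half_plane. y \<tau> = x \<tau>} sparse_in upper_half_plane"
  proof (rule y_special_values_sparse[OF x_holomorphic])
    fix \<tau> assume \<tau>: "Im \<tau> > 0" "p \<tau> \<noteq> 0" "y \<tau> = x \<tau>"
    have d: "deriv x \<tau> = \<omega> \<tau> * (x \<tau> * (x \<tau> - 1))" by (rule DERIV_imp_deriv[OF x_deriv[OF \<tau>(1)]])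
    have n: "\<omega> \<tau> * (x \<tau> * (x \<tau> - 1)) \<noteq> 0" using \<omega>_nonzero x_nonzero \<tau> by auto
    have e: "\<omega> \<tau> * (2 * x \<tau> * (x \<tau> - 1) * (x \<tau> - x \<tau>) * p \<tau> - ((x \<tau>)\<^sup>2 - 2 * x \<tau> * x \<tau> + x \<tau>) / 2)
        = (\<omega> \<tau> * (x \<tau> * (x \<tau> - 1))) / 2"
    proof -
      have "(x \<tau>)\<^sup>2 - 2 * x \<tau> * x \<tau> + x \<tau> = - (x \<tau> * (x \<tau> - 1))" by (simp add: power2_eq_square algebra_simps)
      then show ?thesis by simp
    qed
    show "deriv x \<tau> \<noteq> \<omega> \<tau> * (2 * y \<tau> * (y \<tau> - 1) * (y \<tau> - x \<tau>) * p \<tau> - ((y \<tau>)\<^sup>2 - 2 * x \<tau> * y \<tau> + x \<tau>) / 2)"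
      unfolding \<tau>(3) d e
    proof
      assume "\<omega> \<tau> * (x \<tau> * (x \<tau> - 1)) = (\<omega> \<tau> * (x \<tau> * (x \<tau> - 1))) / 2"
      then have "2 * (\<omega> \<tau> * (x \<tau> * (x \<tau> - 1))) = \<omega> \<tau> * (x \<tau> * (x \<tau> - 1))" by (subst (asm) eq_divide_eq) simp
      then show False using n by (subst (asm) mult_2) simp
    qed
  qed
  from sparse_in_union'[OF sparse_in_union'[OF p_zeros_sparse 0] sparse_in_union'[OF 1 2]]
  show ?thesis by (rule sparse_in_subset2) auto
qed

text \<open>
  Since the derivative of \<open>x\<close> does not vanish, \<open>x\<close> is a local coordinate; \<open>y\<close> and \<open>p\<close> as functions of
  \<open>x\<close> satisfy Hitchin's system, and one further differentiation eliminates \<open>p\<close>.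
\<close>
lemma local_painleve6_solution:
  assumes \<tau>0: "Im \<tau>0 > 0" "p \<tau>0 \<noteq> 0" "y \<tau>0 \<noteq> 0" "y \<tau>0 \<noteq> 1" "y \<tau>0 \<noteq> x \<tau>0"
  obtains V Y where "open V" "\<tau>0 \<in> V" "V \<subseteq> {\<tau> \<in> upper_half_plane. p \<tau> \<noteq> 0}" "inj_on x V"
    "painleve6_solution_on (1/8) (1/8) (1/8) (1/8) (x ` V) Y" "\<And>\<tau>. \<tau> \<in> V \<Longrightarrow> Y (x \<tau>) = y \<tau>"
proof -
  define G where "G = {\<tau> \<in> upper_half_plane. p \<tau> \<noteq> 0 \<and> 2 * p \<tau> * q \<tau> + 1 \<noteq> 0 \<and> 2 * p \<tau> * (q \<tau> - 1) + 1 \<noteq> 0 \<and> 2 * p \<tau> * (q \<tau> - x \<tau>) + 1 \<noteq> 0}"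
  have G: "\<tau> \<in> G \<longleftrightarrow> Im \<tau> > 0 \<and> p \<tau> \<noteq> 0 \<and> y \<tau> \<noteq> 0 \<and> y \<tau> \<noteq> 1 \<and> y \<tau> \<noteq> x \<tau>" for \<tau>
    by (auto simp: G_def upper_half_plane_simps y_def field_simps)
  have "G = upper_half_plane \<inter> (\<lambda>\<tau>. p \<tau> * (2 * p \<tau> * q \<tau> + 1) * (2 * p \<tau> * (q \<tau> - 1) + 1) * (2 * p \<tau> * (q \<tau> - x \<tau>) + 1)) -` (- {0})"
    by (auto simp: G_def)
  moreover have "open \<dots>"
  proof (rule continuous_open_preimage)
    show "continuous_on upper_half_plane (\<lambda>\<tau>. p \<tau> * (2 * p \<tau> * q \<tau> + 1) * (2 * p \<tau> * (q \<tau> - 1) + 1) * (2 * p \<tau> * (q \<tau> - x \<tau>) + 1))"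
      by (intro continuous_intros holomorphic_on_imp_continuous_on x_holomorphic q_holomorphic p_holomorphic)
  qed (auto simp: upper_half_plane_simps)
  ultimately have oG: "open G" by simp
  have GH: "G \<subseteq> upper_half_plane" by (auto simp: G_def)
  have dx: "deriv x \<tau> = \<omega> \<tau> * (x \<tau> * (x \<tau> - 1))" if "\<tau> \<in> G" for \<tau>
    using DERIV_imp_deriv[OF x_deriv] that G by blast
  have wnz: "\<omega> \<tau> * (x \<tau> * (x \<tau> - 1)) \<noteq> 0" if "\<tau> \<in> G" for \<tau>
    using \<omega>_nonzero x_nonzero that G by auto
  have "\<tau>0 \<in> G" using \<tau>0 G by auto
  then obtain r where r: "r > 0" "ball \<tau>0 r \<subseteq> G" "open (x ` ball \<tau>0 r)" "inj_on x (ball \<tau>0 r)"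
    using has_complex_derivative_locally_invertible[of x G \<tau>0] holomorphic_on_subset[OF x_holomorphic GH] oG dx wnz by metis
  define V where "V = ball \<tau>0 r"
  have V: "open V" "\<tau>0 \<in> V" "V \<subseteq> G" "open (x ` V)" "inj_on x V" using r by (auto simp: V_def)
  obtain g where g: "g holomorphic_on (x ` V)" "\<And>z. z \<in> V \<Longrightarrow> g (x z) = z"
  proof -
    have "x holomorphic_on V" using holomorphic_on_subset[OF x_holomorphic] V(3) GH by blast
    then show ?thesis using holomorphic_has_inverse[OF _ V(1,5)] that by blast
  qed
  have gd: "(g has_field_derivative 1 / (\<omega> \<tau> * (x \<tau> * (x \<tau> - 1)))) (at (x \<tau>))" if \<tau>: "\<tau> \<in> V" for \<tau>
  proof -
    have "Im \<tau> > 0" using that V G by blast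
    have gg: "(g has_field_derivative deriv g (x \<tau>)) (at (x \<tau>))"
      by (rule holomorphic_derivI[OF g(1) V(4)]) (use \<tau> in auto)
    have "((\<lambda>z. g (x z)) has_field_derivative deriv g (x \<tau>) * (\<omega> \<tau> * (x \<tau> * (x \<tau> - 1)))) (at \<tau>)"
      by (rule DERIV_chain2[OF gg x_deriv]) fact
    moreover have "((\<lambda>z. g (x z)) has_field_derivative 1) (at \<tau>)"
      by (rule has_field_derivative_transform_within_open[of "\<lambda>z. z" _ _ V]) (use V g \<tau> in auto)
    ultimately have "deriv g (x \<tau>) * (\<omega> \<tau> * (x \<tau> * (x \<tau> - 1))) = 1" by (rule DERIV_unique)
    moreover have "\<omega> \<tau> * (x \<tau> * (x \<tau> - 1)) \<noteq> 0" using wnz V \<tau> by blast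
    ultimately have "deriv g (x \<tau>) = 1 / (\<omega> \<tau> * (x \<tau> * (x \<tau> - 1)))" by (simp add: field_simps)
    with gg show ?thesis by simp
  qed
  define Y P where "Y = (\<lambda>\<xi>. y (g \<xi>))" and "P = (\<lambda>\<xi>. p (g \<xi>))"
  define R1 where "R1 = (\<lambda>\<xi>. (2 * Y \<xi> * (Y \<xi> - 1) * (Y \<xi> - \<xi>) * P \<xi> - ((Y \<xi>)\<^sup>2 - 2 * \<xi> * Y \<xi> + \<xi>) / 2) / (\<xi> * (\<xi> - 1)))"
  define R2 where "R2 = (\<lambda>\<xi>. (- (3 * (Y \<xi>)\<^sup>2 - 2 * (1 + \<xi>) * Y \<xi> + \<xi>) * (P \<xi>)\<^sup>2 + (Y \<xi> - \<xi>) * P \<xi>) / (\<xi> * (\<xi> - 1)))"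
  have gV: "g \<xi> \<in> V" "x (g \<xi>) = \<xi>" if "\<xi> \<in> x ` V" for \<xi> using that g(2) by auto
  have good: "Im (g \<xi>) > 0" "p (g \<xi>) \<noteq> 0" "Y \<xi> \<noteq> 0" "Y \<xi> \<noteq> 1" "Y \<xi> \<noteq> \<xi>" "\<xi> \<noteq> 0" "\<xi> \<noteq> 1" if "\<xi> \<in> x ` V" for \<xi>
  proof -
    have "g \<xi> \<in> G" using gV(1)[OF that] V(3) by blast
    then show "Im (g \<xi>) > 0" "p (g \<xi>) \<noteq> 0" "Y \<xi> \<noteq> 0" "Y \<xi> \<noteq> 1" "Y \<xi> \<noteq> \<xi>" "\<xi> \<noteq> 0" "\<xi> \<noteq> 1"
      using x_nonzero[of "g \<xi>"] unfolding G Y_def gV(2)[OF that] by auto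
  qed
  have dY: "(Y has_field_derivative R1 \<xi>) (at \<xi>)" if \<xi>: "\<xi> \<in> x ` V" for \<xi>
  proof -
    have gd': "(g has_field_derivative 1 / (\<omega> (g \<xi>) * (\<xi> * (\<xi> - 1)))) (at \<xi>)" using gd[OF gV(1)[OF \<xi>]] gV(2)[OF \<xi>] by simp
    show ?thesis unfolding Y_def
      by (rule DERIV_cong[OF DERIV_chain2[OF y_deriv[OF good(1,2)[OF \<xi>]] gd']])
         (use \<omega>_nonzero[OF good(1)[OF \<xi>]] in \<open>simp add: R1_def Y_def P_def gV(2)[OF \<xi>]\<close>)
  qed
  have dP: "(P has_field_derivative R2 \<xi>) (at \<xi>)" if \<xi>: "\<xi> \<in> x ` V" for \<xi>
  proof -
    have gd': "(g has_field_derivative 1 / (\<omega> (g \<xi>) * (\<xi> * (\<xi> - 1)))) (at \<xi>)" using gd[OF gV(1)[OF \<xi>]] gV(2)[OF \<xi>] by simp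
    show ?thesis unfolding P_def
      by (rule DERIV_cong[OF DERIV_chain2[OF p_deriv[OF good(1,2)[OF \<xi>]] gd']])
         (use \<omega>_nonzero[OF good(1)[OF \<xi>]] in \<open>simp add: R2_def Y_def P_def gV(2)[OF \<xi>]\<close>)
  qed
  have dR1: "(R1 has_field_derivative painleve6_rhs (1/8) (1/8) (1/8) (1/8) \<xi> (Y \<xi>) (R1 \<xi>)) (at \<xi>)" if \<xi>: "\<xi> \<in> x ` V" for \<xi>
  proof -
    note nz = good(6,7,3,4,5)[OF \<xi>]
    have "((\<lambda>\<xi>. 2 * Y \<xi> * (Y \<xi> - 1) * (Y \<xi> - \<xi>) * P \<xi> - ((Y \<xi>)\<^sup>2 - 2 * \<xi> * Y \<xi> + \<xi>) / 2) has_field_derivative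
        (2 * (3 * (Y \<xi>)\<^sup>2 - 2 * (1 + \<xi>) * Y \<xi> + \<xi>) * R1 \<xi> * P \<xi> - 2 * Y \<xi> * (Y \<xi> - 1) * P \<xi> + 2 * Y \<xi> * (Y \<xi> - 1) * (Y \<xi> - \<xi>) * R2 \<xi>
          - (2 * (Y \<xi> - \<xi>) * R1 \<xi> - 2 * Y \<xi> + 1) / 2)) (at \<xi>)"
    proof -
      have 1: "((\<lambda>\<xi>. 2 * Y \<xi>) has_field_derivative 2 * R1 \<xi>) (at \<xi>)" by (rule DERIV_cmult[OF dY[OF \<xi>]])
      have 2: "((\<lambda>\<xi>. Y \<xi> - 1) has_field_derivative R1 \<xi> - 0) (at \<xi>)" by (rule DERIV_diff[OF dY[OF \<xi>] DERIV_const])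
      have 3: "((\<lambda>\<xi>. Y \<xi> - \<xi>) has_field_derivative R1 \<xi> - 1) (at \<xi>)" by (rule DERIV_diff[OF dY[OF \<xi>] DERIV_ident])
      have 4: "((\<lambda>\<xi>. ((Y \<xi>)\<^sup>2 - 2 * \<xi> * Y \<xi> + \<xi>) / 2) has_field_derivative (2 * (Y \<xi> - \<xi>) * R1 \<xi> - 2 * Y \<xi> + 1) / 2) (at \<xi>)"
        unfolding power2_eq_square[of "Y \<xi>" for \<xi>]
        by (rule DERIV_cdivide, rule DERIV_cong[OF DERIV_add[OF DERIV_diff[OF DERIV_mult[OF dY[OF \<xi>] dY[OF \<xi>]]
             DERIV_mult[OF DERIV_cmult[OF DERIV_ident, of 2] dY[OF \<xi>]]] DERIV_ident]]) (simp add: algebra_simps)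
      show ?thesis
        by (rule DERIV_cong[OF DERIV_diff[OF DERIV_mult[OF DERIV_mult[OF DERIV_mult[OF 1 2] 3] dP[OF \<xi>]] 4]])
           (simp add: algebra_simps power2_eq_square)
    qed
    moreover have "((\<lambda>\<xi>. \<xi> * (\<xi> - 1)) has_field_derivative 2 * \<xi> - 1) (at \<xi>)"
      by (rule derivative_eq_intros refl)+ (simp add: algebra_simps)
    ultimately have "(R1 has_field_derivative
       ((2 * (3 * (Y \<xi>)\<^sup>2 - 2 * (1 + \<xi>) * Y \<xi> + \<xi>) * R1 \<xi> * P \<xi> - 2 * Y \<xi> * (Y \<xi> - 1) * P \<xi> + 2 * Y \<xi> * (Y \<xi> - 1) * (Y \<xi> - \<xi>) * R2 \<xi>
          - (2 * (Y \<xi> - \<xi>) * R1 \<xi> - 2 * Y \<xi> + 1) / 2) * (\<xi> * (\<xi> - 1)) -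
         (2 * Y \<xi> * (Y \<xi> - 1) * (Y \<xi> - \<xi>) * P \<xi> - ((Y \<xi>)\<^sup>2 - 2 * \<xi> * Y \<xi> + \<xi>) / 2) * (2 * \<xi> - 1)) / ((\<xi> * (\<xi> - 1)) * (\<xi> * (\<xi> - 1)))) (at \<xi>)"
      unfolding R1_def[abs_def] by (rule DERIV_divide) (use nz in auto)
    also have "((2 * (3 * (Y \<xi>)\<^sup>2 - 2 * (1 + \<xi>) * Y \<xi> + \<xi>) * R1 \<xi> * P \<xi> - 2 * Y \<xi> * (Y \<xi> - 1) * P \<xi> + 2 * Y \<xi> * (Y \<xi> - 1) * (Y \<xi> - \<xi>) * R2 \<xi>
          - (2 * (Y \<xi> - \<xi>) * R1 \<xi> - 2 * Y \<xi> + 1) / 2) * (\<xi> * (\<xi> - 1)) -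
         (2 * Y \<xi> * (Y \<xi> - 1) * (Y \<xi> - \<xi>) * P \<xi> - ((Y \<xi>)\<^sup>2 - 2 * \<xi> * Y \<xi> + \<xi>) / 2) * (2 * \<xi> - 1)) / ((\<xi> * (\<xi> - 1)) * (\<xi> * (\<xi> - 1)))
       = (2 * (3 * (Y \<xi>)\<^sup>2 - 2 * (1 + \<xi>) * Y \<xi> + \<xi>) * R1 \<xi> * P \<xi> - 2 * Y \<xi> * (Y \<xi> - 1) * P \<xi> + 2 * Y \<xi> * (Y \<xi> - 1) * (Y \<xi> - \<xi>) * R2 \<xi>
          - (2 * (Y \<xi> - \<xi>) * R1 \<xi> - 2 * Y \<xi> + 1) / 2) / (\<xi> * (\<xi> - 1)) - R1 \<xi> * (2 * \<xi> - 1) / (\<xi> * (\<xi> - 1))"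
      (is "(?A * ?D - ?N * ?e) / (?D * ?D) = _")
    proof -
      have quot: "(a * d - n * e) / (d * d) = a / d - r * e / d" if "n = r * d" "d \<noteq> 0" for a d n e r :: complex
        using that by (simp add: field_simps)
      show ?thesis by (rule quot) (use nz in \<open>simp_all add: R1_def\<close>)
    qed
    also have "\<dots> = painleve6_rhs (1/8) (1/8) (1/8) (1/8) \<xi> (Y \<xi>) (R1 \<xi>)"
      using hitchin_system_imp_painleve6[OF nz, of "P \<xi>"] unfolding R1_def R2_def .
    finally show ?thesis .
  qed
  have "painleve6_solution_on (1/8) (1/8) (1/8) (1/8) (x ` V) Y"
    unfolding painleve6_solution_on_def
  proof (intro conjI ballI)
    show "open (x ` V)" by fact
    show "Y holomorphic_on x ` V" using dY V(4) by (auto simp: holomorphic_on_open)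
    fix \<xi> assume \<xi>: "\<xi> \<in> x ` V"
    show "\<xi> \<noteq> 0" "\<xi> \<noteq> 1" "Y \<xi> \<noteq> 0" "Y \<xi> \<noteq> 1" "Y \<xi> \<noteq> \<xi>" using good[OF \<xi>] by auto
    have "(deriv Y has_field_derivative painleve6_rhs (1/8) (1/8) (1/8) (1/8) \<xi> (Y \<xi>) (R1 \<xi>)) (at \<xi>)"
      by (rule has_field_derivative_transform_within_open[OF dR1[OF \<xi>] V(4) \<xi>]) (use DERIV_imp_deriv[OF dY] in auto)
    then show "deriv (deriv Y) \<xi> = painleve6_rhs (1/8) (1/8) (1/8) (1/8) \<xi> (Y \<xi>) (deriv Y \<xi>)"
      unfolding DERIV_imp_deriv[OF dY[OF \<xi>]] by (rule DERIV_imp_deriv)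
  qed
  moreover have "Y (x \<tau>) = y \<tau>" if "\<tau> \<in> V" for \<tau> using g(2)[OF that] by (simp add: Y_def)
  moreover have "V \<subseteq> {\<tau> \<in> upper_half_plane. p \<tau> \<noteq> 0}" using V(3) G by (auto simp: upper_half_plane_simps)
  ultimately show ?thesis using that V by blast
qed

end

section \<open>Elimination of an algebraic function\<close>

text \<open>
  More vectors than coordinates are dependent, by fraction-free Gaussian elimination of the last
  coordinate.
\<close>
lemma linear_dependence_idom:
  fixes v :: "'b \<Rightarrow> nat \<Rightarrow> 'a :: idom"
  assumes "finite I" "card I > d"
  shows "\<exists>c. (\<exists>i\<in>I. c i \<noteq> 0) \<and> (\<forall>j<d. (\<Sum>i\<in>I. c i * v i j) = 0)"
  using assms
proof (induction d arbitrary: I v)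
  case 0
  then obtain i where "i \<in> I" by (auto simp: card_gt_0_iff)
  then show ?case by (intro exI[of _ "\<lambda>_. 1"]) auto
next
  case (Suc d)
  show ?case
  proof (cases "\<forall>i\<in>I. v i d = 0")
    case True
    from Suc.IH[of I v] Suc.prems obtain c where c: "\<exists>i\<in>I. c i \<noteq> 0" "\<forall>j<d. (\<Sum>i\<in>I. c i * v i j) = 0" by auto
    have "(\<Sum>i\<in>I. c i * v i j) = 0" if "j < Suc d" for j
    proof (cases "j = d")
      case True
      with \<open>\<forall>i\<in>I. v i d = 0\<close> show ?thesis by simp
    qed (use c that in auto)
    with c(1) show ?thesis by blast
  next
    case False
    then obtain k where k: "k \<in> I" "v k d \<noteq> 0" by blast
    define J where "J = I - {k}"
    have J: "finite J" "card J > d" "I = insert k J" "k \<notin> J" using Suc.prems k by (auto simp: J_def)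
    \<comment> \<open>Subtracting multiples of the pivot vector clears the coordinate \<open>d\<close>.\<close>
    define w where "w = (\<lambda>i j. v k d * v i j - v i d * v k j)"
    from Suc.IH[OF J(1,2), of w] obtain c where c: "\<exists>i\<in>J. c i \<noteq> 0" "\<forall>j<d. (\<Sum>i\<in>J. c i * w i j) = 0" by auto
    \<comment> \<open>The coefficient of the pivot is chosen such that the coordinate \<open>d\<close> cancels.\<close>
    define c' where "c' = (\<lambda>i. if i = k then - (\<Sum>i\<in>J. c i * v i d) else v k d * c i)"
    have "(\<Sum>i\<in>I. c' i * v i j) = (\<Sum>i\<in>J. c i * w i j)" for j
    proof -
      have "(\<Sum>i\<in>I. c' i * v i j) = c' k * v k j + (\<Sum>i\<in>J. c' i * v i j)"
        unfolding J(3) using J by (simp add: sum.insert)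
      also have "(\<Sum>i\<in>J. c' i * v i j) = (\<Sum>i\<in>J. v k d * c i * v i j)"
        using J by (intro sum.cong) (auto simp: c'_def)
      also have "c' k * v k j = - (\<Sum>i\<in>J. c i * v i d * v k j)"
        by (simp add: c'_def sum_distrib_right)
      finally show ?thesis by (simp add: w_def sum_subtractf algebra_simps)
    qed
    moreover have "w i d = 0" for i by (simp add: w_def)
    ultimately have "\<forall>j<Suc d. (\<Sum>i\<in>I. c' i * v i j) = 0"
      using c(2) by (auto simp: less_Suc_eq)
    moreover obtain i where "i \<in> J" "c i \<noteq> 0" using c by blast
    then have "c' i \<noteq> 0" "i \<in> I" using J k by (auto simp: c'_def)
    ultimately show ?thesis by blast
  qed
qed

lemma eval_poly2_simps:
  "eval_poly2 0 X Y = 0" "eval_poly2 1 X Y = 1" "eval_poly2 (F + G) X Y = eval_poly2 F X Y + eval_poly2 G X Y"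
  "eval_poly2 (F - G) X Y = eval_poly2 F X Y - eval_poly2 G X Y" "eval_poly2 (- F) X Y = - eval_poly2 F X Y"
  "eval_poly2 (F * G) X Y = eval_poly2 F X Y * eval_poly2 G X Y" "eval_poly2 (F ^ n) X Y = eval_poly2 F X Y ^ n"
  "eval_poly2 (smult a F) X Y = poly a X * eval_poly2 F X Y" "eval_poly2 (pCons a F) X Y = poly a X + Y * eval_poly2 F X Y"
  "eval_poly2 (monom a n) X Y = poly a X * Y ^ n" "eval_poly2 (numeral k) X Y = numeral k"
  "eval_poly2 (sum f I) X Y = (\<Sum>i\<in>I. eval_poly2 (f i) X Y)"
  by (simp_all add: eval_poly2_def poly_monom poly_sum)

lemma eval_poly2_map_poly: "eval_poly2 F X Y = poly (map_poly (\<lambda>a. poly a X) F) Y"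
  by (induction F) (auto simp: eval_poly2_simps map_poly_pCons)

lemma holomorphic_on_eval_poly2:
  assumes "f holomorphic_on S" "g holomorphic_on S"
  shows "(\<lambda>z. eval_poly2 F (f z) (g z)) holomorphic_on S"
proof (induction F)
  case (pCons a F)
  have "(\<lambda>z. poly a (f z)) holomorphic_on S"
    by (induction a) (auto intro!: holomorphic_intros assms)
  with pCons show ?case by (auto simp: eval_poly2_simps intro!: holomorphic_intros assms)
qed (simp add: eval_poly2_simps)

lemma eval_poly2_deriv:
  assumes f: "(f has_field_derivative f') (at z)" and g: "(g has_field_derivative g') (at z)"
  shows "((\<lambda>z. eval_poly2 F (f z) (g z)) has_field_derivative
     eval_poly2 (map_poly pderiv F) (f z) (g z) * f' + eval_poly2 (pderiv F) (f z) (g z) * g') (at z)"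
proof (induction F)
  case 0
  then show ?case by (simp add: eval_poly2_simps)
next
  case (pCons a F)
  have a: "((\<lambda>z. poly a (f z)) has_field_derivative poly (pderiv a) (f z) * f') (at z)"
    by (rule DERIV_chain2[OF poly_DERIV f])
  have "map_poly pderiv (pCons a F) = pCons (pderiv a) (map_poly pderiv F)"
    by (simp add: map_poly_pCons)
  then show ?case unfolding eval_poly2_simps pderiv_pCons
    by - (rule DERIV_cong[OF DERIV_add[OF a DERIV_mult[OF g pCons(2)]]], simp add: eval_poly2_simps algebra_simps)
qed

text \<open>
  Let \<open>y = N / M\<close> be evaluated at a root \<open>q\<close> of \<open>F\<close>, and let \<open>d\<close> be the degree of \<open>F\<close>. Pseudo-division
  by \<open>F\<close> reduces the \<open>d + 1\<close> polynomials \<open>N\<^sup>i M\<^sup>d\<^sup>-\<^sup>i\<close>, which are \<open>y\<^sup>i M\<^sup>d\<close>, to degree below \<open>d\<close>. Hence they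
  are linearly dependent over the polynomials in \<open>x\<close>, and the dependency is an equation for \<open>y\<close>, the
  same at all points.
\<close>
theorem rational_function_algebraic:
  fixes F M N :: "complex poly poly"
  assumes F: "F \<noteq> 0"
  obtains H where "H \<noteq> 0"
    "\<And>X q y. eval_poly2 F X q = 0 \<Longrightarrow> eval_poly2 M X q \<noteq> 0 \<Longrightarrow> y * eval_poly2 M X q = eval_poly2 N X q \<Longrightarrow> eval_poly2 H X y = 0"
proof -
  define d where "d = degree F"
  define P where "P = (\<lambda>i. N ^ i * M ^ (d - i))"
  have "\<exists>l Q r. l \<noteq> 0 \<and> smult l (P i) = F * Q + r \<and> (r = 0 \<or> degree r < degree F)" for i
    using pseudo_mod(1)[OF F, of "P i"] pseudo_mod(2)[OF F, of "P i"] by metis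
  then obtain l Q r where l: "\<And>i. l i \<noteq> 0" and r: "\<And>i. smult (l i) (P i) = F * Q i + r i" "\<And>i. r i = 0 \<or> degree (r i) < degree F"
    by metis
  obtain c where c: "\<exists>i\<in>{..d}. c i \<noteq> 0" "\<forall>j<d. (\<Sum>i\<le>d. c i * coeff (r i) j) = 0"
    using linear_dependence_idom[of "{..d}" d "\<lambda>i. coeff (r i)"] by auto
  have rel: "(\<Sum>i\<le>d. smult (c i) (r i)) = 0"
  proof (rule poly_eqI)
    fix j
    have "coeff (r i) j = 0" if "\<not> j < d" for i
      using r(2)[of i] that by (auto simp: d_def intro: coeff_eq_0)
    then show "coeff (\<Sum>i\<le>d. smult (c i) (r i)) j = coeff 0 j"
      using c(2) by (cases "j < d") (auto simp: coeff_sum)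
  qed
  define H where "H = (\<Sum>i\<le>d. monom (c i * l i) i)"
  have "H \<noteq> 0"
  proof
    assume "H = 0"
    obtain i where i: "i \<le> d" "c i \<noteq> 0" using c by blast
    have "coeff H i = c i * l i" using i by (simp add: H_def coeff_sum coeff_monom if_distrib cong: if_cong)
    with i l[of i] \<open>H = 0\<close> show False by simp
  qed
  moreover have "eval_poly2 H X y = 0"
    if F0: "eval_poly2 F X q = 0" and M0: "eval_poly2 M X q \<noteq> 0" and y: "y * eval_poly2 M X q = eval_poly2 N X q" for X q y
  proof -
    have "eval_poly2 H X y * eval_poly2 M X q ^ d = (\<Sum>i\<le>d. poly (c i) X * (poly (l i) X * (y ^ i * eval_poly2 M X q ^ d)))"
      by (simp add: H_def eval_poly2_simps sum_distrib_right) (simp add: mult_ac)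
    also have "\<dots> = (\<Sum>i\<le>d. poly (c i) X * eval_poly2 (r i) X q)"
    proof (rule sum.cong)
      fix i assume "i \<in> {..d}"
      then have "y ^ i * eval_poly2 M X q ^ d = (y * eval_poly2 M X q) ^ i * eval_poly2 M X q ^ (d - i)"
        by (simp add: power_mult_distrib mult.assoc flip: power_add)
      also have "\<dots> = eval_poly2 (P i) X q" unfolding y by (simp add: P_def eval_poly2_simps)
      finally have "poly (l i) X * (y ^ i * eval_poly2 M X q ^ d) = eval_poly2 (smult (l i) (P i)) X q"
        by (simp add: eval_poly2_simps)
      then show "poly (c i) X * (poly (l i) X * (y ^ i * eval_poly2 M X q ^ d)) = poly (c i) X * eval_poly2 (r i) X q"
        unfolding r(1) by (simp add: eval_poly2_simps F0)
    qed simp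
    also have "\<dots> = eval_poly2 (\<Sum>i\<le>d. smult (c i) (r i)) X q" by (simp add: eval_poly2_simps)
    also have "\<dots> = 0" unfolding rel by (simp add: eval_poly2_simps)
    finally show ?thesis using M0 by simp
  qed
  ultimately show ?thesis by (rule that)
qed

lemma holomorphic_product_zero:
  assumes f: "f holomorphic_on S" and g: "g holomorphic_on S" and S: "open S" "connected S"
    and fg: "\<And>z. z \<in> S \<Longrightarrow> f z * g z = 0"
  shows "(\<forall>z\<in>S. f z = 0) \<or> (\<forall>z\<in>S. g z = 0)"
proof (rule disjCI)
  assume "\<not> (\<forall>z\<in>S. g z = 0)"
  then obtain w where w: "w \<in> S" "g w \<noteq> 0" by blast
  define U where "U = S \<inter> g -` (- {0})"
  have "open U" unfolding U_def
    by (intro continuous_open_preimage holomorphic_on_imp_continuous_on g S) auto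
  moreover have "w \<in> U" "U \<subseteq> S" using w by (auto simp: U_def)
  moreover have "f z = 0" if "z \<in> U" for z using fg[of z] that by (auto simp: U_def)
  ultimately have "f z = 0" if "z \<in> S" for z
    by (intro analytic_continuation_open[of U S f "\<lambda>_. 0" z]) (use f S that in auto)
  then show "\<forall>z\<in>S. f z = 0" by blast
qed

text \<open>
  A relation between two holomorphic functions that is minimal with respect to an additive degree is
  irreducible, because one of two factors of a relation is again a relation.
\<close>
lemma irreducible_relation:
  fixes F :: "complex poly poly"
  assumes fg: "f holomorphic_on S" "g holomorphic_on S" and S: "open S" "connected S" "S \<noteq> {}"
    and F: "F \<noteq> 0" "\<And>z. z \<in> S \<Longrightarrow> eval_poly2 F (f z) (g z) = 0"
  obtains G where "irreducible G" "\<And>z. z \<in> S \<Longrightarrow> eval_poly2 G (f z) (g z) = 0"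
proof -
  define vanish where "vanish = (\<lambda>F. \<forall>z\<in>S. eval_poly2 F (f z) (g z) = 0)"
  \<comment> \<open>The degree in \<open>y\<close> plus the degree in \<open>x\<close> of the leading coefficient is additive and vanishes only on constants.\<close>
  define \<mu> where "\<mu> = (\<lambda>F :: complex poly poly. degree F + degree (lead_coeff F))"
  have \<mu>: "\<mu> (A * B) = \<mu> A + \<mu> B" if "A \<noteq> 0" "B \<noteq> 0" for A B
  proof -
    have "degree (lead_coeff (A * B)) = degree (lead_coeff A) + degree (lead_coeff B)"
      unfolding lead_coeff_mult by (rule degree_mult_eq) (use that in auto)
    moreover have "degree (A * B) = degree A + degree B" by (rule degree_mult_eq) (use that in auto)
    ultimately show ?thesis by (simp add: \<mu>_def)
  qed
  have "F \<noteq> 0 \<and> vanish F" using F by (simp add: vanish_def)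
  from ex_has_least_nat[of "\<lambda>F. F \<noteq> 0 \<and> vanish F" F \<mu>, OF this]
  obtain G where G: "G \<noteq> 0" "vanish G" "\<And>K. K \<noteq> 0 \<Longrightarrow> vanish K \<Longrightarrow> \<mu> G \<le> \<mu> K" by blast
  have const: "K dvd 1" if "K \<noteq> 0" "\<mu> K = 0" for K
  proof -
    have "degree K = 0" "degree (lead_coeff K) = 0" using that(2) unfolding \<mu>_def add_is_0 by blast+
    then obtain a where a: "K = [:a:]" by (auto elim: degree_eq_zeroE)
    then have "degree a = 0" using \<open>degree (lead_coeff K) = 0\<close> by simp
    then obtain c where "a = [:c:]" by (auto elim: degree_eq_zeroE)
    with a have c: "K = [:[:c:]:]" by simp
    with that have "c \<noteq> 0" by auto
    then have "K * [:[:1 / c:]:] = 1" by (simp add: c one_pCons)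
    then show ?thesis by (metis dvd_triv_left)
  qed
  have "irreducible G"
  proof (rule irreducibleI)
    show "G \<noteq> 0" by fact
    show "\<not> G dvd 1"
    proof
      assume "G dvd 1"
      then obtain V where V: "1 = G * V" by (auto simp: dvd_def)
      obtain z where "z \<in> S" using S by blast
      have "eval_poly2 G (f z) (g z) * eval_poly2 V (f z) (g z) = 1"
        using arg_cong[OF V, of "\<lambda>F. eval_poly2 F (f z) (g z)"] by (simp add: eval_poly2_simps)
      then show False using \<open>z \<in> S\<close> G(2) by (simp add: vanish_def)
    qed
    fix A B assume AB: "G = A * B"
    have nz: "A \<noteq> 0" "B \<noteq> 0" using G(1) AB by auto
    have "vanish A \<or> vanish B" unfolding vanish_def
    proof (rule holomorphic_product_zero)
      show "eval_poly2 A (f z) (g z) * eval_poly2 B (f z) (g z) = 0" if "z \<in> S" for z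
        using G(2) that by (simp add: vanish_def AB eval_poly2_simps)
    qed (use S in \<open>auto intro: holomorphic_on_eval_poly2 fg\<close>)
    then have "\<mu> A = 0 \<or> \<mu> B = 0"
      using G(3)[OF nz(1)] G(3)[OF nz(2)] \<mu>[OF nz] AB by auto
    then show "A dvd 1 \<or> B dvd 1" using const nz by blast
  qed
  with G(2) that show ?thesis by (auto simp: vanish_def)
qed

section \<open>Multiplication on the Legendre curve\<close>

text \<open>
  Picard's function at an arbitrary point \<open>u\<close> of the elliptic curve: the first coordinate on the
  Legendre curve \<open>w\<^sup>2 = q (q - 1) (q - x)\<close>, with its pole at the origin.
\<close>
definition picard_q :: "complex \<Rightarrow> complex \<Rightarrow> complex" where
  "picard_q u \<tau> = - ((theta4 0 \<tau>)\<^sup>2 / (theta3 0 \<tau>)\<^sup>2) * (theta2 u \<tau> / theta1 u \<tau>)\<^sup>2"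

lemma hitchin_x_eq: "hitchin_x \<tau> = ((theta4 0 \<tau>)\<^sup>2 / (theta3 0 \<tau>)\<^sup>2)\<^sup>2"
  by (simp add: hitchin_x_def power_divide)

text \<open>
  The addition formulas for \<open>\<theta>\<^sub>1\<close> and \<open>\<theta>\<^sub>2\<close> divided by one another. Only \<open>x\<close> enters, so the first
  coordinate of \<open>a + b\<close> is obtained rationally from those of \<open>a\<close>, \<open>b\<close> and \<open>a - b\<close>.
\<close>
lemma picard_q_addition:
  assumes \<tau>: "Im \<tau> > 0" and nz: "theta1 a \<tau> \<noteq> 0" "theta1 b \<tau> \<noteq> 0" "theta1 (a + b) \<tau> \<noteq> 0" "theta1 (a - b) \<tau> \<noteq> 0"
  shows "picard_q (a + b) \<tau> * picard_q (a - b) \<tau> * (picard_q a \<tau> - picard_q b \<tau>)\<^sup>2 =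
    (picard_q a \<tau> * picard_q b \<tau> - hitchin_x \<tau>)\<^sup>2"
proof -
  define c where "c = (theta4 0 \<tau>)\<^sup>2 / (theta3 0 \<tau>)\<^sup>2"
  define S where "S = (\<lambda>u. (theta2 u \<tau>)\<^sup>2 / (theta1 u \<tau>)\<^sup>2)"
  define k where "k = (theta2 0 \<tau>)\<^sup>2"
  note cnz = theta_constants_nonzero[OF \<tau>]
  have k: "k \<noteq> 0" using cnz by (simp add: k_def)
  have q: "picard_q u \<tau> = - c * S u" for u by (simp add: picard_q_def c_def S_def power_divide)
  define p1 p2 where "p1 = theta1 (a + b) \<tau> * theta1 (a - b) \<tau>" and "p2 = theta2 (a + b) \<tau> * theta2 (a - b) \<tau>"
  define m where "m = (theta1 a \<tau>)\<^sup>2 * (theta1 b \<tau>)\<^sup>2"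
  have m: "m \<noteq> 0" and p1: "p1 \<noteq> 0" using nz by (auto simp: m_def p1_def)
  have 1: "k * p1 = m * (S b - S a)" and 2: "k * p2 = m * (S a * S b - 1)"
    unfolding k_def p1_def p2_def theta_addition[OF \<tau>] m_def S_def using nz by (simp_all add: field_simps)
  have 3: "S (a + b) * S (a - b) = (p2 / p1)\<^sup>2" by (simp add: S_def p1_def p2_def power_mult_distrib power_divide)
  have "(k * p1)\<^sup>2 * (S (a + b) * S (a - b)) = (k * p2)\<^sup>2"
    unfolding 3 using p1 by (simp add: power_mult_distrib power_divide)
  then have "m\<^sup>2 * ((S b - S a)\<^sup>2 * (S (a + b) * S (a - b))) = m\<^sup>2 * (S a * S b - 1)\<^sup>2"
    unfolding 1 2 by (simp add: power_mult_distrib mult_ac)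
  then have 4: "(S b - S a)\<^sup>2 * (S (a + b) * S (a - b)) = (S a * S b - 1)\<^sup>2" using m by simp
  have "picard_q (a + b) \<tau> * picard_q (a - b) \<tau> * (picard_q a \<tau> - picard_q b \<tau>)\<^sup>2 = c ^ 4 * ((S b - S a)\<^sup>2 * (S (a + b) * S (a - b)))"
    unfolding q by (simp add: power2_eq_square power4_eq_xxxx algebra_simps)
  also have "\<dots> = (picard_q a \<tau> * picard_q b \<tau> - hitchin_x \<tau>)\<^sup>2"
    unfolding 4 q hitchin_x_eq c_def[symmetric] by (simp add: power2_eq_square power4_eq_xxxx algebra_simps)
  finally show ?thesis .
qed

lemma picard_q_eq_iff_torsion:
  assumes \<tau>: "Im \<tau> > 0" and nz: "theta1 a \<tau> \<noteq> 0" "theta1 b \<tau> \<noteq> 0" and z: "theta1 (a + b) \<tau> = 0"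
  shows "picard_q a \<tau> = picard_q b \<tau>"
proof -
  have "(theta2 a \<tau>)\<^sup>2 / (theta1 a \<tau>)\<^sup>2 = (theta2 b \<tau>)\<^sup>2 / (theta1 b \<tau>)\<^sup>2"
    using theta_addition(1)[OF \<tau>, of a b] nz z by (simp add: field_simps)
  then show ?thesis by (simp add: picard_q_def power_divide)
qed

lemma picard_q_duplication:
  assumes \<tau>: "Im \<tau> > 0" and nz: "theta1 u \<tau> \<noteq> 0" "theta1 (2 * u) \<tau> \<noteq> 0"
  shows "picard_q (2 * u) \<tau> * (4 * picard_q u \<tau> * (picard_q u \<tau> - 1) * (picard_q u \<tau> - hitchin_x \<tau>)) =
    ((picard_q u \<tau>)\<^sup>2 - hitchin_x \<tau>)\<^sup>2"
proof -
  note cnz = theta_constants_nonzero[OF \<tau>]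
  define c2 c3 c4 where "c2 = theta2 0 \<tau>" "c3 = theta3 0 \<tau>" "c4 = theta4 0 \<tau>"
  note c = this[symmetric]
  define a1 a2 a3 a4 where "a1 = theta1 u \<tau>" "a2 = theta2 u \<tau>" "a3 = theta3 u \<tau>" "a4 = theta4 u \<tau>"
  note a = this[symmetric]
  define d1 d2 where "d1 = theta1 (2 * u) \<tau>" "d2 = theta2 (2 * u) \<tau>"
  note d = this[symmetric]
  have nz': "a1 \<noteq> 0" "d1 \<noteq> 0" "c2 \<noteq> 0" "c3 \<noteq> 0" "c4 \<noteq> 0" using nz cnz by (simp_all add: a c d)
  have dup1: "d1 * (c2 * c3 * c4) = 2 * (a1 * a2 * a3 * a4)" using theta1_duplication[OF \<tau>, of u] unfolding a c d .
  have dup2: "d2 * c2 ^ 3 = a2 ^ 4 - a1 ^ 4" using theta2_duplication[OF \<tau>, of u] unfolding a c d .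
  have sq: "c2\<^sup>2 * a3\<^sup>2 = c4\<^sup>2 * a1\<^sup>2 + c3\<^sup>2 * a2\<^sup>2" "c2\<^sup>2 * a4\<^sup>2 = c3\<^sup>2 * a1\<^sup>2 + c4\<^sup>2 * a2\<^sup>2"
    using theta_squares[OF \<tau>, of u] unfolding a c by auto
  have q: "picard_q u \<tau> = - (c4\<^sup>2 / c3\<^sup>2) * (a2 / a1)\<^sup>2" "picard_q (2 * u) \<tau> = - (c4\<^sup>2 / c3\<^sup>2) * (d2 / d1)\<^sup>2"
    by (simp_all add: picard_q_def a c d)
  have x: "hitchin_x \<tau> = (c4\<^sup>2 / c3\<^sup>2)\<^sup>2" by (simp add: hitchin_x_eq c)
  have q1: "picard_q u \<tau> - 1 = - (c2\<^sup>2 * a4\<^sup>2) / (c3\<^sup>2 * a1\<^sup>2)"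
    unfolding sq q using nz' by (simp add: field_simps)
  have qx: "picard_q u \<tau> - hitchin_x \<tau> = - c4\<^sup>2 * (c2\<^sup>2 * a3\<^sup>2) / (c3 ^ 4 * a1\<^sup>2)"
    unfolding sq q x using nz' by (simp add: field_simps power2_eq_square power4_eq_xxxx)
  have q2x: "(picard_q u \<tau>)\<^sup>2 - hitchin_x \<tau> = c4 ^ 4 * (d2 * c2 ^ 3) / (c3 ^ 4 * a1 ^ 4)"
    unfolding dup2 q x using nz' by (simp add: field_simps power2_eq_square power4_eq_xxxx)
  have "picard_q (2 * u) \<tau> * (4 * picard_q u \<tau> * (picard_q u \<tau> - 1) * (picard_q u \<tau> - hitchin_x \<tau>)) =
     (2 * (a1 * a2 * a3 * a4))\<^sup>2 * (c4 ^ 6 * c2 ^ 4 * d2\<^sup>2) / (d1\<^sup>2 * c3 ^ 10 * a1 ^ 8)"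
    unfolding q1 qx unfolding q using nz' by (simp add: divide_simps) (simp add: algebra_simps power2_eq_square power_numeral_reduce)
  also have "\<dots> = ((picard_q u \<tau>)\<^sup>2 - hitchin_x \<tau>)\<^sup>2"
    unfolding dup1[symmetric] q2x using nz' by (simp add: divide_simps) (simp add: algebra_simps power2_eq_square power_numeral_reduce)
  finally show ?thesis .
qed

text \<open>
  At the origin \<open>q\<close> has a double pole, and multiplication by \<open>j\<close> divides its leading coefficient by
  \<open>j\<^sup>2\<close>. This distinguishes \<open>q\<close> at \<open>j u\<close> from \<open>q\<close> at \<open>u\<close> and keeps all denominators of the
  multiplication formulas from vanishing identically.
\<close>
lemma picard_q_asymptotics:
  assumes \<tau>: "Im \<tau> > 0" and j: "j > 0"
  shows "eventually (\<lambda>u. theta1 (of_nat j * u) \<tau> \<noteq> 0) (at 0)"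
    "((\<lambda>u. picard_q (of_nat j * u) \<tau> * u\<^sup>2) \<longlongrightarrow> - (theta4 0 \<tau>)\<^sup>2 / ((theta3 0 \<tau>)\<^sup>2 * (of_nat j * (pi * theta3 0 \<tau> * theta4 0 \<tau>))\<^sup>2)) (at 0)"
proof -
  note cnz = theta_constants_nonzero[OF \<tau>]
  note d0 = stheta_deriv_z[OF \<tau>, of 0 0, unfolded stheta_0 One_nat_def[symmetric]]
  have "((\<lambda>u. theta1 (of_nat j * u) \<tau>) has_field_derivative stheta1 0 1 (of_nat j * 0) \<tau> * of_nat j) (at 0)"
    by (rule DERIV_chain2[OF d0(1)]) (use DERIV_cmult[OF DERIV_ident, of "of_nat j" 0] in simp)
  then have lim1: "((\<lambda>u. theta1 (of_nat j * u) \<tau> / u) \<longlongrightarrow> of_nat j * stheta1 0 1 0 \<tau>) (at 0)"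
    by (simp add: has_field_derivative_iff mult.commute)
  have s1: "of_nat j * stheta1 0 1 0 \<tau> \<noteq> 0" using jacobi_derivative_formula[OF \<tau>] cnz j by simp
  have "eventually (\<lambda>u. theta1 (of_nat j * u) \<tau> / u \<noteq> 0) (at 0)"
    by (rule tendsto_imp_eventually_ne[OF lim1 s1])
  then show ev: "eventually (\<lambda>u. theta1 (of_nat j * u) \<tau> \<noteq> 0) (at 0)" by eventually_elim auto
  have "((\<lambda>u. theta2 (of_nat j * u) \<tau>) has_field_derivative stheta2 0 1 (of_nat j * 0) \<tau> * of_nat j) (at 0)"
    by (rule DERIV_chain2[OF d0(2)]) (use DERIV_cmult[OF DERIV_ident, of "of_nat j" 0] in simp)
  then have "isCont (\<lambda>u. theta2 (of_nat j * u) \<tau>) 0" by (rule DERIV_isCont)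
  then have lim2: "((\<lambda>u. theta2 (of_nat j * u) \<tau>) \<longlongrightarrow> theta2 0 \<tau>) (at 0)" by (simp add: isCont_def)
  have "((\<lambda>u. - ((theta4 0 \<tau>)\<^sup>2 / (theta3 0 \<tau>)\<^sup>2) * (theta2 (of_nat j * u) \<tau> / (theta1 (of_nat j * u) \<tau> / u))\<^sup>2) \<longlongrightarrow>
      - ((theta4 0 \<tau>)\<^sup>2 / (theta3 0 \<tau>)\<^sup>2) * (theta2 0 \<tau> / (of_nat j * stheta1 0 1 0 \<tau>))\<^sup>2) (at 0)"
    by (intro tendsto_intros lim1 lim2 s1)
  also have "- ((theta4 0 \<tau>)\<^sup>2 / (theta3 0 \<tau>)\<^sup>2) * (theta2 0 \<tau> / (of_nat j * stheta1 0 1 0 \<tau>))\<^sup>2 =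
     - (theta4 0 \<tau>)\<^sup>2 / ((theta3 0 \<tau>)\<^sup>2 * (of_nat j * (pi * theta3 0 \<tau> * theta4 0 \<tau>))\<^sup>2)"
    unfolding jacobi_derivative_formula[OF \<tau>] using cnz j by (simp add: field_simps power2_eq_square)
  also have "(\<lambda>u. - ((theta4 0 \<tau>)\<^sup>2 / (theta3 0 \<tau>)\<^sup>2) * (theta2 (of_nat j * u) \<tau> / (theta1 (of_nat j * u) \<tau> / u))\<^sup>2) =
     (\<lambda>u. picard_q (of_nat j * u) \<tau> * u\<^sup>2)"
    by (simp add: picard_q_def power_divide power_mult_distrib fun_eq_iff)
  finally show "((\<lambda>u. picard_q (of_nat j * u) \<tau> * u\<^sup>2) \<longlongrightarrow> - (theta4 0 \<tau>)\<^sup>2 / ((theta3 0 \<tau>)\<^sup>2 * (of_nat j * (pi * theta3 0 \<tau> * theta4 0 \<tau>))\<^sup>2)) (at 0)" .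
qed

lemma picard_q_near_0:
  assumes \<tau>: "Im \<tau> > 0"
  shows "j > 0 \<Longrightarrow> eventually (\<lambda>u. picard_q (of_nat j * u) \<tau> \<noteq> 0) (at 0)"
    "j \<ge> 2 \<Longrightarrow> eventually (\<lambda>u. picard_q (of_nat j * u) \<tau> \<noteq> picard_q u \<tau>) (at 0)"
    "filterlim (\<lambda>u. picard_q u \<tau>) at_infinity (at 0)"
proof -
  note cnz = theta_constants_nonzero[OF \<tau>]
  define L where "L = (\<lambda>j::nat. - (theta4 0 \<tau>)\<^sup>2 / ((theta3 0 \<tau>)\<^sup>2 * (of_nat j * (pi * theta3 0 \<tau> * theta4 0 \<tau>))\<^sup>2))"
  have lim: "((\<lambda>u. picard_q (of_nat j * u) \<tau> * u\<^sup>2) \<longlongrightarrow> L j) (at 0)" if "j > 0" for j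
    unfolding L_def by (rule picard_q_asymptotics(2)[OF \<tau> that])
  have Lnz: "L j \<noteq> 0" if "j > 0" for j using cnz that by (simp add: L_def)
  have L1: "L j * (of_nat j)\<^sup>2 = L 1" if "j > 0" for j
    using cnz that by (simp add: L_def power_mult_distrib)
  show "eventually (\<lambda>u. picard_q (of_nat j * u) \<tau> \<noteq> 0) (at 0)" if "j > 0"
    using tendsto_imp_eventually_ne[OF lim Lnz, OF that that] by eventually_elim auto
  have lim1: "((\<lambda>u. picard_q u \<tau> * u\<^sup>2) \<longlongrightarrow> L 1) (at 0)" using lim[of 1] by simp
  show "eventually (\<lambda>u. picard_q (of_nat j * u) \<tau> \<noteq> picard_q u \<tau>) (at 0)" if "j \<ge> 2"
  proof -
    have "L j - L 1 \<noteq> 0"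
    proof
      assume "L j - L 1 = 0"
      then have "L j * ((of_nat j)\<^sup>2 - 1) = 0" using L1[of j] that by (simp add: algebra_simps)
      then have "(of_nat j :: complex)\<^sup>2 = 1" using Lnz[of j] that by simp
      then have "of_nat (j\<^sup>2) = (of_nat 1 :: complex)" by simp
      then have "j\<^sup>2 = 1" unfolding of_nat_eq_iff .
      with that show False by (simp add: power2_eq_square)
    qed
    moreover have "((\<lambda>u. picard_q (of_nat j * u) \<tau> * u\<^sup>2 - picard_q u \<tau> * u\<^sup>2) \<longlongrightarrow> L j - L 1) (at 0)"
      by (intro tendsto_diff lim lim1) (use that in auto)
    ultimately have "eventually (\<lambda>u. picard_q (of_nat j * u) \<tau> * u\<^sup>2 - picard_q u \<tau> * u\<^sup>2 \<noteq> 0) (at 0)"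
      by (intro tendsto_imp_eventually_ne)
    then show ?thesis by eventually_elim auto
  qed
  have "filterlim (\<lambda>u. (picard_q u \<tau> * u\<^sup>2) / u\<^sup>2) at_infinity (at 0)"
  proof (rule filterlim_divide_at_infinity[OF lim1])
    have "((\<lambda>u::complex. u\<^sup>2) \<longlongrightarrow> 0\<^sup>2) (at 0)" by (intro tendsto_intros)
    then show "filterlim (\<lambda>u::complex. u\<^sup>2) (at 0) (at 0)"
      by (auto simp: filterlim_at eventually_at_filter)
    show "L 1 \<noteq> 0" by (rule Lnz) simp
  qed
  then show "filterlim (\<lambda>u. picard_q u \<tau>) at_infinity (at 0)"
  proof (rule filterlim_mono_eventually[OF _ order_refl order_refl])
    show "eventually (\<lambda>u. picard_q u \<tau> * u\<^sup>2 / u\<^sup>2 = picard_q u \<tau>) (at 0)"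
      by (auto simp: eventually_at_filter)
  qed
qed

text \<open>
  The pair \<open>(x, q)\<close> is algebraically independent when \<open>\<tau>\<close> and \<open>u\<close> vary: choose \<open>\<tau>\<close> off the roots of the
  leading coefficient and then \<open>u\<close> near the pole of \<open>q\<close>.
\<close>
lemma picard_q_generic:
  assumes F: "F \<noteq> 0" and inf: "infinite (hitchin_x ` upper_half_plane)"
  obtains \<tau> where "Im \<tau> > 0" "eventually (\<lambda>u. eval_poly2 F (hitchin_x \<tau>) (picard_q u \<tau>) \<noteq> 0) (at 0)"
proof -
  have "finite {X. poly (lead_coeff F) X = 0}" by (rule poly_roots_finite) (use F in auto)
  then have "\<not> hitchin_x ` upper_half_plane \<subseteq> {X. poly (lead_coeff F) X = 0}" using inf finite_subset by blast
  then obtain \<tau> where \<tau>: "\<tau> \<in> upper_half_plane" "poly (lead_coeff F) (hitchin_x \<tau>) \<noteq> 0" by auto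
  define f where "f = map_poly (\<lambda>a. poly a (hitchin_x \<tau>)) F"
  have "coeff f (degree F) \<noteq> 0" using \<tau> by (simp add: f_def coeff_map_poly)
  then have "f \<noteq> 0" by auto
  then have fin: "finite {Y. poly f Y = 0}" by (rule poly_roots_finite)
  have Im: "Im \<tau> > 0" using \<tau> by (simp add: upper_half_plane_simps)
  obtain b where b: "\<And>Y. poly f Y = 0 \<Longrightarrow> norm Y \<le> b"
    using finite_imp_bounded[OF fin] unfolding bounded_iff by auto
  have "eventually (\<lambda>u. norm (picard_q u \<tau>) \<ge> \<bar>b\<bar> + 1) (at 0)"
    using picard_q_near_0(3)[OF Im, unfolded filterlim_at_infinity[OF order_refl], rule_format, of "\<bar>b\<bar> + 1"]
    by simp
  then have "eventually (\<lambda>u. eval_poly2 F (hitchin_x \<tau>) (picard_q u \<tau>) \<noteq> 0) (at 0)"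
  proof eventually_elim
    case (elim u)
    then show ?case unfolding eval_poly2_map_poly f_def[symmetric] using b[of "picard_q u \<tau>"] by auto
  qed
  with Im show ?thesis by (rule that)
qed

text \<open>
  The fraction \<open>A / B\<close> is the first coordinate of multiplication by \<open>j\<close>. Excluding the poles of all
  multiples up to \<open>j\<close>, and not only of the last one, is what the recursion needs.
\<close>
definition is_multiplication_pair :: "nat \<Rightarrow> complex poly poly \<Rightarrow> complex poly poly \<Rightarrow> bool" where
  "is_multiplication_pair j A B \<longleftrightarrow> A \<noteq> 0 \<and> B \<noteq> 0 \<and>
     (\<forall>\<tau> u. Im \<tau> > 0 \<longrightarrow> (\<forall>i\<in>{1..j}. theta1 (of_nat i * u) \<tau> \<noteq> 0) \<longrightarrow>
        eval_poly2 B (hitchin_x \<tau>) (picard_q u \<tau>) * picard_q (of_nat j * u) \<tau> = eval_poly2 A (hitchin_x \<tau>) (picard_q u \<tau>))"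

lemma theta1_multiples_near_0:
  assumes "Im \<tau> > 0"
  shows "eventually (\<lambda>u. \<forall>i\<in>{1..j}. theta1 (of_nat i * u) \<tau> \<noteq> 0) (at 0)"
  using picard_q_asymptotics(1)[OF assms] by (intro eventually_ball_finite) auto

lemma multiplication_pair_difference_nonzero:
  assumes inf: "infinite (hitchin_x ` upper_half_plane)"
    and AB: "is_multiplication_pair j A B" and j: "j \<ge> 2"
  shows "A - B * [:0, 1:] \<noteq> 0"
proof
  assume 0: "A - B * [:0, 1:] = 0"
  have B: "B \<noteq> 0" using AB by (simp add: is_multiplication_pair_def)
  obtain \<tau> where \<tau>: "Im \<tau> > 0" "eventually (\<lambda>u. eval_poly2 B (hitchin_x \<tau>) (picard_q u \<tau>) \<noteq> 0) (at 0)"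
    by (rule picard_q_generic[OF B inf])
  have "eventually (\<lambda>u::complex. False) (at 0)"
    using \<tau>(2) theta1_multiples_near_0[OF \<tau>(1), of j] picard_q_near_0(2)[OF \<tau>(1) j]
  proof eventually_elim
    case (elim u)
    have "eval_poly2 B (hitchin_x \<tau>) (picard_q u \<tau>) * picard_q (of_nat j * u) \<tau> = eval_poly2 A (hitchin_x \<tau>) (picard_q u \<tau>)"
      using AB \<tau>(1) elim(2) unfolding is_multiplication_pair_def by blast
    also have "\<dots> = eval_poly2 B (hitchin_x \<tau>) (picard_q u \<tau>) * picard_q u \<tau>"
      using arg_cong[OF 0, of "\<lambda>F. eval_poly2 F (hitchin_x \<tau>) (picard_q u \<tau>)"] by (simp add: eval_poly2_simps)
    finally show False using elim(1,3) by simp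
  qed
  then show False by simp
qed

lemma is_multiplication_pairI:
  assumes inf: "infinite (hitchin_x ` upper_half_plane)"
    and B: "B \<noteq> 0" and j: "j > 0"
    and eq: "\<And>\<tau> u. Im \<tau> > 0 \<Longrightarrow> (\<And>i. i \<in> {1..j} \<Longrightarrow> theta1 (of_nat i * u) \<tau> \<noteq> 0) \<Longrightarrow>
        eval_poly2 B (hitchin_x \<tau>) (picard_q u \<tau>) * picard_q (of_nat j * u) \<tau> = eval_poly2 A (hitchin_x \<tau>) (picard_q u \<tau>)"
  shows "is_multiplication_pair j A B"
  unfolding is_multiplication_pair_def
proof (intro conjI allI impI)
  show "A \<noteq> 0"
  proof
    assume A: "A = 0"
    obtain \<tau> where \<tau>: "Im \<tau> > 0" "eventually (\<lambda>u. eval_poly2 B (hitchin_x \<tau>) (picard_q u \<tau>) \<noteq> 0) (at 0)"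
      by (rule picard_q_generic[OF B inf])
    have "eventually (\<lambda>u::complex. False) (at 0)"
      using \<tau>(2) theta1_multiples_near_0[OF \<tau>(1), of j] picard_q_near_0(1)[OF \<tau>(1) j]
    proof eventually_elim
      case (elim u)
      then show False using eq[OF \<tau>(1), of u] A by (auto simp: eval_poly2_simps)
    qed
    then show False by simp
  qed
qed (use B eq in auto)

text \<open>
  From the fractions for \<open>j\<close> and \<open>j + 1\<close> the addition formula yields the one for \<open>j + 2\<close>; its
  denominator is nonzero because \<open>q\<close> at \<open>(j + 1) u\<close> differs from \<open>q\<close> at \<open>u\<close>.
\<close>
theorem multiplication_pair_exists:
  assumes inf: "infinite (hitchin_x ` upper_half_plane)" and j: "j \<ge> 1"
  shows "\<exists>A B. is_multiplication_pair j A B"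
proof -
  define S where "S = [:0, 1 :: complex poly:]"
  define X where "X = [:[:0, 1 :: complex:]:]"
  have SX: "eval_poly2 S \<xi> q = q" "eval_poly2 X \<xi> q = \<xi>" for \<xi> q
    by (simp_all add: S_def X_def eval_poly2_simps)
  have one: "is_multiplication_pair 1 S 1"
    by (rule is_multiplication_pairI[OF inf]) (auto simp: SX eval_poly2_simps)
  have two: "is_multiplication_pair 2 ((S\<^sup>2 - X)\<^sup>2) (4 * S * (S - 1) * (S - X))"
  proof (rule is_multiplication_pairI[OF inf])
    have "S - 1 \<noteq> 0" "S - X \<noteq> 0" "S \<noteq> 0" by (simp_all add: S_def X_def one_pCons)
    moreover have "(4 :: complex poly poly) \<noteq> 0" by simp
    ultimately show "4 * S * (S - 1) * (S - X) \<noteq> 0" by (simp only: mult_eq_0_iff) simp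
    fix \<tau> u assume \<tau>: "Im \<tau> > 0" and nz: "\<And>i. i \<in> {1..2} \<Longrightarrow> theta1 (of_nat i * u) \<tau> \<noteq> 0"
    show "eval_poly2 (4 * S * (S - 1) * (S - X)) (hitchin_x \<tau>) (picard_q u \<tau>) * picard_q (of_nat 2 * u) \<tau> =
        eval_poly2 ((S\<^sup>2 - X)\<^sup>2) (hitchin_x \<tau>) (picard_q u \<tau>)"
      using picard_q_duplication[OF \<tau>, of u] nz[of 1] nz[of 2] by (simp add: SX eval_poly2_simps mult_ac)
  qed simp
  have "(\<exists>A B. is_multiplication_pair j A B) \<and> (\<exists>A B. is_multiplication_pair (Suc j) A B)" if "j \<ge> 1" for j
    using that
  proof (induction j rule: nat_induct_at_least)
    case base
    then show ?case using one two by (auto simp: numeral_2_eq_2)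
  next
    case (Suc j)
    then obtain A0 B0 A B where 0: "is_multiplication_pair j A0 B0" and 1: "is_multiplication_pair (Suc j) A B" by blast
    have "is_multiplication_pair (Suc (Suc j)) ((A * S - X * B)\<^sup>2 * B0) ((A - B * S)\<^sup>2 * A0)"
    proof (rule is_multiplication_pairI[OF inf])
      have "A - B * S \<noteq> 0" unfolding S_def by (rule multiplication_pair_difference_nonzero[OF inf 1]) (use Suc in auto)
      then show "(A - B * S)\<^sup>2 * A0 \<noteq> 0" using 0 by (simp add: is_multiplication_pair_def)
      fix \<tau> u assume \<tau>: "Im \<tau> > 0" and nz: "\<And>i. i \<in> {1..Suc (Suc j)} \<Longrightarrow> theta1 (of_nat i * u) \<tau> \<noteq> 0"
      define q0 q1 q2 q where "q0 = picard_q (of_nat j * u) \<tau>" "q1 = picard_q (of_nat (Suc j) * u) \<tau>"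
        "q2 = picard_q (of_nat (Suc (Suc j)) * u) \<tau>" "q = picard_q u \<tau>"
      note q_defs = this
      define \<xi> where "\<xi> = hitchin_x \<tau>"
      have e0: "eval_poly2 B0 \<xi> q * q0 = eval_poly2 A0 \<xi> q"
        using 0 \<tau> nz unfolding is_multiplication_pair_def \<xi>_def q_defs by auto
      have e1: "eval_poly2 B \<xi> q * q1 = eval_poly2 A \<xi> q"
        using 1 \<tau> nz unfolding is_multiplication_pair_def \<xi>_def q_defs by auto
      have s: "of_nat (Suc j) * u + u = of_nat (Suc (Suc j)) * u" "of_nat (Suc j) * u - u = of_nat j * u"
        by (simp_all add: algebra_simps)
      have "q2 * q0 * (q1 - q)\<^sup>2 = (q1 * q - \<xi>)\<^sup>2"
        using picard_q_addition[OF \<tau>, of "of_nat (Suc j) * u" u] nz[of 1] nz[of j] nz[of "Suc j"] nz[of "Suc (Suc j)"] Suc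
        unfolding s q_defs \<xi>_def by simp
      then have "(eval_poly2 B \<xi> q)\<^sup>2 * eval_poly2 B0 \<xi> q * (q2 * q0 * (q1 - q)\<^sup>2) = (eval_poly2 B \<xi> q)\<^sup>2 * eval_poly2 B0 \<xi> q * (q1 * q - \<xi>)\<^sup>2"
        by simp
      then have "(eval_poly2 A \<xi> q - eval_poly2 B \<xi> q * q)\<^sup>2 * eval_poly2 A0 \<xi> q * q2 = (eval_poly2 A \<xi> q * q - \<xi> * eval_poly2 B \<xi> q)\<^sup>2 * eval_poly2 B0 \<xi> q"
        unfolding e0[symmetric] e1[symmetric] by (simp add: power2_eq_square algebra_simps)
      then show "eval_poly2 ((A - B * S)\<^sup>2 * A0) (hitchin_x \<tau>) (picard_q u \<tau>) * picard_q (of_nat (Suc (Suc j)) * u) \<tau> =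
          eval_poly2 ((A * S - X * B)\<^sup>2 * B0) (hitchin_x \<tau>) (picard_q u \<tau>)"
        by (simp add: SX eval_poly2_simps q_defs \<xi>_def)
    qed simp
    with 1 show ?case by blast
  qed
  with j show ?thesis by blast
qed

text \<open>
  If \<open>n z\<close> is a lattice point, then \<open>(n - 1) z\<close> is \<open>- z\<close> up to the lattice, and \<open>q\<close> is even. The
  resulting equation between \<open>q\<close> at \<open>(n - 1) z\<close> and \<open>q\<close> at \<open>z\<close> is not trivial as soon as \<open>n - 1 \<ge> 2\<close>.
  The same \<open>F\<close> serves for all \<open>\<tau>\<close>.
\<close>
theorem picard_q_torsion_algebraic:
  assumes inf: "infinite (hitchin_x ` upper_half_plane)" and n: "n \<ge> 3"
  obtains F where "F \<noteq> 0"
    "\<And>\<tau> z. Im \<tau> > 0 \<Longrightarrow> theta1 (of_nat n * z) \<tau> = 0 \<Longrightarrow> (\<And>i. i \<in> {1..<n} \<Longrightarrow> theta1 (of_nat i * z) \<tau> \<noteq> 0) \<Longrightarrow>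
       eval_poly2 F (hitchin_x \<tau>) (picard_q z \<tau>) = 0"
proof -
  obtain A B where AB: "is_multiplication_pair (n - 1) A B"
    using multiplication_pair_exists[OF inf, of "n - 1"] n by fastforce
  have "A - B * [:0, 1:] \<noteq> 0" by (rule multiplication_pair_difference_nonzero[OF inf AB]) (use n in auto)
  moreover have "eval_poly2 (A - B * [:0, 1:]) (hitchin_x \<tau>) (picard_q z \<tau>) = 0"
    if \<tau>: "Im \<tau> > 0" and 0: "theta1 (of_nat n * z) \<tau> = 0" and nz: "\<And>i. i \<in> {1..<n} \<Longrightarrow> theta1 (of_nat i * z) \<tau> \<noteq> 0" for \<tau> z
  proof -
    have s: "of_nat (n - 1) * z + z = of_nat n * z" using n by (simp add: of_nat_diff algebra_simps)
    have "picard_q (of_nat (n - 1) * z) \<tau> = picard_q z \<tau>"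
    proof (rule picard_q_eq_iff_torsion[OF \<tau>])
      show "theta1 (of_nat (n - 1) * z) \<tau> \<noteq> 0" by (rule nz) (use n in auto)
      show "theta1 z \<tau> \<noteq> 0" using nz[of 1] n by simp
      show "theta1 (of_nat (n - 1) * z + z) \<tau> = 0" unfolding s by fact
    qed
    moreover have "eval_poly2 B (hitchin_x \<tau>) (picard_q z \<tau>) * picard_q (of_nat (n - 1) * z) \<tau> = eval_poly2 A (hitchin_x \<tau>) (picard_q z \<tau>)"
    proof -
      have "\<forall>i\<in>{1..n - 1}. theta1 (of_nat i * z) \<tau> \<noteq> 0" using nz n by auto
      with AB \<tau> show ?thesis unfolding is_multiplication_pair_def by blast
    qed
    ultimately show ?thesis by (simp add: eval_poly2_simps mult.commute)
  qed
  ultimately show ?thesis by (rule that)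
qed

context shifted_point
begin

lemma hitchin_x_eq_x: "hitchin_x \<tau> = x \<tau>"
  by (simp add: hitchin_x_eq x_def t_def)

lemma infinite_x: "infinite (hitchin_x ` upper_half_plane)"
proof
  assume fin: "finite (hitchin_x ` upper_half_plane)"
  have "deriv x \<i> = \<omega> \<i> * (x \<i> * (x \<i> - 1))" by (rule DERIV_imp_deriv[OF x_deriv]) simp
  then have "deriv x \<i> \<noteq> 0" using \<omega>_nonzero[of \<i>] x_nonzero[of \<i>] by simp
  then obtain r where r: "r > 0" "ball \<i> r \<subseteq> upper_half_plane" "inj_on x (ball \<i> r)"
    using has_complex_derivative_locally_injective[OF x_holomorphic, of \<i>] by (auto simp: upper_half_plane_simps)
  have "finite (x ` ball \<i> r)"
    by (rule finite_subset[OF _ fin]) (use r(2) in \<open>auto simp: hitchin_x_eq_x\<close>)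
  then have "finite (ball \<i> r)" using r(3) finite_imageD by blast
  then show False using uncountable_ball[OF r(1), of "\<i>"] countable_finite by blast
qed

lemma q_picard: "q \<tau> = picard_q (of_real B + of_real A * \<tau>) \<tau>"
  by (simp add: q_def t_def s_def picard_q_def f1_def f2_def stheta_eq shift_factor_def)

lemma q_special: "Im \<tau> > 0 \<Longrightarrow> q \<tau> \<noteq> 0" "Im \<tau> > 0 \<Longrightarrow> q \<tau> \<noteq> 1" "Im \<tau> > 0 \<Longrightarrow> q \<tau> \<noteq> x \<tau>"
proof -
  assume \<tau>: "Im \<tau> > 0"
  have "q \<tau> * (q \<tau> - 1) * (q \<tau> - x \<tau>) = - (t \<tau>)\<^sup>2 * (s \<tau> * (t \<tau> + s \<tau>) * (1 + t \<tau> * s \<tau>))"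
    by (simp add: q_def x_def power2_eq_square algebra_simps)
  then have "q \<tau> * (q \<tau> - 1) * (q \<tau> - x \<tau>) \<noteq> 0"
    unfolding v_square[OF \<tau>, symmetric] using v_nonzero[OF \<tau>] t_nonzero(1)[OF \<tau>] by simp
  then show "q \<tau> \<noteq> 0" "q \<tau> \<noteq> 1" "q \<tau> \<noteq> x \<tau>" by auto
qed

text \<open>
  Take a relation \<open>R\<close> of least degree in \<open>q\<close>; then \<open>\<partial>R/\<partial>q\<close> does not vanish identically. Differentiating
  \<open>R (x, q) = 0\<close> and inserting the Picard system shows that the momentum is rational in \<open>(x, q)\<close>, so \<open>y\<close>
  is the quotient \<open>N / M\<close> of two polynomials in \<open>(x, q)\<close>. The equation for \<open>y\<close> extends from the points
  with \<open>M \<noteq> 0\<close> to the connected set of all points with \<open>p \<noteq> 0\<close>, on which \<open>y\<close> is holomorphic.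
\<close>
lemma y_algebraic:
  assumes F: "F \<noteq> 0" "\<And>\<tau>. Im \<tau> > 0 \<Longrightarrow> eval_poly2 F (x \<tau>) (q \<tau>) = 0"
  obtains G where "irreducible G" "\<And>\<tau>. Im \<tau> > 0 \<Longrightarrow> p \<tau> \<noteq> 0 \<Longrightarrow> eval_poly2 G (x \<tau>) (y \<tau>) = 0"
proof -
  note H = upper_half_plane_simps
  define rel where "rel = (\<lambda>F. F \<noteq> 0 \<and> (\<forall>\<tau>\<in>upper_half_plane. eval_poly2 F (x \<tau>) (q \<tau>) = 0))"
  have "rel F" using F by (auto simp: rel_def H)
  from ex_has_least_nat[of rel F degree, OF this]
  obtain R where R: "rel R" "\<And>K. rel K \<Longrightarrow> degree R \<le> degree K" by blast
  have "degree R > 0"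
  proof (rule ccontr)
    assume "\<not> degree R > 0"
    then obtain l where l: "R = [:l:]" by (auto elim: degree_eq_zeroE)
    with R(1) have "l \<noteq> 0" "hitchin_x ` upper_half_plane \<subseteq> {X. poly l X = 0}"
      by (auto simp: rel_def eval_poly2_simps hitchin_x_eq_x)
    then show False using infinite_x poly_roots_finite[of l] finite_subset by blast
  qed
  then have dR: "pderiv R \<noteq> 0" "degree (pderiv R) < degree R"
    by (simp_all add: pderiv_eq_0_iff degree_pderiv)
  then have "\<not> rel (pderiv R)" using R(2)[of "pderiv R"] by auto
  with dR obtain \<tau>1 where \<tau>1: "\<tau>1 \<in> upper_half_plane" "eval_poly2 (pderiv R) (x \<tau>1) (q \<tau>1) \<noteq> 0" by (auto simp: rel_def)
  define Rx Ry where "Rx = (\<lambda>\<tau>. eval_poly2 (map_poly pderiv R) (x \<tau>) (q \<tau>))" and "Ry = (\<lambda>\<tau>. eval_poly2 (pderiv R) (x \<tau>) (q \<tau>))"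
  have hol: "Ry holomorphic_on upper_half_plane" unfolding Ry_def by (intro holomorphic_on_eval_poly2 x_holomorphic q_holomorphic)
  have chain: "x \<tau> * (x \<tau> - 1) * Rx \<tau> + Ry \<tau> * (q \<tau> * (q \<tau> - 1)) = - Ry \<tau> * (2 * q \<tau> * (q \<tau> - 1) * (q \<tau> - x \<tau>) * p \<tau>)"
    if \<tau>: "Im \<tau> > 0" for \<tau>
  proof -
    have "((\<lambda>\<tau>. eval_poly2 R (x \<tau>) (q \<tau>)) has_field_derivative Rx \<tau> * (\<omega> \<tau> * (x \<tau> * (x \<tau> - 1))) +
        Ry \<tau> * (\<omega> \<tau> * (2 * q \<tau> * (q \<tau> - 1) * (q \<tau> - x \<tau>) * p \<tau> + q \<tau> * (q \<tau> - 1)))) (at \<tau>)"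
      unfolding Rx_def Ry_def by (rule eval_poly2_deriv[OF x_deriv[OF \<tau>] q_deriv[OF \<tau>]])
    moreover have "((\<lambda>\<tau>. eval_poly2 R (x \<tau>) (q \<tau>)) has_field_derivative 0) (at \<tau>)"
      by (rule has_field_derivative_transform_within_open[of "\<lambda>_. 0" _ _ upper_half_plane])
         (use R(1) \<tau> in \<open>auto simp: rel_def H\<close>)
    ultimately have "Rx \<tau> * (\<omega> \<tau> * (x \<tau> * (x \<tau> - 1))) +
        Ry \<tau> * (\<omega> \<tau> * (2 * q \<tau> * (q \<tau> - 1) * (q \<tau> - x \<tau>) * p \<tau> + q \<tau> * (q \<tau> - 1))) = 0" by (rule DERIV_unique)
    then have "\<omega> \<tau> * (x \<tau> * (x \<tau> - 1) * Rx \<tau> + Ry \<tau> * (q \<tau> * (q \<tau> - 1)) + Ry \<tau> * (2 * q \<tau> * (q \<tau> - 1) * (q \<tau> - x \<tau>) * p \<tau>)) = 0"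
      by (simp add: algebra_simps)
    then have "x \<tau> * (x \<tau> - 1) * Rx \<tau> + Ry \<tau> * (q \<tau> * (q \<tau> - 1)) + Ry \<tau> * (2 * q \<tau> * (q \<tau> - 1) * (q \<tau> - x \<tau>) * p \<tau>) = 0"
      using \<omega>_nonzero[OF \<tau>] by simp
    then show ?thesis by (simp add: add_eq_0_iff)
  qed
  define S where "S = [:0, 1 :: complex poly:]"
  define X where "X = [:[:0, 1 :: complex:]:]"
  have SX: "eval_poly2 S \<xi> q = q" "eval_poly2 X \<xi> q = \<xi>" for \<xi> q
    by (simp_all add: S_def X_def eval_poly2_simps)
  \<comment> \<open>On the curve \<open>M\<close> is the product of \<open>\<partial>R/\<partial>q\<close> and \<open>2 q (q - 1) (q - x) p\<close>.\<close>
  define M where "M = - (X * (X - 1) * map_poly pderiv R + pderiv R * (S * (S - 1)))"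
  define N where "N = S * M + pderiv R * (S * (S - 1) * (S - X))"
  have R0: "R \<noteq> 0" using R(1) by (simp add: rel_def)
  obtain G where G: "G \<noteq> 0" "\<And>X q y. eval_poly2 R X q = 0 \<Longrightarrow> eval_poly2 M X q \<noteq> 0 \<Longrightarrow> y * eval_poly2 M X q = eval_poly2 N X q \<Longrightarrow> eval_poly2 G X y = 0"
    using rational_function_algebraic[OF R0, of M N] by blast
  have M: "eval_poly2 M (x \<tau>) (q \<tau>) = Ry \<tau> * (2 * q \<tau> * (q \<tau> - 1) * (q \<tau> - x \<tau>) * p \<tau>)" if "Im \<tau> > 0" for \<tau>
  proof -
    have "eval_poly2 M (x \<tau>) (q \<tau>) = - (x \<tau> * (x \<tau> - 1) * Rx \<tau> + Ry \<tau> * (q \<tau> * (q \<tau> - 1)))"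
      by (simp add: M_def eval_poly2_simps SX Rx_def Ry_def)
    then show ?thesis unfolding chain[OF that] by simp
  qed
  have Gy: "eval_poly2 G (x \<tau>) (y \<tau>) = 0" if \<tau>: "Im \<tau> > 0" "p \<tau> \<noteq> 0" "Ry \<tau> \<noteq> 0" for \<tau>
  proof (rule G(2))
    show "eval_poly2 R (x \<tau>) (q \<tau>) = 0" using R(1) \<tau> by (simp add: rel_def H)
    show "eval_poly2 M (x \<tau>) (q \<tau>) \<noteq> 0" unfolding M[OF \<tau>(1)] using \<tau> q_special[OF \<tau>(1)] by simp
    have "eval_poly2 N (x \<tau>) (q \<tau>) = q \<tau> * eval_poly2 M (x \<tau>) (q \<tau>) + Ry \<tau> * (q \<tau> * (q \<tau> - 1) * (q \<tau> - x \<tau>))"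
      by (simp add: N_def eval_poly2_simps SX Ry_def)
    also have "\<dots> = y \<tau> * eval_poly2 M (x \<tau>) (q \<tau>)" unfolding M[OF \<tau>(1)] y_def using \<tau>(2) by (simp add: field_simps)
    finally show "y \<tau> * eval_poly2 M (x \<tau>) (q \<tau>) = eval_poly2 N (x \<tau>) (q \<tau>)" ..
  qed
  define D where "D = upper_half_plane - {\<tau> \<in> upper_half_plane. p \<tau> = 0}"
  have D: "\<tau> \<in> D \<longleftrightarrow> Im \<tau> > 0 \<and> p \<tau> \<noteq> 0" for \<tau> by (auto simp: D_def H)
  have oD: "open D" unfolding D_def by (rule open_diff_sparse_pts[OF H(1) p_zeros_sparse])
  have cD: "connected D" unfolding D_def by (rule sparse_imp_connected[OF _ H(2,1) p_zeros_sparse]) simp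
  have DH: "D \<subseteq> upper_half_plane" by (auto simp: D_def)
  have holD: "x holomorphic_on D" "y holomorphic_on D" "Ry holomorphic_on D"
    unfolding y_def[abs_def] using holomorphic_on_subset[OF x_holomorphic DH] holomorphic_on_subset[OF q_holomorphic DH]
      holomorphic_on_subset[OF p_holomorphic DH] holomorphic_on_subset[OF hol DH] D
    by (auto intro!: holomorphic_intros)
  have "\<exists>\<tau>\<in>D. Ry \<tau> \<noteq> 0"
  proof (rule ccontr)
    assume "\<not> ?thesis"
    then have "p \<tau> * Ry \<tau> = 0" if "\<tau> \<in> upper_half_plane" for \<tau> using that by (auto simp: D_def)
    from holomorphic_product_zero[OF p_holomorphic hol H(1,2) this]
    have "(\<forall>\<tau>\<in>upper_half_plane. p \<tau> = 0) \<or> (\<forall>\<tau>\<in>upper_half_plane. Ry \<tau> = 0)" by blast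
    moreover have "\<not> (\<forall>\<tau>\<in>upper_half_plane. Ry \<tau> = 0)" using \<tau>1 by (auto simp: Ry_def)
    moreover have "\<not> (\<forall>\<tau>\<in>upper_half_plane. p \<tau> = 0)"
    proof
      assume "\<forall>\<tau>\<in>upper_half_plane. p \<tau> = 0"
      then have "{\<tau> \<in> upper_half_plane. p \<tau> = 0} = upper_half_plane" by auto
      with p_zeros_sparse have "upper_half_plane sparse_in upper_half_plane" by simp
      then have "\<not> \<i> islimpt upper_half_plane" unfolding sparse_in_open[OF H(1)] by (simp add: H)
      moreover have "\<i> islimpt upper_half_plane" by (rule interior_limit_point) (simp add: interior_open[OF H(1)] H)
      ultimately show False by simp
    qed
    ultimately show False by blast
  qed
  then obtain \<tau>2 where \<tau>2: "\<tau>2 \<in> D" "Ry \<tau>2 \<noteq> 0" by blast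
  have "eval_poly2 G (x \<tau>) (y \<tau>) * Ry \<tau> = 0" if "\<tau> \<in> D" for \<tau>
    using Gy[of \<tau>] that D by auto
  from holomorphic_product_zero[OF holomorphic_on_eval_poly2[OF holD(1,2)] holD(3) oD cD this]
  have "eval_poly2 G (x \<tau>) (y \<tau>) = 0" if "\<tau> \<in> D" for \<tau> using \<tau>2 that by blast
  from irreducible_relation[OF holD(1,2) oD cD _ G(1) this]
  obtain K where "irreducible K" "\<And>\<tau>. \<tau> \<in> D \<Longrightarrow> eval_poly2 K (x \<tau>) (y \<tau>) = 0" using \<tau>2 by blast
  then show ?thesis using D by (intro that) auto
qed

end

section \<open>Torsion sections and the main result\<close>

lemma theta1_lattice: "theta1 (of_int m + of_int n * \<tau>) \<tau> = 0"
proof -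
  have step: "theta1 (z + 1) \<tau> = 0 \<longleftrightarrow> theta1 z \<tau> = 0" "theta1 (z + \<tau>) \<tau> = 0 \<longleftrightarrow> theta1 z \<tau> = 0" for z
    by (simp_all add: theta1_quasiperiods)
  have "theta1 (of_int m) \<tau> = 0"
  proof (induction m rule: int_induct[where k = 0])
    case (step1 i)
    then show ?case using step(1)[of "of_int i"] by simp
  next
    case (step2 i)
    then show ?case using step(1)[of "of_int i - 1"] by simp
  qed simp
  then show ?thesis
  proof (induction n rule: int_induct[where k = 0])
    case (step1 i)
    then show ?case using step(2)[of "of_int m + of_int i * \<tau>"] by (simp add: algebra_simps)
  next
    case (step2 i)
    then show ?case using step(2)[of "of_int m + of_int i * \<tau> - \<tau>"] by (simp add: algebra_simps)
  qed simp
qed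

text \<open>
  For real coordinates the point \<open>k (A \<tau> + B)\<close> lies in the lattice if and only if \<open>k A\<close> and \<open>k B\<close> are
  integers. In particular the order of a torsion point does not depend on \<open>\<tau>\<close>.
\<close>
lemma theta1_torsion_zero_iff:
  assumes \<tau>: "Im \<tau> > 0" and N: "N \<noteq> 0"
  shows "theta1 (of_nat k * torsion_point \<nu> \<mu> N \<tau>) \<tau> = 0 \<longleftrightarrow> 2 * N dvd int k * \<nu> \<and> 2 * N dvd int k * \<mu>"
proof
  assume "theta1 (of_nat k * torsion_point \<nu> \<mu> N \<tau>) \<tau> = 0"
  then obtain m n :: int where mn: "of_nat k * torsion_point \<nu> \<mu> N \<tau> = of_int m + of_int n * \<tau>"
    using theta1_zeros[OF \<tau>] by metis
  have N': "(of_int N :: complex) \<noteq> 0" "real_of_int N \<noteq> 0" using N by simp_all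
  have e: "of_int (int k * \<mu> - 2 * N * m) + of_int (int k * \<nu> - 2 * N * n) * \<tau> = 0"
  proof -
    have "of_int (int k * \<mu>) + of_int (int k * \<nu>) * \<tau> = 2 * of_int N * (of_nat k * torsion_point \<nu> \<mu> N \<tau>)"
      using N' by (simp add: torsion_point_def field_simps)
    then show ?thesis unfolding mn by (simp add: algebra_simps)
  qed
  from arg_cong[OF e, of Im] have "real_of_int (int k * \<nu> - 2 * N * n) * Im \<tau> = 0" by simp
  then have "real_of_int (int k * \<nu> - 2 * N * n) = 0" using \<tau> by (subst (asm) mult_eq_0_iff) auto
  then have 1: "int k * \<nu> - 2 * N * n = 0" unfolding of_int_eq_0_iff .
  from e have "(of_int (int k * \<mu> - 2 * N * m) :: complex) = 0" unfolding 1 by simp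
  then have 2: "int k * \<mu> - 2 * N * m = 0" unfolding of_int_eq_0_iff .
  from 1 2 show "2 * N dvd int k * \<nu> \<and> 2 * N dvd int k * \<mu>" by (metis dvd_triv_left eq_iff_diff_eq_0)
next
  assume "2 * N dvd int k * \<nu> \<and> 2 * N dvd int k * \<mu>"
  then obtain n m where nm: "int k * \<nu> = 2 * N * n" "int k * \<mu> = 2 * N * m" by (auto simp: dvd_def)
  have N': "(of_int N :: complex) \<noteq> 0" using N by simp
  have "of_nat k * torsion_point \<nu> \<mu> N \<tau> = (of_int (int k * \<mu>) + of_int (int k * \<nu>) * \<tau>) / (2 * of_int N)"
    using N' by (simp add: torsion_point_def field_simps)
  also have "\<dots> = of_int m + of_int n * \<tau>" unfolding nm using N' by (simp add: field_simps)
  finally show "theta1 (of_nat k * torsion_point \<nu> \<mu> N \<tau>) \<tau> = 0" by (simp add: theta1_lattice)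
qed

locale hitchin_torsion =
  fixes \<nu> \<mu> N :: int
  assumes N: "N \<noteq> 0" and not_half_period: "\<not> (N dvd \<nu> \<and> N dvd \<mu>)"
begin

definition A where "A = real_of_int \<nu> / (2 * real_of_int N)"
definition B where "B = real_of_int \<mu> / (2 * real_of_int N)"

lemma torsion_point_eq: "torsion_point \<nu> \<mu> N \<tau> = of_real B + of_real A * \<tau>"
  by (simp add: torsion_point_def A_def B_def)

sublocale shifted_point A B
proof
  fix \<tau> :: complex assume \<tau>: "Im \<tau> > 0"
  show "theta1 (2 * (of_real B + of_real A * \<tau>)) \<tau> \<noteq> 0"
    using theta1_torsion_zero_iff[OF \<tau> N, of 2 \<nu> \<mu>] not_half_period unfolding torsion_point_eq[symmetric] by auto
qed

lemma theta1_torsion_nonzero: "Im \<tau> > 0 \<Longrightarrow> theta1 (torsion_point \<nu> \<mu> N \<tau>) \<tau> \<noteq> 0"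
  using f_nonzero(1)[of \<tau>] by (auto simp: f1_def stheta_eq torsion_point_eq)

lemma hitchin_denom_eq:
  assumes \<tau>: "Im \<tau> > 0"
  shows "f1 1 \<tau> = shift_factor A (of_real B) \<tau> * hitchin_denom \<nu> \<mu> N \<tau>"
proof -
  have "theta1' z \<tau> = stheta1 0 1 z \<tau>" for z
    unfolding theta1'_def
    by (rule DERIV_imp_deriv, rule stheta_deriv_z(1)[OF \<tau>, of 0 0 z, unfolded stheta_0 One_nat_def[symmetric]])
  moreover have "2 * pi * \<i> * of_real A = pi * \<i> * (of_int \<nu> / of_int N)" using N by (simp add: A_def field_simps)
  ultimately show ?thesis
    unfolding f1_def stheta_derivatives(1)[OF \<tau>, of A] hitchin_denom_def Let_def torsion_point_eq by simp
qed

lemma hitchin_denom_zero_iff: "Im \<tau> > 0 \<Longrightarrow> hitchin_denom \<nu> \<mu> N \<tau> = 0 \<longleftrightarrow> p \<tau> = 0"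
  using hitchin_denom_eq[of \<tau>] t_nonzero(1)[of \<tau>] v_nonzero[of \<tau>] f_nonzero(1)[of \<tau>] theta_constants_nonzero(2)[of \<tau>]
  by (auto simp: p_def Z_def shift_factor_def)

text \<open>
  The shift factor cancels, since numerator and denominator have the same degree in the theta functions
  at the torsion point. At a zero of the denominator both sides reduce to \<open>q\<close>, because a quotient by
  zero is zero.
\<close>
lemma hitchin_y_eq:
  assumes \<tau>: "Im \<tau> > 0"
  shows "hitchin_y \<nu> \<mu> N \<tau> = y \<tau>"
proof -
  define z where "z = torsion_point \<nu> \<mu> N \<tau>"
  define E where "E = shift_factor A (of_real B) \<tau>"
  have E: "E \<noteq> 0" by (simp add: E_def shift_factor_def)
  note cnz = theta_constants_nonzero[OF \<tau>]
  have f: "f1 0 \<tau> = E * theta1 z \<tau>" "f2 0 \<tau> = E * theta2 z \<tau>" "f3 0 \<tau> = E * theta3 z \<tau>" "f4 0 \<tau> = E * theta4 z \<tau>"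
    "f1 1 \<tau> = E * hitchin_denom \<nu> \<mu> N \<tau>"
    using hitchin_denom_eq[OF \<tau>] by (simp_all add: f1_def f2_def f3_def f4_def stheta_eq E_def z_def torsion_point_eq)
  have nz: "theta1 z \<tau> \<noteq> 0" using theta1_torsion_nonzero[OF \<tau>] by (simp add: z_def)
  have s: "s \<tau> = (theta2 z \<tau>)\<^sup>2 / (theta1 z \<tau>)\<^sup>2" unfolding s_def f using E by (simp add: power_divide)
  show ?thesis
  proof (cases "hitchin_denom \<nu> \<mu> N \<tau> = 0")
    case True
    then have "p \<tau> = 0" using hitchin_denom_zero_iff[OF \<tau>] by simp
    then show ?thesis using True
      by (simp add: hitchin_y_def y_def q_def s t_def z_def[symmetric] Let_def power2_eq_square)
  next
    case False
    have "1 / (2 * p \<tau>) = t \<tau> * (v \<tau> / Z \<tau>)" by (simp add: p_def)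
    also have "v \<tau> / Z \<tau> = pi * (theta2 0 \<tau>)\<^sup>2 * theta2 z \<tau> * theta3 z \<tau> * theta4 z \<tau> / ((theta1 z \<tau>)\<^sup>2 * hitchin_denom \<nu> \<mu> N \<tau>)"
      unfolding v_def Z_def f using E nz False cnz by (simp add: field_simps power2_eq_square power3_eq_cube)
    finally show ?thesis
      unfolding y_def hitchin_y_def Let_def q_def s z_def[symmetric] t_def[symmetric]
      using nz False by (simp add: field_simps power2_eq_square)
  qed
qed

lemma hitchin_exceptional_eq:
  "hitchin_exceptional \<nu> \<mu> N = {\<tau> \<in> upper_half_plane. p \<tau> = 0 \<or> y \<tau> = 0 \<or> y \<tau> = 1 \<or> y \<tau> = x \<tau>}"
  unfolding hitchin_exceptional_def
  by (auto simp: upper_half_plane_simps theta1_torsion_nonzero hitchin_denom_zero_iff hitchin_y_eq hitchin_x_eq_x)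

lemma hitchin_y_meromorphic: "hitchin_y \<nu> \<mu> N meromorphic_on upper_half_plane"
proof -
  have "q analytic_on upper_half_plane" "p analytic_on upper_half_plane"
    using q_holomorphic p_holomorphic by (simp_all add: analytic_on_open upper_half_plane_simps)
  then have "y meromorphic_on upper_half_plane"
    unfolding y_def[abs_def] by (intro meromorphic_intros analytic_on_imp_meromorphic_on)
  moreover have "eventually (\<lambda>\<tau>. hitchin_y \<nu> \<mu> N \<tau> = y \<tau>) (at z)" if "z \<in> upper_half_plane" for z
    using eventually_at_in_open'[OF upper_half_plane_simps(1) that]
    by eventually_elim (simp add: upper_half_plane_simps hitchin_y_eq)
  ultimately show ?thesis using meromorphic_on_cong[of upper_half_plane "hitchin_y \<nu> \<mu> N" y upper_half_plane] by blast
qed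

lemma q_algebraic:
  obtains F where "F \<noteq> 0" "\<And>\<tau>. Im \<tau> > 0 \<Longrightarrow> eval_poly2 F (x \<tau>) (q \<tau>) = 0"
proof -
  define P where "P = (\<lambda>k. k \<ge> 1 \<and> 2 * N dvd int k * \<nu> \<and> 2 * N dvd int k * \<mu>)"
  define n where "n = (LEAST k. P k)"
  have "P (nat \<bar>2 * N\<bar>)" using N by (auto simp: P_def)
  then have n: "P n" unfolding n_def by (rule LeastI)
  have least: "\<not> P k" if "k < n" for k using not_less_Least that unfolding n_def by blast
  \<comment> \<open>Orders \<open>1\<close> and \<open>2\<close> are the half-periods.\<close>
  have "n \<noteq> 1" "n \<noteq> 2"
    using n not_half_period by (auto simp: P_def dest: dvd_mult_right)
  with n have n3: "n \<ge> 3" by (auto simp: P_def)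
  obtain F where F: "F \<noteq> 0"
    "\<And>\<tau> z. Im \<tau> > 0 \<Longrightarrow> theta1 (of_nat n * z) \<tau> = 0 \<Longrightarrow> (\<And>i. i \<in> {1..<n} \<Longrightarrow> theta1 (of_nat i * z) \<tau> \<noteq> 0) \<Longrightarrow>
       eval_poly2 F (hitchin_x \<tau>) (picard_q z \<tau>) = 0"
    using picard_q_torsion_algebraic[OF infinite_x n3] by blast
  have "eval_poly2 F (x \<tau>) (q \<tau>) = 0" if \<tau>: "Im \<tau> > 0" for \<tau>
    unfolding q_picard hitchin_x_eq_x[symmetric] torsion_point_eq[symmetric]
    by (rule F(2)[OF \<tau>]) (use n least in \<open>auto simp: theta1_torsion_zero_iff[OF \<tau> N] P_def\<close>)
  with F(1) show ?thesis by (rule that)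
qed

end

theorem theorem5:
  fixes \<nu> \<mu> N :: int
  assumes "N \<noteq> 0"
    and not_half_period: "\<not> (N dvd \<nu> \<and> N dvd \<mu>)"
  shows "hitchin_x holomorphic_on upper_half_plane
       \<and> hitchin_y \<nu> \<mu> N meromorphic_on upper_half_plane
       \<and> hitchin_exceptional \<nu> \<mu> N sparse_in upper_half_plane
       \<and> (\<exists>F :: complex poly poly. irreducible F
           \<and> (\<forall>\<tau>\<in>upper_half_plane.
                theta1 (torsion_point \<nu> \<mu> N \<tau>) \<tau> \<noteq> 0 \<and> hitchin_denom \<nu> \<mu> N \<tau> \<noteq> 0 \<longrightarrow>
                eval_poly2 F (hitchin_x \<tau>) (hitchin_y \<nu> \<mu> N \<tau>) = 0)
           \<and> (\<forall>\<tau>\<^sub>0 \<in> upper_half_plane - hitchin_exceptional \<nu> \<mu> N.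
                \<exists>V Y. open V \<and> \<tau>\<^sub>0 \<in> V \<and> V \<subseteq> upper_half_plane \<and> inj_on hitchin_x V
                  \<and> algebraic_painleve6_solution_on (1/8) (1/8) (1/8) (1/8) F (hitchin_x ` V) Y
                  \<and> (\<forall>\<tau>\<in>V. Y (hitchin_x \<tau>) = hitchin_y \<nu> \<mu> N \<tau>)))"
proof -
  interpret hitchin_torsion \<nu> \<mu> N by standard (fact assms)+
  note H = upper_half_plane_simps(3)
  have x: "hitchin_x = x" by (rule ext) (rule hitchin_x_eq_x)
  obtain R where R: "R \<noteq> 0" "\<And>\<tau>. Im \<tau> > 0 \<Longrightarrow> eval_poly2 R (x \<tau>) (q \<tau>) = 0" using q_algebraic by blast
  obtain F where F: "irreducible F" "\<And>\<tau>. Im \<tau> > 0 \<Longrightarrow> p \<tau> \<noteq> 0 \<Longrightarrow> eval_poly2 F (x \<tau>) (y \<tau>) = 0"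
    using y_algebraic[OF R] by blast
  show ?thesis
  proof (intro conjI exI[of _ F] ballI impI)
    show "hitchin_x holomorphic_on upper_half_plane" unfolding x by (rule x_holomorphic)
    show "hitchin_y \<nu> \<mu> N meromorphic_on upper_half_plane" by (rule hitchin_y_meromorphic)
    show "hitchin_exceptional \<nu> \<mu> N sparse_in upper_half_plane"
      unfolding hitchin_exceptional_eq by (rule exceptional_sparse)
    show "irreducible F" by (rule F)
    show "eval_poly2 F (hitchin_x \<tau>) (hitchin_y \<nu> \<mu> N \<tau>) = 0"
      if "\<tau> \<in> upper_half_plane" "theta1 (torsion_point \<nu> \<mu> N \<tau>) \<tau> \<noteq> 0 \<and> hitchin_denom \<nu> \<mu> N \<tau> \<noteq> 0" for \<tau>
      using that F(2)[of \<tau>] by (auto simp: H x hitchin_y_eq hitchin_denom_zero_iff)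
    fix \<tau>\<^sub>0 assume "\<tau>\<^sub>0 \<in> upper_half_plane - hitchin_exceptional \<nu> \<mu> N"
    then have \<tau>0: "Im \<tau>\<^sub>0 > 0" "p \<tau>\<^sub>0 \<noteq> 0" "y \<tau>\<^sub>0 \<noteq> 0" "y \<tau>\<^sub>0 \<noteq> 1" "y \<tau>\<^sub>0 \<noteq> x \<tau>\<^sub>0"
      by (auto simp: hitchin_exceptional_eq H)
    obtain V Y where V: "open V" "\<tau>\<^sub>0 \<in> V" "V \<subseteq> {\<tau> \<in> upper_half_plane. p \<tau> \<noteq> 0}" "inj_on x V"
      "painleve6_solution_on (1/8) (1/8) (1/8) (1/8) (x ` V) Y" "\<And>\<tau>. \<tau> \<in> V \<Longrightarrow> Y (x \<tau>) = y \<tau>"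
      using local_painleve6_solution[OF \<tau>0] by blast
    have "algebraic_painleve6_solution_on (1/8) (1/8) (1/8) (1/8) F (hitchin_x ` V) Y"
      unfolding algebraic_painleve6_solution_on_def x
      using V F by (auto simp: H)
    moreover have "\<forall>\<tau>\<in>V. Y (hitchin_x \<tau>) = hitchin_y \<nu> \<mu> N \<tau>"
      using V by (auto simp: x H hitchin_y_eq)
    moreover have "V \<subseteq> upper_half_plane" using V by blast
    ultimately show "\<exists>V Y. open V \<and> \<tau>\<^sub>0 \<in> V \<and> V \<subseteq> upper_half_plane \<and> inj_on hitchin_x V
        \<and> algebraic_painleve6_solution_on (1/8) (1/8) (1/8) (1/8) F (hitchin_x ` V) Y
        \<and> (\<forall>\<tau>\<in>V. Y (hitchin_x \<tau>) = hitchin_y \<nu> \<mu> N \<tau>)"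
      using V(1,2,4) unfolding x by blast
  qed
qed

end
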